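(* Let $(X,d,\mu,\mathcal E,\mathcal F)$ be a sub-Gaussian Dirichlet space with parameters $d_H,d_W$ that satisfies $wBE(\kappa)$ with $\kappa=d_W-\lambda_1^\#$. There is a constant $C>0$ such that for every Borel set $E\subset X$, $$P(E)\le C\,\mathcal C^*_{d_W-\kappa}(E).$$ In particular, any such set $E$ for which $\bigcap_{r>0}\partial_r^*E$ has finite $(d_W-\kappa)$-codimensional lower Minkowski content has finite perimeter.
   Context: A sub-Gaussian Dirichlet space $(X,d,\mu,\mathcal E,\mathcal F)$ with parameters $d_H,d_W$ means: $(X,d,\mu)$ is a locally compact metric measure space, $\mu$ is a Radon measure supported on $X$, $(\mathcal E,\mathcal F)$ is a Dirichlet form on $L^2(X,\mu)$, and (i) every ball $B(x,r)=\{y: d(x,y)<r\}$, $x\in X$, $0<r<\infty$, has compact closure; (ii) $\mu$ is Ahlfors $d_H$-regular: there are $c_1,c_2,d_H\in(0,\infty)$ with $c_1r^{d_H}\le\mu(B(x,r))\le c_2r^{d_H}$ for all $x\in X$, $r\in[0,\infty)$; (iii) $\mathcal E$ is regular and strongly local (i.e. $\mathcal E(u,v)=0$ for $u,v\in\mathcal F$ with compact supports such that $u$ is constant in a neighborhood of the support of $v$); (iv) the heat semigroup $\{P_t\}$ of $(\mathcal E,\mathcal F)$ has a continuous heat kernel $p_t(x,y)$ (so $P_tg(x)=\int_Xp_t(x,y)g(y)\,d\mu(y)$) satisfying, for some $c_3,c_4,c_5,c_6\in(0,\infty)$ and $d_W\in(2,\infty)$, $$c_5t^{-d_H/d_W}\exp\Big(-c_6\Big(\tfrac{d(x,y)^{d_W}}{t}\Big)^{\frac1{d_W-1}}\Big)\le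 p_t(x,y)\le c_3t^{-d_H/d_W}\exp\Big(-c_4\Big(\tfrac{d(x,y)^{d_W}}{t}\Big)^{\frac1{d_W-1}}\Big)$$ for $\mu\times\mu$-a.e. $(x,y)$ and all $t>0$. $X$ satisfies $wBE(\kappa)$ if $0<\kappa<d_W$ and there is $C>0$ such that $|P_tg(x)-P_tg(y)|\le C\frac{d(x,y)^\kappa}{t^{\kappa/d_W}}\|g\|_{L^\infty(X,\mu)}$ for all $t>0$, $g\in L^\infty(X,\mu)$, $x,y\in X$. Let $\Delta_r=\{(x,y)\in X\times X: d(x,y)<r\}$. For $\lambda>0$, $KS^{\lambda,1}(X)$ is the set of $f\in L^1(X,\mu)$ such that $\limsup_{r\to0^+}\iint_{\Delta_r}\frac{|f(y)-f(x)|}{r^\lambda\mu(B(x,r))}\,d\mu(y)\,d\mu(x)<\infty$. Set $\lambda_1^\#=\sup\{\lambda>0: KS^{\lambda,1}(X)\text{ contains non-constant functions}\}$, $BV(X)=KS^{\lambda_1^\#,1}(X)$, and for $f\in BV(X)$ $$\mathbf{Var}(f)=\liminf_{r\to0^+}\iint_{\Delta_r}\frac{|f(y)-f(x)|}{r^{\lambda_1^\#}\mu(B(x,r))}\,d\mu(y)\,d\mu(x).$$ A Borel set $E\subset X$ has finite perimeter if $\mathbf 1_E\in BV(X)$; in that case its perimeter is $P(E)=\mathbf{Var}(\mathbf 1_E)$. For a Borel set $E$: $E^*=\{x:\limsup_{r\to0^+}\mu(B(x,r)\cap E)/\mu(B(x,r))>0\}$, $E_r=\{x:\mu(B(x,r)\cap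 E)>0\}$, and likewise $(E^c)^*$ and $(E^c)_r$ for the complement $E^c$; the measure-theoretic $r$-neighborhood is $\partial_r^*E=(E^*\cap(E^c)_r)\cup((E^c)^*\cap E_r)$. The $(d_W-\kappa)$-codimensional lower Minkowski content is $$\mathcal C^*_{d_W-\kappa}(E)=\liminf_{r\to0^+}\frac1{r^{d_W-\kappa}}\mu(\partial_r^*E);$$ it is expressed through the neighborhoods $\partial_r^*E$, whose intersection is $\bigcap_{r>0}\partial_r^*E$, and it is the only lower Minkowski content defined here.
   Formalization: In the "in particular" clause E is also assumed to have finite measure; without this the clause fails for E = X, whose content is 0 while its indicator is not in L^1, and finite perimeter always forces finite measure. *)

theory Defs
  imports "HOL-Analysis.Analysis" "HOL-Probability.Essential_Supremum"
begin

section \<open>Function spaces and measures\<close>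

text \<open>Elements of the Lebesgue spaces are represented by functions; everything below is
  invariant under, or explicitly closed under, changes on null sets.\<close>

definition L2_space :: "'a measure \<Rightarrow> ('a \<Rightarrow> real) set" where
  "L2_space M = {u. u \<in> borel_measurable M \<and> integrable M (\<lambda>x. (u x)\<^sup>2)}"

definition Linf_norm :: "'a measure \<Rightarrow> ('a \<Rightarrow> real) \<Rightarrow> ereal" where
  "Linf_norm M g = esssup M (\<lambda>x. ereal \<bar>g x\<bar>)"

definition Linf_space :: "'a measure \<Rightarrow> ('a \<Rightarrow> real) set" where
  "Linf_space M = {g. g \<in> borel_measurable M \<and> Linf_norm M g < \<infinity>}"

text \<open>Continuous functions with compact support.\<close>

definition Cc_space :: "('a::topological_space \<Rightarrow> real) set" where
  "Cc_space = {f. continuous_on UNIV f \<and> compact (closure {x. f x \<noteq> 0})}"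

text \<open>The support of the class of \<open>u\<close> modulo null sets: the complement of the
  union of all open sets on which \<open>u\<close> vanishes almost everywhere.\<close>

definition ess_support :: "'a::topological_space measure \<Rightarrow> ('a \<Rightarrow> real) \<Rightarrow> 'a set" where
  "ess_support M u = - \<Union>{U. open U \<and> (AE x in M. x \<in> U \<longrightarrow> u x = 0)}"

definition radon_measure :: "'a::metric_space measure \<Rightarrow> bool" where
  "radon_measure M \<longleftrightarrow> sets M = sets borel \<and>
     (\<forall>K. compact K \<longrightarrow> emeasure M K < \<infinity>) \<and>
     (\<forall>A \<in> sets borel. emeasure M A = (SUP K \<in> {K. compact K \<and> K \<subseteq> A}. emeasure M K))"

definition fully_supported :: "'a::metric_space measure \<Rightarrow> bool" where
  "fully_supported M \<longleftrightarrow> (\<forall>U. open U \<longrightarrow> U \<noteq> {} \<longrightarrow> emeasure M U > 0)"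

definition ahlfors_regular :: "'a::metric_space measure \<Rightarrow> real \<Rightarrow> bool" where
  "ahlfors_regular M dH \<longleftrightarrow> dH > 0 \<and> (\<exists>c1>0. \<exists>c2>0. \<forall>x. \<forall>r\<ge>0.
     ennreal (c1 * r powr dH) \<le> emeasure M (ball x r) \<and>
     emeasure M (ball x r) \<le> ennreal (c2 * r powr dH))"


section \<open>Dirichlet forms\<close>

definition form_norm1 ::
    "'a measure \<Rightarrow> (('a \<Rightarrow> real) \<Rightarrow> ('a \<Rightarrow> real) \<Rightarrow> real) \<Rightarrow> ('a \<Rightarrow> real) \<Rightarrow> real" where
  "form_norm1 M \<E> u = sqrt (\<E> u u + (\<integral>x. (u x)\<^sup>2 \<partial>M))"

text \<open>A Dirichlet form: a densely defined, closed, symmetric, nonnegative definite bilinear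
  form on which the unit contraction operates. The first two assumptions after
  \<open>dom_L2\<close> say that domain and form live on classes modulo null sets.\<close>

locale dirichlet_form =
  fixes M :: "'a measure"
    and \<E> :: "('a \<Rightarrow> real) \<Rightarrow> ('a \<Rightarrow> real) \<Rightarrow> real"
    and \<F> :: "('a \<Rightarrow> real) set"
  assumes dom_L2: "\<F> \<subseteq> L2_space M"
    and dom_AE: "\<lbrakk>u \<in> \<F>; v \<in> borel_measurable M; AE x in M. u x = v x\<rbrakk> \<Longrightarrow> v \<in> \<F>"
    and form_AE: "\<lbrakk>u \<in> \<F>; v \<in> \<F>; w \<in> \<F>; AE x in M. u x = v x\<rbrakk> \<Longrightarrow> \<E> u w = \<E> v w"
    and dom_zero: "(\<lambda>x. 0) \<in> \<F>"
    and dom_add: "\<lbrakk>u \<in> \<F>; v \<in> \<F>\<rbrakk> \<Longrightarrow> (\<lambda>x. u x + v x) \<in> \<F>"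
    and dom_scale: "u \<in> \<F> \<Longrightarrow> (\<lambda>x. c * u x) \<in> \<F>"
    and form_sym: "\<lbrakk>u \<in> \<F>; v \<in> \<F>\<rbrakk> \<Longrightarrow> \<E> u v = \<E> v u"
    and form_add: "\<lbrakk>u \<in> \<F>; v \<in> \<F>; w \<in> \<F>\<rbrakk> \<Longrightarrow> \<E> (\<lambda>x. u x + v x) w = \<E> u w + \<E> v w"
    and form_scale: "\<lbrakk>u \<in> \<F>; w \<in> \<F>\<rbrakk> \<Longrightarrow> \<E> (\<lambda>x. c * u x) w = c * \<E> u w"
    and form_nonneg: "u \<in> \<F> \<Longrightarrow> \<E> u u \<ge> 0"
    and dom_dense: "\<lbrakk>u \<in> L2_space M; \<epsilon> > 0\<rbrakk> \<Longrightarrow> \<exists>v\<in>\<F>. (\<integral>x. (u x - v x)\<^sup>2 \<partial>M) < \<epsilon>"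
    and form_closed:
      "\<lbrakk>\<And>n::nat. f n \<in> \<F>;
        \<And>\<epsilon>. \<epsilon> > 0 \<Longrightarrow> \<exists>N. \<forall>m\<ge>N. \<forall>n\<ge>N. form_norm1 M \<E> (\<lambda>x. f m x - f n x) < \<epsilon>\<rbrakk>
       \<Longrightarrow> \<exists>u\<in>\<F>. (\<lambda>n. form_norm1 M \<E> (\<lambda>x. f n x - u x)) \<longlonglongrightarrow> 0"
    and form_markov:
      "u \<in> \<F> \<Longrightarrow> (\<lambda>x. min (max (u x) 0) 1) \<in> \<F> \<and>
         \<E> (\<lambda>x. min (max (u x) 0) 1) (\<lambda>x. min (max (u x) 0) 1) \<le> \<E> u u"

text \<open>Regularity: \<open>\<F> \<inter> C\<^sub>c\<close> is dense in \<open>\<F>\<close> for the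
  form norm and in \<open>C\<^sub>c\<close> for the supremum norm.\<close>

definition regular_form ::
    "'a::metric_space measure \<Rightarrow> (('a \<Rightarrow> real) \<Rightarrow> ('a \<Rightarrow> real) \<Rightarrow> real) \<Rightarrow> ('a \<Rightarrow> real) set \<Rightarrow> bool" where
  "regular_form M \<E> \<F> \<longleftrightarrow>
     (\<forall>u\<in>\<F>. \<forall>\<epsilon>>0. \<exists>v \<in> \<F> \<inter> Cc_space. form_norm1 M \<E> (\<lambda>x. u x - v x) < \<epsilon>) \<and>
     (\<forall>u\<in>Cc_space. \<forall>\<epsilon>>0. \<exists>v \<in> \<F> \<inter> Cc_space. \<forall>x. \<bar>u x - v x\<bar> < \<epsilon>)"

definition strongly_local_form ::
    "'a::metric_space measure \<Rightarrow> (('a \<Rightarrow> real) \<Rightarrow> ('a \<Rightarrow> real) \<Rightarrow> real) \<Rightarrow> ('a \<Rightarrow> real) set \<Rightarrow> bool" where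
  "strongly_local_form M \<E> \<F> \<longleftrightarrow>
     (\<forall>u\<in>\<F>. \<forall>v\<in>\<F>. compact (ess_support M u) \<longrightarrow> compact (ess_support M v) \<longrightarrow>
        (\<exists>U c. open U \<and> ess_support M v \<subseteq> U \<and> (AE x in M. x \<in> U \<longrightarrow> u x = c)) \<longrightarrow>
        \<E> u v = 0)"


section \<open>Heat semigroup and heat kernel\<close>

text \<open>The graph of the generator \<open>L\<close> of the form, characterised by
  \<open>\<E> u v = - \<langle>L u, v\<rangle>\<close> for all \<open>v \<in> \<F>\<close>.\<close>

definition form_generator ::
    "'a measure \<Rightarrow> (('a \<Rightarrow> real) \<Rightarrow> ('a \<Rightarrow> real) \<Rightarrow> real) \<Rightarrow> ('a \<Rightarrow> real) set
      \<Rightarrow> ('a \<Rightarrow> real) \<Rightarrow> ('a \<Rightarrow> real) \<Rightarrow> bool" where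
  "form_generator M \<E> \<F> u w \<longleftrightarrow>
     u \<in> \<F> \<and> w \<in> L2_space M \<and> (\<forall>v\<in>\<F>. \<E> u v = - (\<integral>x. w x * v x \<partial>M))"

text \<open>The graph of the infinitesimal generator of a semigroup on \<open>L\<^sup>2\<close>
  (strong derivative at time zero).\<close>

definition semigroup_generator ::
    "'a measure \<Rightarrow> (real \<Rightarrow> ('a \<Rightarrow> real) \<Rightarrow> 'a \<Rightarrow> real) \<Rightarrow> ('a \<Rightarrow> real) \<Rightarrow> ('a \<Rightarrow> real) \<Rightarrow> bool" where
  "semigroup_generator M P u w \<longleftrightarrow>
     u \<in> L2_space M \<and> w \<in> L2_space M \<and>
     ((\<lambda>t. \<integral>x. ((P t u x - u x) / t - w x)\<^sup>2 \<partial>M) \<longlongrightarrow> 0) (at_right 0)"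

text \<open>The heat semigroup \<open>P\<^sub>t = exp (t L)\<close> of the form: the strongly continuous
  contraction semigroup on \<open>L\<^sup>2\<close> whose generator is that of the form. These conditions
  determine \<open>P t u\<close>, \<open>t > 0\<close>, up to null sets; times \<open>t \<le> 0\<close> play no role.\<close>

locale heat_semigroup =
  fixes M :: "'a measure"
    and \<E> :: "('a \<Rightarrow> real) \<Rightarrow> ('a \<Rightarrow> real) \<Rightarrow> real"
    and \<F> :: "('a \<Rightarrow> real) set"
    and P :: "real \<Rightarrow> ('a \<Rightarrow> real) \<Rightarrow> 'a \<Rightarrow> real"
  assumes P_L2: "\<lbrakk>t > 0; u \<in> L2_space M\<rbrakk> \<Longrightarrow> P t u \<in> L2_space M"
    and P_AE: "\<lbrakk>t > 0; u \<in> L2_space M; v \<in> L2_space M; AE x in M. u x = v x\<rbrakk>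
                 \<Longrightarrow> AE x in M. P t u x = P t v x"
    and P_add: "\<lbrakk>t > 0; u \<in> L2_space M; v \<in> L2_space M\<rbrakk>
                 \<Longrightarrow> AE x in M. P t (\<lambda>y. u y + v y) x = P t u x + P t v x"
    and P_scale: "\<lbrakk>t > 0; u \<in> L2_space M\<rbrakk> \<Longrightarrow> AE x in M. P t (\<lambda>y. c * u y) x = c * P t u x"
    and P_contraction: "\<lbrakk>t > 0; u \<in> L2_space M\<rbrakk>
                 \<Longrightarrow> (\<integral>x. (P t u x)\<^sup>2 \<partial>M) \<le> (\<integral>x. (u x)\<^sup>2 \<partial>M)"
    and P_semigroup: "\<lbrakk>s > 0; t > 0; u \<in> L2_space M\<rbrakk>
                 \<Longrightarrow> AE x in M. P (s + t) u x = P s (P t u) x"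
    and P_continuous: "u \<in> L2_space M
                 \<Longrightarrow> ((\<lambda>t. \<integral>x. (P t u x - u x)\<^sup>2 \<partial>M) \<longlongrightarrow> 0) (at_right 0)"
    and P_generator: "semigroup_generator M P u w \<longleftrightarrow> form_generator M \<E> \<F> u w"

definition kernel_op ::
    "'a measure \<Rightarrow> (real \<Rightarrow> 'a \<Rightarrow> 'a \<Rightarrow> real) \<Rightarrow> real \<Rightarrow> ('a \<Rightarrow> real) \<Rightarrow> 'a \<Rightarrow> real" where
  "kernel_op M p t g x = (\<integral>y. p t x y * g y \<partial>M)"

text \<open>Continuity is required in the space variables for each fixed time.\<close>

definition continuous_heat_kernel ::
    "'a::metric_space measure \<Rightarrow> (('a \<Rightarrow> real) \<Rightarrow> ('a \<Rightarrow> real) \<Rightarrow> real) \<Rightarrow> ('a \<Rightarrow> real) set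
      \<Rightarrow> (real \<Rightarrow> 'a \<Rightarrow> 'a \<Rightarrow> real) \<Rightarrow> bool" where
  "continuous_heat_kernel M \<E> \<F> p \<longleftrightarrow>
     (\<forall>t>0. continuous_on UNIV (\<lambda>(x, y). p t x y)) \<and>
     (\<exists>P. heat_semigroup M \<E> \<F> P \<and>
        (\<forall>t>0. \<forall>g\<in>L2_space M. AE x in M. P t g x = kernel_op M p t g x))"

definition sub_gaussian ::
    "real \<Rightarrow> real \<Rightarrow> real \<Rightarrow> real \<Rightarrow> real \<Rightarrow> 'a::metric_space \<Rightarrow> 'a \<Rightarrow> real" where
  "sub_gaussian dH dW a b t x y =
     a * t powr (- dH / dW) * exp (- b * (dist x y powr dW / t) powr (1 / (dW - 1)))"

definition sub_gaussian_bounds ::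
    "'a::metric_space measure \<Rightarrow> (real \<Rightarrow> 'a \<Rightarrow> 'a \<Rightarrow> real) \<Rightarrow> real \<Rightarrow> real \<Rightarrow> bool" where
  "sub_gaussian_bounds M p dH dW \<longleftrightarrow>
     (\<exists>c3>0. \<exists>c4>0. \<exists>c5>0. \<exists>c6>0. \<forall>t>0. AE (x, y) in M \<Otimes>\<^sub>M M.
        sub_gaussian dH dW c5 c6 t x y \<le> p t x y \<and> p t x y \<le> sub_gaussian dH dW c3 c4 t x y)"

text \<open>The space \<open>X\<close> is the whole type \<open>'a\<close>; local compactness is part of
  \<open>ball_compact\<close>.\<close>

locale sub_gaussian_dirichlet_space = dirichlet_form M \<E> \<F>
  for M :: "'a::metric_space measure"
    and \<E> :: "('a \<Rightarrow> real) \<Rightarrow> ('a \<Rightarrow> real) \<Rightarrow> real"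
    and \<F> :: "('a \<Rightarrow> real) set" +
  fixes p :: "real \<Rightarrow> 'a \<Rightarrow> 'a \<Rightarrow> real"
    and dH dW :: real
  assumes radon: "radon_measure M"
    and full_support: "fully_supported M"
    and ball_compact: "0 < r \<Longrightarrow> compact (closure (ball (x::'a) r))"
    and ahlfors: "ahlfors_regular M dH"
    and regular: "regular_form M \<E> \<F>"
    and strongly_local: "strongly_local_form M \<E> \<F>"
    and heat_kernel: "continuous_heat_kernel M \<E> \<F> p"
    and dW_gt_2: "dW > 2"
    and heat_kernel_bounds: "sub_gaussian_bounds M p dH dW"

text \<open>The weak Bakry-Emery condition. The semigroup acts on bounded functions through its
  continuous kernel, which gives a meaning to the values at every single point.\<close>

definition wBE ::
    "'a::metric_space measure \<Rightarrow> (real \<Rightarrow> 'a \<Rightarrow> 'a \<Rightarrow> real) \<Rightarrow> real \<Rightarrow> real \<Rightarrow> bool" where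
  "wBE M p dW \<kappa> \<longleftrightarrow> 0 < \<kappa> \<and> \<kappa> < dW \<and>
     (\<exists>C>0. \<forall>t>0. \<forall>g\<in>Linf_space M. \<forall>x y.
        ereal \<bar>kernel_op M p t g x - kernel_op M p t g y\<bar>
          \<le> ereal (C * (dist x y powr \<kappa> / t powr (\<kappa> / dW))) * Linf_norm M g)"


section \<open>Korevaar-Schoen and BV spaces, perimeter\<close>

definition KS_energy ::
    "'a::metric_space measure \<Rightarrow> real \<Rightarrow> ('a \<Rightarrow> real) \<Rightarrow> real \<Rightarrow> ennreal" where
  "KS_energy M l f r =
     (\<integral>\<^sup>+x. (\<integral>\<^sup>+y\<in>ball x r.
        ennreal \<bar>f y - f x\<bar> / (ennreal (r powr l) * emeasure M (ball x r)) \<partial>M) \<partial>M)"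

definition KS_space :: "'a::metric_space measure \<Rightarrow> real \<Rightarrow> ('a \<Rightarrow> real) set" where
  "KS_space M l = {f. integrable M f \<and> Limsup (at_right 0) (KS_energy M l f) < \<infinity>}"

text \<open>The exponent is taken in the extended reals, so that it is a genuine supremum.
  Non-constant means not almost everywhere equal to a constant.\<close>

definition critical_exponent :: "'a::metric_space measure \<Rightarrow> ereal" where
  "critical_exponent M =
     Sup (ereal ` {l. l > 0 \<and> (\<exists>f\<in>KS_space M l. \<not> (\<exists>c. AE x in M. f x = c))})"

text \<open>The conversion \<open>real_of_ereal\<close> is only relevant for a finite exponent, as is the
  case whenever \<open>\<kappa> = d\<^sub>W - \<lambda>\<close> for a real \<open>\<kappa>\<close>.\<close>

definition BV_space :: "'a::metric_space measure \<Rightarrow> ('a \<Rightarrow> real) set" where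
  "BV_space M = KS_space M (real_of_ereal (critical_exponent M))"

definition BV_variation :: "'a::metric_space measure \<Rightarrow> ('a \<Rightarrow> real) \<Rightarrow> ennreal" where
  "BV_variation M f = Liminf (at_right 0) (KS_energy M (real_of_ereal (critical_exponent M)) f)"

definition finite_perimeter :: "'a::metric_space measure \<Rightarrow> 'a set \<Rightarrow> bool" where
  "finite_perimeter M E \<longleftrightarrow> E \<in> sets borel \<and> (indicator E :: 'a \<Rightarrow> real) \<in> BV_space M"

text \<open>The defining formula is used for every Borel set. For a set that is not of finite
  perimeter it still gives a value in \<open>[0, \<infinity>]\<close>.\<close>

definition perimeter :: "'a::metric_space measure \<Rightarrow> 'a set \<Rightarrow> ennreal" where
  "perimeter M E = BV_variation M (indicator E)"


section \<open>Measure-theoretic neighbourhoods and Minkowski content\<close>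

definition upper_density_set :: "'a::metric_space measure \<Rightarrow> 'a set \<Rightarrow> 'a set" where
  "upper_density_set M E =
     {x. Limsup (at_right 0) (\<lambda>r. emeasure M (ball x r \<inter> E) / emeasure M (ball x r)) > 0}"

definition measure_nbhd :: "'a::metric_space measure \<Rightarrow> real \<Rightarrow> 'a set \<Rightarrow> 'a set" where
  "measure_nbhd M r E = {x. emeasure M (ball x r \<inter> E) > 0}"

definition boundary_nbhd :: "'a::metric_space measure \<Rightarrow> real \<Rightarrow> 'a set \<Rightarrow> 'a set" where
  "boundary_nbhd M r E =
     (upper_density_set M E \<inter> measure_nbhd M r (- E)) \<union>
     (upper_density_set M (- E) \<inter> measure_nbhd M r E)"

text \<open>The \<open>s\<close>-codimensional lower Minkowski content. It depends on the set \<open>E\<close> through its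
  neighbourhoods \<open>boundary_nbhd M r E\<close>, and is the content that is attributed to the
  measure-theoretic boundary of \<open>E\<close>, the intersection of these neighbourhoods.\<close>

definition lower_minkowski_content :: "'a::metric_space measure \<Rightarrow> real \<Rightarrow> 'a set \<Rightarrow> ennreal" where
  "lower_minkowski_content M s E =
     Liminf (at_right 0) (\<lambda>r. emeasure M (boundary_nbhd M r E) / ennreal (r powr s))"

end

(*
  The inequality P(E) <= C_*(E) is elementary, with constant 1: almost every point of E (of its
  complement) is a point of positive upper density, so the inner integral of the Korevaar-Schoen
  energy at scale r vanishes almost everywhere outside the r-neighbourhood of the boundary and is
  at most r^(-lambda) on it.

  For finite perimeter one has to pass from the lower to the upper limit of the energies, without
  knowing a priori that the upper limit is finite. Let Psi(t) be the heat that E, of finite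
  measure, loses up to time t. The sub-Gaussian bounds compare Psi(r^dW) with the energy at scale
  r: the tail of the kernel at time tau is a small multiple of the kernel at time N tau, and
  Psi(N tau) <= N Psi(tau). On the other hand Psi((k+1) tau) - Psi(k tau) = <1_E, w - P_tau w> for
  w = P_(k tau) 1_E, and wBE(kappa) bounds this by k^(-kappa/dW) Psi(tau); summing over k gives
  Psi(n tau) <= B n^(lambda/dW) Psi(tau). Hence one good small scale controls all larger scales.

  The argument needs the semigroup only through the symmetry of P_t, which follows from that of
  the generator once its domain is known to be dense, and through P_t 1 = 1, which is itself a
  consequence of wBE as t tends to infinity.
*)
theory Submission
  imports Defs
begin

section \<open>Square-integrable functions\<close>

text \<open>The exponents show why sharp growth of Psi is needed. Up to constants, also in the time
  variable, the energy at scale r is r^(-lambda) Psi(r^dW). Subadditivity alone gives Psi(r^dW)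
  \<le> const (r/rho)^dW Psi(rho^dW), so a bound at scale rho would reach scale r only with the
  factor (r/rho)^kappa, which is useless because the good scales rho are merely known to accumulate
  at 0. The increments do better: P_(k tau) 1_E is kappa-Hoelder with constant of order (k
  tau)^(-kappa/dW), while the kernel at time tau displaces points by about tau^(1/dW). The sum of
  k^(-kappa/dW) over k < n has order n^(1 - kappa/dW), and dW (1 - kappa/dW) = lambda, so the factor
  (r/rho)^lambda is cancelled exactly by the normalisation of the energies.

  The detour through time N tau is forced by the different constants \<open>c4\<close> and
  \<open>c6\<close> in the two exponential bounds: the kernel at a fixed time cannot be compared
  with itself, but its upper bound at tau lies below its lower bound at N tau with an exponential
  factor to spare.\<close>

lemma square_le_mult_of_nonneg_quadratic:
  fixes a b c :: real
  assumes nonneg: "\<And>s. 0 \<le> a + 2 * s * b + s\<^sup>2 * c" and c: "0 \<le> c"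
  shows "b\<^sup>2 \<le> a * c"
proof (cases "c = 0")
  case True
  have "b = 0"
  proof (rule ccontr)
    assume b: "b \<noteq> 0"
    have "a + 2 * (- (a + 1) / (2 * b)) * b = -1" using b by (simp add: field_simps)
    with nonneg[of "- (a + 1) / (2 * b)"] True show False by simp
  qed
  with True show ?thesis by simp
next
  case False
  with c have c: "c > 0" by simp
  have "0 \<le> a + 2 * (- b / c) * b + (- b / c)\<^sup>2 * c" by (rule nonneg)
  also have "\<dots> = a - b\<^sup>2 / c" using c by (simp add: field_simps power2_eq_square)
  finally show ?thesis using c by (simp add: field_simps)
qed

lemma tendsto_zero_of_square_le:
  fixes f g :: "'b \<Rightarrow> real"
  assumes le: "\<And>x. (f x)\<^sup>2 \<le> g x" and g: "(g \<longlongrightarrow> 0) F"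
  shows "(f \<longlongrightarrow> 0) F"
proof (rule Lim_null_comparison)
  show "\<forall>\<^sub>F x in F. norm (f x) \<le> sqrt (g x)"
    using real_sqrt_le_mono[OF le] by simp
  show "((\<lambda>x. sqrt (g x)) \<longlongrightarrow> 0) F" using tendsto_real_sqrt[OF g] by simp
qed

lemma L2_spaceD:
  assumes "u \<in> L2_space M"
  shows "u \<in> borel_measurable M" "integrable M (\<lambda>x. (u x)\<^sup>2)"
  using assms by (auto simp: L2_space_def)

lemma L2_integrable_mult:
  assumes u: "u \<in> L2_space M" and v: "v \<in> L2_space M"
  shows "integrable M (\<lambda>x. u x * v x)"
proof (rule Bochner_Integration.integrable_bound)
  show "integrable M (\<lambda>x. (u x)\<^sup>2 + (v x)\<^sup>2)"
    using L2_spaceD[OF u] L2_spaceD[OF v] by simp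
  show "(\<lambda>x. u x * v x) \<in> borel_measurable M"
    using L2_spaceD(1)[OF u] L2_spaceD(1)[OF v] by simp
  have "\<bar>a * b\<bar> \<le> a\<^sup>2 + b\<^sup>2" for a b :: real
  proof -
    have "0 \<le> (\<bar>a\<bar> - \<bar>b\<bar>)\<^sup>2" by simp
    then have "2 * (\<bar>a\<bar> * \<bar>b\<bar>) \<le> a\<^sup>2 + b\<^sup>2" unfolding power2_diff by simp
    moreover have "0 \<le> \<bar>a\<bar> * \<bar>b\<bar>" by simp
    ultimately show ?thesis unfolding abs_mult by linarith
  qed
  then show "AE x in M. norm (u x * v x) \<le> norm ((u x)\<^sup>2 + (v x)\<^sup>2)" by simp
qed

lemma L2_lincomb:
  assumes u: "u \<in> L2_space M" and v: "v \<in> L2_space M"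
  shows "(\<lambda>x. a * u x + b * v x) \<in> L2_space M"
proof -
  note [measurable] = L2_spaceD(1)[OF u] L2_spaceD(1)[OF v]
  have "(\<lambda>x. (a * u x + b * v x)\<^sup>2)
      = (\<lambda>x. a\<^sup>2 * (u x)\<^sup>2 + (2 * a * b) * (u x * v x) + b\<^sup>2 * (v x)\<^sup>2)"
    by (auto simp: fun_eq_iff power2_eq_square algebra_simps)
  moreover have "integrable M (\<lambda>x. a\<^sup>2 * (u x)\<^sup>2 + (2 * a * b) * (u x * v x) + b\<^sup>2 * (v x)\<^sup>2)"
    using L2_spaceD(2)[OF u] L2_spaceD(2)[OF v] L2_integrable_mult[OF u v]
    by (intro Bochner_Integration.integrable_add integrable_mult_right)
  ultimately show ?thesis unfolding L2_space_def by simp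
qed

lemma L2_diff: "u \<in> L2_space M \<Longrightarrow> v \<in> L2_space M \<Longrightarrow> (\<lambda>x. u x - v x) \<in> L2_space M"
  using L2_lincomb[of u M v 1 "-1"] by simp

lemma L2_scale: "u \<in> L2_space M \<Longrightarrow> (\<lambda>x. c * u x) \<in> L2_space M"
  using L2_lincomb[of u M u c 0] by simp

lemma L2_bounded_support:
  assumes [measurable]: "g \<in> borel_measurable M" "A \<in> sets M" and A: "emeasure M A < \<infinity>"
    and bound: "\<And>x. \<bar>g x\<bar> \<le> c" and supp: "\<And>x. x \<notin> A \<Longrightarrow> g x = 0"
  shows "g \<in> L2_space M"
proof -
  have "integrable M (\<lambda>x. (g x)\<^sup>2)"
  proof (rule Bochner_Integration.integrable_bound)
    show "integrable M (\<lambda>x. c\<^sup>2 * indicator A x)" using A by simp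
    show "AE x in M. norm ((g x)\<^sup>2) \<le> norm (c\<^sup>2 * indicator A x)"
      using bound supp by (auto simp: indicator_def abs_le_square_iff[symmetric] intro!: AE_I2 order_trans[OF bound])
  qed simp
  then show ?thesis by (simp add: L2_space_def)
qed

lemma L2_indicator:
  assumes "A \<in> sets M" "emeasure M A < \<infinity>"
  shows "(indicator A :: 'a \<Rightarrow> real) \<in> L2_space M"
  by (rule L2_bounded_support[OF _ assms, of _ 1]) (use assms in \<open>auto simp: indicator_def\<close>)

lemma L2_Cauchy_Schwarz:
  assumes u: "u \<in> L2_space M" and v: "v \<in> L2_space M"
  shows "(\<integral>x. u x * v x \<partial>M)\<^sup>2 \<le> (\<integral>x. (u x)\<^sup>2 \<partial>M) * (\<integral>x. (v x)\<^sup>2 \<partial>M)"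
proof (rule square_le_mult_of_nonneg_quadratic)
  fix s :: real
  have "0 \<le> (\<integral>x. (u x + s * v x)\<^sup>2 \<partial>M)" by simp
  also have "\<dots> = (\<integral>x. (u x)\<^sup>2 + (2 * s) * (u x * v x) + s\<^sup>2 * (v x)\<^sup>2 \<partial>M)"
    by (simp add: power2_eq_square algebra_simps)
  also have "\<dots> = (\<integral>x. (u x)\<^sup>2 \<partial>M) + 2 * s * (\<integral>x. u x * v x \<partial>M) + s\<^sup>2 * (\<integral>x. (v x)\<^sup>2 \<partial>M)"
    using L2_spaceD(2)[OF u] L2_spaceD(2)[OF v] L2_integrable_mult[OF u v] by simp
  finally show "0 \<le> \<dots>" .
qed simp

lemma L2_Cauchy_Schwarz_abs:
  assumes u: "u \<in> L2_space M" and v: "v \<in> L2_space M"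
  shows "\<bar>\<integral>x. u x * v x \<partial>M\<bar> \<le> sqrt (\<integral>x. (u x)\<^sup>2 \<partial>M) * sqrt (\<integral>x. (v x)\<^sup>2 \<partial>M)"
  using real_sqrt_le_mono[OF L2_Cauchy_Schwarz[OF u v]] by (simp add: real_sqrt_mult)

lemma L2_integral_lincomb_mult:
  assumes "u \<in> L2_space M" "v \<in> L2_space M" "w \<in> L2_space M"
  shows "(\<integral>x. (a * u x + b * v x) * w x \<partial>M) = a * (\<integral>x. u x * w x \<partial>M) + b * (\<integral>x. v x * w x \<partial>M)"
proof -
  have "(\<integral>x. (a * u x + b * v x) * w x \<partial>M) = (\<integral>x. a * (u x * w x) + b * (v x * w x) \<partial>M)"
    by (simp add: algebra_simps)
  then show ?thesis using L2_integrable_mult[OF assms(1,3)] L2_integrable_mult[OF assms(2,3)] by simp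
qed

lemma L2_integral_diff_mult:
  assumes "u \<in> L2_space M" "v \<in> L2_space M" "w \<in> L2_space M"
  shows "(\<integral>x. (u x - v x) * w x \<partial>M) = (\<integral>x. u x * w x \<partial>M) - (\<integral>x. v x * w x \<partial>M)"
  using L2_integral_lincomb_mult[OF assms, of 1 "-1"] by simp


section \<open>Density of the domain of the generator\<close>

context dirichlet_form
begin

lemma dom_lincomb: "u \<in> \<F> \<Longrightarrow> v \<in> \<F> \<Longrightarrow> (\<lambda>x. a * u x + b * v x) \<in> \<F>"
  by (intro dom_add dom_scale)

lemma dom_diff: "u \<in> \<F> \<Longrightarrow> v \<in> \<F> \<Longrightarrow> (\<lambda>x. u x - v x) \<in> \<F>"
  using dom_lincomb[of u v 1 "-1"] by simp

lemma form_lincomb: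
  assumes "u \<in> \<F>" "v \<in> \<F>" "w \<in> \<F>"
  shows "\<E> (\<lambda>x. a * u x + b * v x) w = a * \<E> u w + b * \<E> v w"
  using assms by (simp add: form_add form_scale dom_scale)

lemma form_lincomb_right:
  assumes "u \<in> \<F>" "v \<in> \<F>" "w \<in> \<F>"
  shows "\<E> w (\<lambda>x. a * u x + b * v x) = a * \<E> w u + b * \<E> w v"
  using assms by (simp add: form_sym[of w] form_lincomb dom_lincomb)

text \<open>The shifted form of the theory of Dirichlet forms. For a \<ge> 1 it is equivalent to the
  square of \<open>form_norm1\<close>, the norm in which \<open>form_closed\<close> provides limits,
  and minimising it against a linear functional leads to the resolvent equation.\<close>

definition energy :: "real \<Rightarrow> ('a \<Rightarrow> real) \<Rightarrow> ('a \<Rightarrow> real) \<Rightarrow> real" where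
  "energy a u v = \<E> u v + a * (\<integral>x. u x * v x \<partial>M)"

lemma energy_lincomb:
  assumes "u \<in> \<F>" "v \<in> \<F>" "w \<in> \<F>"
  shows "energy a (\<lambda>x. b * u x + c * v x) w = b * energy a u w + c * energy a v w"
proof -
  have "u \<in> L2_space M" "v \<in> L2_space M" "w \<in> L2_space M" using assms dom_L2 by auto
  from L2_integral_lincomb_mult[OF this] show ?thesis
    unfolding energy_def form_lincomb[OF assms] by (simp only: distrib_left mult.left_commute add_ac)
qed

lemma energy_sym: "u \<in> \<F> \<Longrightarrow> v \<in> \<F> \<Longrightarrow> energy a u v = energy a v u"
  by (simp add: energy_def form_sym mult.commute)

lemma energy_quadratic:
  assumes u: "u \<in> \<F>" and v: "v \<in> \<F>"
  shows "energy a (\<lambda>x. b * u x + c * v x) (\<lambda>x. b * u x + c * v x)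
    = b\<^sup>2 * energy a u u + 2 * b * c * energy a u v + c\<^sup>2 * energy a v v"
  by (simp add: energy_lincomb u v dom_lincomb energy_sym[of _ "\<lambda>x. b * u x + c * v x"]
      energy_sym[of v u] power2_eq_square algebra_simps)

lemma energy_nonneg: "u \<in> \<F> \<Longrightarrow> a \<ge> 0 \<Longrightarrow> energy a u u \<ge> 0"
  unfolding energy_def using form_nonneg by (simp add: power2_eq_square[symmetric])

lemma energy_Cauchy_Schwarz:
  assumes "u \<in> \<F>" "v \<in> \<F>" "a \<ge> 0"
  shows "(energy a u v)\<^sup>2 \<le> energy a u u * energy a v v"
proof (rule square_le_mult_of_nonneg_quadratic)
  fix s :: real
  have "0 \<le> energy a (\<lambda>x. 1 * u x + s * v x) (\<lambda>x. 1 * u x + s * v x)"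
    by (intro energy_nonneg dom_lincomb assms)
  then show "0 \<le> energy a u u + 2 * s * energy a u v + s\<^sup>2 * energy a v v"
    unfolding energy_quadratic[OF assms(1,2)] by (simp add: algebra_simps)
qed (use assms energy_nonneg in auto)

lemma form_norm1_le_energy:
  assumes "u \<in> \<F>" "a \<ge> 1"
  shows "(form_norm1 M \<E> u)\<^sup>2 \<le> energy a u u"
proof -
  have nn: "0 \<le> (\<integral>x. (u x)\<^sup>2 \<partial>M)" by simp
  have "(form_norm1 M \<E> u)\<^sup>2 = \<E> u u + 1 * (\<integral>x. (u x)\<^sup>2 \<partial>M)"
    unfolding form_norm1_def using form_nonneg[OF assms(1)] nn by simp
  also have "\<dots> \<le> \<E> u u + a * (\<integral>x. (u x)\<^sup>2 \<partial>M)"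
    using nn assms(2) by (intro add_left_mono mult_right_mono) auto
  finally show ?thesis by (simp add: energy_def power2_eq_square)
qed

lemma energy_le_form_norm1:
  assumes "u \<in> \<F>" "a \<ge> 1"
  shows "energy a u u \<le> a * (form_norm1 M \<E> u)\<^sup>2"
proof -
  have nn: "0 \<le> (\<integral>x. (u x)\<^sup>2 \<partial>M)" by simp
  have "energy a u u = 1 * \<E> u u + a * (\<integral>x. (u x)\<^sup>2 \<partial>M)"
    by (simp add: energy_def power2_eq_square)
  also have "\<dots> \<le> a * \<E> u u + a * (\<integral>x. (u x)\<^sup>2 \<partial>M)"
    using form_nonneg[OF assms(1)] assms(2) by (intro add_right_mono mult_right_mono) auto
  also have "\<dots> = a * (form_norm1 M \<E> u)\<^sup>2"
    unfolding form_norm1_def using form_nonneg[OF assms(1)] nn by (simp add: algebra_simps)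
  finally show ?thesis .
qed

text \<open>The solution \<open>v\<close> of \<open>a v - L v = a u\<close>, found by minimising
  \<open>energy a v v - 2 a \<langle>u, v\<rangle>\<close>: by the parallelogram law a minimising sequence is
  Cauchy.\<close>

lemma resolvent_exists:
  assumes u: "u \<in> \<F>" and a: "a \<ge> 1"
  obtains v where "v \<in> \<F>" "\<And>\<phi>. \<phi> \<in> \<F> \<Longrightarrow> \<E> v \<phi> = - (a * (\<integral>x. (v x - u x) * \<phi> x \<partial>M))"
proof -
  \<comment> \<open>The last summand completes the square: G v is \<open>\<E> v v\<close> plus a
    times the squared L2 distance of v and u. Hence 0 is a lower bound and the infimum
    exists.\<close>
  define G where "G v = energy a v v - 2 * a * (\<integral>x. v x * u x \<partial>M) + a * (\<integral>x. u x * u x \<partial>M)" for v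
  have a0: "a \<ge> 0" using a by simp
  have F2: "v \<in> L2_space M" if "v \<in> \<F>" for v using that dom_L2 by auto
  have G_nonneg: "G v \<ge> 0" if v: "v \<in> \<F>" for v
  proof -
    have "0 \<le> (\<integral>x. (1 * v x + (-1) * u x)\<^sup>2 \<partial>M)" by simp
    also have "(\<lambda>x. (1 * v x + (-1) * u x)\<^sup>2) = (\<lambda>x. v x * v x - 2 * (v x * u x) + u x * u x)"
      by (auto simp: fun_eq_iff power2_eq_square algebra_simps)
    finally have "0 \<le> (\<integral>x. v x * v x \<partial>M) - 2 * (\<integral>x. v x * u x \<partial>M) + (\<integral>x. u x * u x \<partial>M)"
      using L2_integrable_mult[OF F2[OF v] F2[OF v]] L2_integrable_mult[OF F2[OF v] F2[OF u]]
        L2_integrable_mult[OF F2[OF u] F2[OF u]] by simp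
    then have "0 \<le> a * ((\<integral>x. v x * v x \<partial>M) - 2 * (\<integral>x. v x * u x \<partial>M) + (\<integral>x. u x * u x \<partial>M))"
      using a0 by simp
    then show ?thesis using form_nonneg[OF v] by (simp add: G_def energy_def algebra_simps)
  qed
  define I where "I = Inf (G ` \<F>)"
  have bdd: "bdd_below (G ` \<F>)" using G_nonneg by (auto intro!: bdd_belowI[of _ 0])
  have I_le: "I \<le> G v" if "v \<in> \<F>" for v
    unfolding I_def using that bdd by (auto intro: cInf_lower)
  have "\<exists>v\<in>\<F>. G v < I + 1 / real (Suc n)" for n
  proof -
    have "Inf (G ` \<F>) < I + 1 / real (Suc n)" by (simp add: I_def)
    then obtain z where "z \<in> G ` \<F>" "z < I + 1 / real (Suc n)"
      using cInf_lessD[of "G ` \<F>" "I + 1 / real (Suc n)"] u by blast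
    then show ?thesis by auto
  qed
  then obtain w where w: "w n \<in> \<F>" and Gw: "G (w n) < I + 1 / real (Suc n)" for n by metis
  have G_lin: "G (\<lambda>x. b * v x + c * \<phi> x) = b\<^sup>2 * energy a v v + 2 * b * c * energy a v \<phi>
      + c\<^sup>2 * energy a \<phi> \<phi> - 2 * a * (b * (\<integral>x. v x * u x \<partial>M) + c * (\<integral>x. \<phi> x * u x \<partial>M))
      + a * (\<integral>x. u x * u x \<partial>M)" if "v \<in> \<F>" "\<phi> \<in> \<F>" for v \<phi> b c
    unfolding G_def energy_quadratic[OF that] by (simp add: L2_integral_lincomb_mult F2 that u)
  have cauchy: "energy a (\<lambda>x. w m x - w n x) (\<lambda>x. w m x - w n x)
      \<le> 2 * (1 / real (Suc m) + 1 / real (Suc n))" for m n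
  proof -
    have "energy a (\<lambda>x. 1 * w m x + (-1) * w n x) (\<lambda>x. 1 * w m x + (-1) * w n x)
        = 2 * G (w m) + 2 * G (w n) - 4 * G (\<lambda>x. (1/2) * w m x + (1/2) * w n x)"
      unfolding G_lin[OF w w] energy_quadratic[OF w w] G_def by (simp add: power2_eq_square algebra_simps)
    moreover have "I \<le> G (\<lambda>x. (1/2) * w m x + (1/2) * w n x)"
      by (intro I_le dom_lincomb w)
    ultimately show ?thesis using Gw[of m] Gw[of n] by simp
  qed
  have "\<exists>N. \<forall>m\<ge>N. \<forall>n\<ge>N. form_norm1 M \<E> (\<lambda>x. w m x - w n x) < \<epsilon>" if \<epsilon>: "\<epsilon> > 0" for \<epsilon>
  proof -
    obtain N where N: "inverse (real (Suc N)) < \<epsilon>\<^sup>2 / 4" using reals_Archimedean[of "\<epsilon>\<^sup>2/4"] \<epsilon> by auto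
    show ?thesis
    proof (intro exI allI impI)
      fix m n assume mn: "N \<le> m" "N \<le> n"
      have inv: "1 / real (Suc k) \<le> inverse (real (Suc N))" if "N \<le> k" for k
        using that by (simp add: field_simps)
      have "(form_norm1 M \<E> (\<lambda>x. w m x - w n x))\<^sup>2 \<le> 2 * (1 / real (Suc m) + 1 / real (Suc n))"
        using form_norm1_le_energy[OF dom_diff[OF w w] a] cauchy order_trans by blast
      also have "\<dots> \<le> 4 * inverse (real (Suc N))"
        using add_mono[OF inv[OF mn(1)] inv[OF mn(2)]] by simp
      also have "\<dots> < \<epsilon>\<^sup>2" using N by simp
      finally show "form_norm1 M \<E> (\<lambda>x. w m x - w n x) < \<epsilon>"
        using \<epsilon> power2_less_imp_less less_imp_le by blast
    qed
  qed
  from form_closed[OF w this] obtain v where v: "v \<in> \<F>"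
    and lim: "(\<lambda>n. form_norm1 M \<E> (\<lambda>x. w n x - v x)) \<longlonglongrightarrow> 0" by blast
  have "\<E> v \<phi> = - (a * (\<integral>x. (v x - u x) * \<phi> x \<partial>M))" if \<phi>: "\<phi> \<in> \<F>" for \<phi>
  proof -
    \<comment> \<open>\<open>B z\<close> is half the derivative of \<open>G\<close> at z in the
      direction \<phi>. Since \<open>G (w n)\<close> exceeds the infimum by less than 1 / (n + 1),
      the quadratic in s along this direction is nonnegative once that excess replaces its constant
      term, and the discriminant forces \<open>B (w n)\<close> to 0.\<close>
    define B where "B z = energy a z \<phi> - a * (\<integral>x. \<phi> x * u x \<partial>M)" for z
    have "(B (w n))\<^sup>2 \<le> 1 / real (Suc n) * energy a \<phi> \<phi>" for n
    proof (rule square_le_mult_of_nonneg_quadratic)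
      fix s :: real
      have "I \<le> G (\<lambda>x. 1 * w n x + s * \<phi> x)" by (intro I_le dom_lincomb w \<phi>)
      also have "\<dots> = G (w n) + 2 * s * B (w n) + s\<^sup>2 * energy a \<phi> \<phi>"
        unfolding G_lin[OF w \<phi>] G_def B_def by (simp add: algebra_simps)
      finally show "0 \<le> 1 / real (Suc n) + 2 * s * B (w n) + s\<^sup>2 * energy a \<phi> \<phi>"
        using Gw[of n] by linarith
    qed (rule energy_nonneg[OF \<phi> a0])
    moreover have "(\<lambda>n. 1 / real (Suc n) * energy a \<phi> \<phi>) \<longlonglongrightarrow> 0"
      using tendsto_mult_left_zero[OF LIMSEQ_Suc[OF lim_1_over_n]] by auto
    ultimately have 1: "(\<lambda>n. B (w n)) \<longlonglongrightarrow> 0" by (rule tendsto_zero_of_square_le)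
    have diffw: "(\<lambda>x. w n x - v x) \<in> \<F>" for n by (intro dom_diff w v)
    have "(energy a (\<lambda>x. w n x - v x) \<phi>)\<^sup>2 \<le> a * (form_norm1 M \<E> (\<lambda>x. w n x - v x))\<^sup>2 * energy a \<phi> \<phi>" for n
      using energy_Cauchy_Schwarz[OF diffw \<phi> a0, of n]
        mult_right_mono[OF energy_le_form_norm1[OF diffw a] energy_nonneg[OF \<phi> a0], of n] by linarith
    moreover have "(\<lambda>n. a * (form_norm1 M \<E> (\<lambda>x. w n x - v x))\<^sup>2 * energy a \<phi> \<phi>) \<longlonglongrightarrow> a * 0\<^sup>2 * energy a \<phi> \<phi>"
      by (intro tendsto_intros lim)
    ultimately have 2: "(\<lambda>n. energy a (\<lambda>x. w n x - v x) \<phi>) \<longlonglongrightarrow> 0"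
      using tendsto_zero_of_square_le[of "\<lambda>n. energy a (\<lambda>x. w n x - v x) \<phi>"
          "\<lambda>n. a * (form_norm1 M \<E> (\<lambda>x. w n x - v x))\<^sup>2 * energy a \<phi> \<phi>"] by simp
    have "B (w n) - energy a (\<lambda>x. w n x - v x) \<phi> = B v" for n
      using energy_lincomb[OF w v \<phi>, of a 1 n "-1"] by (simp add: B_def)
    with tendsto_diff[OF 1 2] have "(\<lambda>n::nat. B v) \<longlonglongrightarrow> 0" by simp
    then have "B v = 0" by (simp add: tendsto_const_iff)
    then have "\<E> v \<phi> + a * (\<integral>x. v x * \<phi> x \<partial>M) = a * (\<integral>x. u x * \<phi> x \<partial>M)"
      by (simp add: B_def energy_def mult.commute)
    then show ?thesis
      unfolding L2_integral_diff_mult[OF F2[OF v] F2[OF u] F2[OF \<phi>]] right_diff_distrib by linarith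
  qed
  with v show ?thesis by (rule that)
qed

text \<open>For large a the resolvent solution v with datum f is close to f: testing its equation
  with v - f gives a |v - f|^2 \<le> \<open>\<E> f f\<close> in L2. So a first approximation f in
  the form domain can be replaced by an element of the generator domain.\<close>

lemma generator_domain_dense:
  assumes u: "u \<in> L2_space M" and \<epsilon>: "\<epsilon> > 0"
  obtains v w where "form_generator M \<E> \<F> v w" "(\<integral>x. (u x - v x)\<^sup>2 \<partial>M) < \<epsilon>"
proof -
  obtain f where f: "f \<in> \<F>" and uf: "(\<integral>x. (u x - f x)\<^sup>2 \<partial>M) < \<epsilon> / 4"
    using dom_dense[OF u, of "\<epsilon>/4"] \<epsilon> by auto
  \<comment> \<open>This makes \<open>\<E> f f / a\<close> smaller than \<epsilon> / 4; the summand
    1 gives a \<ge> 1 and strictness. Both errors of \<epsilon> / 4 are doubled in the final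
    estimate.\<close>
  define a where "a = 1 + 4 * \<E> f f / \<epsilon>"
  have Ef: "\<E> f f \<ge> 0" by (rule form_nonneg[OF f])
  have a: "a \<ge> 1" using Ef \<epsilon> by (simp add: a_def)
  obtain v where v: "v \<in> \<F>"
    and weak: "\<And>\<phi>. \<phi> \<in> \<F> \<Longrightarrow> \<E> v \<phi> = - (a * (\<integral>x. (v x - f x) * \<phi> x \<partial>M))"
    using resolvent_exists[OF f a] by blast
  have f2: "f \<in> L2_space M" and v2: "v \<in> L2_space M" using f v dom_L2 by auto
  have gen: "form_generator M \<E> \<F> v (\<lambda>x. a * (v x - f x))"
    unfolding form_generator_def using v weak L2_scale[OF L2_diff[OF v2 f2], of a]
    by (simp add: mult.assoc)
  have "a * (\<integral>x. (v x - f x)\<^sup>2 \<partial>M) = - \<E> v (\<lambda>x. v x - f x)"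
    using weak[OF dom_diff[OF v f]] by (simp add: power2_eq_square)
  also have "\<dots> = \<E> v f - \<E> v v"
    using form_lincomb_right[OF v f v, of 1 "-1"] by simp
  also have "\<dots> \<le> \<E> f f"
  proof -
    have "0 \<le> \<E> (\<lambda>x. 1 * v x + (-1) * f x) (\<lambda>x. 1 * v x + (-1) * f x)"
      by (intro form_nonneg dom_lincomb v f)
    also have "\<dots> = \<E> v v - 2 * \<E> v f + \<E> f f"
      using energy_quadratic[OF v f, of 0 1 "-1"] by (simp add: energy_def)
    finally show ?thesis using form_nonneg[OF v] Ef by linarith
  qed
  finally have "(\<integral>x. (v x - f x)\<^sup>2 \<partial>M) \<le> \<E> f f / a" using a by (simp add: field_simps)
  also have "\<dots> < \<epsilon> / 4" using \<epsilon> Ef by (simp add: a_def field_simps add_pos_nonneg)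
  finally have vf: "(\<integral>x. (v x - f x)\<^sup>2 \<partial>M) < \<epsilon> / 4" .
  have "(\<integral>x. (u x - v x)\<^sup>2 \<partial>M) \<le> (\<integral>x. 2 * (u x - f x)\<^sup>2 + 2 * (v x - f x)\<^sup>2 \<partial>M)"
  proof (rule integral_mono)
    show "integrable M (\<lambda>x. (u x - v x)\<^sup>2)" by (rule L2_spaceD(2)[OF L2_diff[OF u v2]])
    show "integrable M (\<lambda>x. 2 * (u x - f x)\<^sup>2 + 2 * (v x - f x)\<^sup>2)"
      using L2_spaceD(2)[OF L2_diff[OF u f2]] L2_spaceD(2)[OF L2_diff[OF v2 f2]] by simp
    fix x
    have "0 \<le> ((u x - f x) + (v x - f x))\<^sup>2" by simp
    then show "(u x - v x)\<^sup>2 \<le> 2 * (u x - f x)\<^sup>2 + 2 * (v x - f x)\<^sup>2"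
      by (simp add: power2_eq_square algebra_simps)
  qed
  also have "\<dots> = 2 * (\<integral>x. (u x - f x)\<^sup>2 \<partial>M) + 2 * (\<integral>x. (v x - f x)\<^sup>2 \<partial>M)"
    using L2_spaceD(2)[OF L2_diff[OF u f2]] L2_spaceD(2)[OF L2_diff[OF v2 f2]] by simp
  also have "\<dots> < \<epsilon>" using uf vf by simp
  finally show ?thesis using gen that by blast
qed

end

section \<open>Symmetry of the heat semigroup\<close>

lemma form_generator_symmetric:
  assumes "dirichlet_form M \<E> \<F>"
    and "form_generator M \<E> \<F> u w" "form_generator M \<E> \<F> v z"
  shows "(\<integral>x. w x * v x \<partial>M) = (\<integral>x. u x * z x \<partial>M)"
proof -
  interpret dirichlet_form M \<E> \<F> by fact
  have "u \<in> \<F>" "v \<in> \<F>" "\<E> u v = - (\<integral>x. w x * v x \<partial>M)" "\<E> v u = - (\<integral>x. z x * u x \<partial>M)"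
    using assms(2,3) by (auto simp: form_generator_def)
  with form_sym[of u v] show ?thesis by (simp add: mult.commute)
qed

locale dirichlet_heat_semigroup = dirichlet_form M \<E> \<F> + heat_semigroup M \<E> \<F> P
  for M :: "'a measure"
    and \<E> :: "('a \<Rightarrow> real) \<Rightarrow> ('a \<Rightarrow> real) \<Rightarrow> real"
    and \<F> :: "('a \<Rightarrow> real) set"
    and P :: "real \<Rightarrow> ('a \<Rightarrow> real) \<Rightarrow> 'a \<Rightarrow> real"
begin

lemma P_lincomb:
  assumes t: "t > 0" and u: "u \<in> L2_space M" and v: "v \<in> L2_space M"
  shows "AE x in M. P t (\<lambda>y. a * u y + b * v y) x = a * P t u x + b * P t v x"
  using P_add[OF t L2_scale[OF u, of a] L2_scale[OF v, of b]] P_scale[OF t u, of a] P_scale[OF t v, of b]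
  by eventually_elim simp

lemma generator_L2: "semigroup_generator M P u w \<Longrightarrow> u \<in> L2_space M" "semigroup_generator M P u w \<Longrightarrow> w \<in> L2_space M"
  by (auto simp: semigroup_generator_def)

definition defect :: "('a \<Rightarrow> real) \<Rightarrow> ('a \<Rightarrow> real) \<Rightarrow> real \<Rightarrow> real" where
  "defect u w h = (\<integral>x. ((P h u x - u x) / h - w x)\<^sup>2 \<partial>M)"

lemma defect_L2:
  assumes "h > 0" "u \<in> L2_space M" "w \<in> L2_space M"
  shows "(\<lambda>x. (P h u x - u x) / h - w x) \<in> L2_space M"
  using L2_diff[OF L2_scale[OF L2_diff[OF P_L2[OF assms(1,2)] assms(2)], of "1/h"] assms(3)]
  by simp

text \<open>The difference quotient commutes with \<open>P s\<close> almost everywhere, so the error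
  of the shifted pair is the image under \<open>P s\<close> of the original error. The resulting
  uniformity in s lets n steps be estimated by n times a single one.\<close>

lemma defect_P_le:
  assumes s: "s > 0" and h: "h > 0" and u: "u \<in> L2_space M" and w: "w \<in> L2_space M"
  shows "defect (P s u) (P s w) h \<le> defect u w h"
proof -
  define q where "q x = (P h u x - u x) / h - w x" for x
  define d where "d x = P h u x - u x" for x
  have d2: "d \<in> L2_space M" unfolding d_def by (intro L2_diff P_L2 h u)
  have q2: "q \<in> L2_space M" unfolding q_def by (intro defect_L2 h u w)
  have "AE x in M. P s d x = P s (P h u) x - P s u x"
    using P_lincomb[OF s P_L2[OF h u] u, of 1 "-1"] by (simp add: d_def[abs_def])
  moreover have "AE x in M. P s q x = (1/h) * P s d x - P s w x"
    using P_lincomb[OF s d2 w, of "1/h" "-1"] by (simp add: q_def[abs_def] d_def)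
  moreover note P_semigroup[OF s h u] P_semigroup[OF h s u]
  ultimately have "AE x in M. (P h (P s u) x - P s u x) / h - P s w x = P s q x"
    by eventually_elim (simp add: add.commute)
  then have eq: "AE x in M. ((P h (P s u) x - P s u x) / h - P s w x)\<^sup>2 = (P s q x)\<^sup>2"
    by eventually_elim simp
  have "defect (P s u) (P s w) h = (\<integral>x. (P s q x)\<^sup>2 \<partial>M)"
    unfolding defect_def
    by (intro integral_cong_AE borel_measurable_power L2_spaceD(1)[OF defect_L2]
        L2_spaceD(1)[OF P_L2[OF s q2]] P_L2 s h u w eq)
  also have "\<dots> \<le> defect u w h"
    using P_contraction[OF s q2] by (simp add: defect_def q_def)
  finally show ?thesis .
qed

lemma generator_invariant:
  assumes s: "s > 0" and gen: "semigroup_generator M P u w"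
  shows "semigroup_generator M P (P s u) (P s w)"
proof -
  note L2 = generator_L2[OF gen]
  have lim: "(defect u w \<longlongrightarrow> 0) (at_right 0)"
    using gen unfolding semigroup_generator_def defect_def by blast
  have "(defect (P s u) (P s w) \<longlongrightarrow> 0) (at_right 0)"
  proof (rule tendsto_sandwich[OF _ _ tendsto_const lim])
    show "\<forall>\<^sub>F h in at_right 0. 0 \<le> defect (P s u) (P s w) h" by (simp add: defect_def)
    show "\<forall>\<^sub>F h in at_right 0. defect (P s u) (P s w) h \<le> defect u w h"
      using eventually_at_right_less by eventually_elim (rule defect_P_le[OF s _ L2])
  qed
  then show ?thesis
    unfolding semigroup_generator_def defect_def using P_L2[OF s] L2 by blast
qed

lemma generator_symmetric:
  assumes "semigroup_generator M P u w" "semigroup_generator M P v z"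
  shows "(\<integral>x. w x * v x \<partial>M) = (\<integral>x. u x * z x \<partial>M)"
  using assms form_generator_symmetric[OF dirichlet_form_axioms] by (simp add: P_generator)

definition asym :: "real \<Rightarrow> ('a \<Rightarrow> real) \<Rightarrow> ('a \<Rightarrow> real) \<Rightarrow> real" where
  "asym t u v = (\<integral>x. P t u x * v x \<partial>M) - (\<integral>x. u x * P t v x \<partial>M)"

text \<open>Symmetry of the generator cancels the terms of first order in h. What remains are the
  two defects, so that one step costs o(h).\<close>

lemma asym_step:
  assumes h: "h > 0" and gu: "semigroup_generator M P u w" and gv: "semigroup_generator M P v z"
  shows "\<bar>asym h u v\<bar> \<le> h * (sqrt (defect u w h) * sqrt (\<integral>x. (v x)\<^sup>2 \<partial>M)
    + sqrt (defect v z h) * sqrt (\<integral>x. (u x)\<^sup>2 \<partial>M))"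
proof -
  note u = generator_L2[OF gu] and v = generator_L2[OF gv]
  let ?q = "\<lambda>u w x. (P h u x - u x) / h - w x"
  have expand: "h * (\<integral>x. ?q u w x * v x \<partial>M)
      = (\<integral>x. P h u x * v x \<partial>M) - (\<integral>x. u x * v x \<partial>M) - h * (\<integral>x. w x * v x \<partial>M)"
    if "u \<in> L2_space M" "w \<in> L2_space M" "v \<in> L2_space M" for u w v
  proof -
    have "h * (\<integral>x. ?q u w x * v x \<partial>M) = (\<integral>x. (P h u x * v x - u x * v x) - h * (w x * v x) \<partial>M)"
      unfolding integral_mult_right_zero[symmetric] using h
      by (intro Bochner_Integration.integral_cong) (auto simp: field_simps)
    then show ?thesis
      using L2_integrable_mult[OF P_L2[OF h that(1)] that(3)] L2_integrable_mult[OF that(1,3)]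
        L2_integrable_mult[OF that(2,3)] by simp
  qed
  have eq: "asym h u v = h * (\<integral>x. ?q u w x * v x \<partial>M) - h * (\<integral>x. ?q v z x * u x \<partial>M)"
    unfolding expand[OF u v(1)] expand[OF v u(1)] asym_def
    using generator_symmetric[OF gu gv] by (simp add: mult.commute)
  have "\<bar>asym h u v\<bar> \<le> h * (\<bar>\<integral>x. ?q u w x * v x \<partial>M\<bar> + \<bar>\<integral>x. ?q v z x * u x \<partial>M\<bar>)"
    unfolding eq using h abs_triangle_ineq4[of "h * (\<integral>x. ?q u w x * v x \<partial>M)" "h * (\<integral>x. ?q v z x * u x \<partial>M)"]
    by (simp add: abs_mult distrib_left)
  also have "\<dots> \<le> h * (sqrt (defect u w h) * sqrt (\<integral>x. (v x)\<^sup>2 \<partial>M)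
      + sqrt (defect v z h) * sqrt (\<integral>x. (u x)\<^sup>2 \<partial>M))"
    using h L2_Cauchy_Schwarz_abs[OF defect_L2[OF h u] v(1)] L2_Cauchy_Schwarz_abs[OF defect_L2[OF h v] u(1)]
    unfolding defect_def by (intro mult_left_mono add_mono) auto
  finally show ?thesis .
qed

text \<open>The axioms leave \<open>P\<close> unspecified at time 0. With the identity there, the
  interpolation between the two sides of the symmetry relation can include both of its
  endpoints.\<close>

definition T :: "real \<Rightarrow> ('a \<Rightarrow> real) \<Rightarrow> 'a \<Rightarrow> real" where
  "T t u = (if t > 0 then P t u else u)"

lemma T_L2: "u \<in> L2_space M \<Longrightarrow> T t u \<in> L2_space M"
  by (simp add: T_def P_L2)

lemma T_contraction: "u \<in> L2_space M \<Longrightarrow> (\<integral>x. (T t u x)\<^sup>2 \<partial>M) \<le> (\<integral>x. (u x)\<^sup>2 \<partial>M)"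
  by (simp add: T_def P_contraction)

lemma T_generator: "semigroup_generator M P u w \<Longrightarrow> semigroup_generator M P (T t u) (T t w)"
  by (simp add: T_def generator_invariant)

lemma T_defect:
  "h > 0 \<Longrightarrow> u \<in> L2_space M \<Longrightarrow> w \<in> L2_space M \<Longrightarrow> defect (T t u) (T t w) h \<le> defect u w h"
  by (simp add: T_def defect_P_le)

lemma T_Suc:
  assumes "h > 0" "u \<in> L2_space M"
  shows "AE x in M. T (real (Suc k) * h) u x = P h (T (real k * h) u) x"
proof (cases "k = 0")
  case False
  have "real (Suc k) * h = h + real k * h" by (simp add: algebra_simps)
  moreover have "AE x in M. P (h + real k * h) u x = P h (P (real k * h) u) x"
    using False assms by (intro P_semigroup) auto
  ultimately show ?thesis using False assms by (simp add: T_def add_pos_pos)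
qed (use assms in \<open>simp add: T_def\<close>)

lemma L2_integral_mult_cong_AE:
  assumes "AE x in M. u x = v x" "u \<in> L2_space M" "v \<in> L2_space M" "w \<in> L2_space M"
  shows "(\<integral>x. u x * w x \<partial>M) = (\<integral>x. v x * w x \<partial>M)"
proof (intro integral_cong_AE borel_measurable_times L2_spaceD(1) assms(2-4))
  show "AE x in M. u x * w x = v x * w x" using assms(1) by eventually_elim simp
qed

text \<open>Moving the semigroup from \<open>u\<close> to \<open>v\<close> in \<open>n\<close> steps of length \<open>h = t / n\<close> costs
  \<open>n o(h)\<close>.\<close>

lemma asym_generator_domain:
  assumes t: "t > 0" and gu: "semigroup_generator M P u w" and gv: "semigroup_generator M P v z"
  shows "asym t u v = 0"
proof -
  note u = generator_L2[OF gu] and v = generator_L2[OF gv]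
  define R where "R h = t * (sqrt (defect u w h) * sqrt (\<integral>x. (v x)\<^sup>2 \<partial>M)
    + sqrt (defect v z h) * sqrt (\<integral>x. (u x)\<^sup>2 \<partial>M))" for h
  have bound: "\<bar>asym t u v\<bar> \<le> R (t / real (Suc m))" for m
  proof -
    define n where "n = Suc m"
    define h where "h = t / real n"
    have h: "h > 0" and nh: "real n * h = t" using t by (auto simp: h_def n_def)
    define S where "S k = (\<integral>x. T (real k * h) u x * T (real (n - k) * h) v x \<partial>M)" for k
    \<comment> \<open>S leads from the pairing of u with \<open>P t v\<close> at k = 0 to that of
      \<open>P t u\<close> with v at k = n. The bound on a step is independent of k, since the
      semigroup increases neither defects nor norms.\<close>
    have step: "\<bar>S (Suc k) - S k\<bar> \<le> R h / real n" if "k < n" for k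
    proof -
      let ?u = "T (real k * h) u" and ?v = "T (real (n - Suc k) * h) v"
      have L: "?u \<in> L2_space M" "?v \<in> L2_space M" by (intro T_L2 u v)+
      have "S (Suc k) = (\<integral>x. P h ?u x * ?v x \<partial>M)"
        unfolding S_def by (intro L2_integral_mult_cong_AE T_Suc[OF h u(1)] L T_L2 P_L2 h u)
      moreover have "S k = (\<integral>x. ?u x * P h ?v x \<partial>M)"
      proof -
        have "n - k = Suc (n - Suc k)" using that by simp
        then have eq: "AE x in M. T (real (n - k) * h) v x = P h ?v x"
          using T_Suc[OF h v(1), of "n - Suc k"] by simp
        have "(\<integral>x. T (real (n - k) * h) v x * ?u x \<partial>M) = (\<integral>x. P h ?v x * ?u x \<partial>M)"
          by (intro L2_integral_mult_cong_AE eq L T_L2 P_L2 h v)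
        then show ?thesis by (simp add: S_def mult.commute)
      qed
      ultimately have "\<bar>S (Suc k) - S k\<bar> = \<bar>asym h ?u ?v\<bar>" by (simp add: asym_def)
      also have "\<dots> \<le> h * (sqrt (defect ?u (T (real k * h) w) h) * sqrt (\<integral>x. (?v x)\<^sup>2 \<partial>M)
          + sqrt (defect ?v (T (real (n - Suc k) * h) z) h) * sqrt (\<integral>x. (?u x)\<^sup>2 \<partial>M))"
        by (intro asym_step h T_generator gu gv)
      also have "\<dots> \<le> h * (sqrt (defect u w h) * sqrt (\<integral>x. (v x)\<^sup>2 \<partial>M)
          + sqrt (defect v z h) * sqrt (\<integral>x. (u x)\<^sup>2 \<partial>M))"
        using h u v by (intro mult_left_mono add_mono mult_mono real_sqrt_le_mono T_defect T_contraction)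
          (auto simp: defect_def)
      also have "\<dots> = R h / real n" by (simp add: R_def h_def)
      finally show ?thesis .
    qed
    have "asym t u v = S n - S 0"
      using t nh by (simp add: asym_def S_def T_def mult.commute)
    then have "\<bar>asym t u v\<bar> = \<bar>\<Sum>k<n. S (Suc k) - S k\<bar>" by (simp add: sum_lessThan_telescope)
    also have "\<dots> \<le> (\<Sum>k<n. R h / real n)"
      by (intro order_trans[OF sum_abs] sum_mono step) simp
    also have "\<dots> = R h" by (simp add: n_def)
    finally show ?thesis by (simp add: h_def n_def)
  qed
  have lim: "(defect u w \<longlongrightarrow> 0) (at_right 0)" "(defect v z \<longlongrightarrow> 0) (at_right 0)"
    using gu gv unfolding semigroup_generator_def defect_def by blast+
  have "filterlim (\<lambda>m. t / real (Suc m)) (at_right 0) sequentially"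
  proof -
    have "(\<lambda>m. t / real (Suc m)) \<longlonglongrightarrow> 0"
      using LIMSEQ_Suc[OF tendsto_divide_0[OF tendsto_const filterlim_real_sequentially[THEN filterlim_at_top_imp_at_infinity], of t]]
      by simp
    then show ?thesis using t by (simp add: filterlim_at)
  qed
  then have "(\<lambda>m. R (t / real (Suc m))) \<longlonglongrightarrow> t * (sqrt 0 * sqrt (\<integral>x. (v x)\<^sup>2 \<partial>M) + sqrt 0 * sqrt (\<integral>x. (u x)\<^sup>2 \<partial>M))"
    unfolding R_def by (intro tendsto_intros lim[THEN filterlim_compose])
  then have "\<bar>asym t u v\<bar> \<le> 0"
    using bound by (intro LIMSEQ_le_const[of "\<lambda>m. R (t / real (Suc m))"]) auto
  then show ?thesis by simp
qed

lemma asym_skew: "asym t v u = - asym t u v"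
  by (simp add: asym_def mult.commute)

text \<open>Approximation in one argument only, by generator elements close in L2. With the
  vanishing as a hypothesis it can be applied twice in \<open>P_symmetric\<close>, once for each
  argument, with \<open>asym_skew\<close> exchanging them.\<close>

lemma asym_approx:
  assumes t: "t > 0" and u: "u \<in> L2_space M" and v: "v \<in> L2_space M"
    and dom: "\<And>u' w. semigroup_generator M P u' w \<Longrightarrow> asym t u' v = 0"
  shows "asym t u v = 0"
proof -
  define N where "N = sqrt (\<integral>x. (v x)\<^sup>2 \<partial>M)"
  have "\<bar>asym t u v\<bar> \<le> 2 * sqrt \<epsilon> * N" if \<epsilon>: "\<epsilon> > 0" for \<epsilon>
  proof -
    obtain u' w where gen: "form_generator M \<E> \<F> u' w" and close: "(\<integral>x. (u x - u' x)\<^sup>2 \<partial>M) < \<epsilon>"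
      using generator_domain_dense[OF u \<epsilon>] by blast
    from gen have gen': "semigroup_generator M P u' w" by (simp add: P_generator)
    note u' = generator_L2(1)[OF gen']
    let ?d = "\<lambda>x. u x - u' x"
    have d: "?d \<in> L2_space M" by (intro L2_diff u u')
    have "AE x in M. P t ?d x = P t u x - P t u' x"
      using P_lincomb[OF t u u', of 1 "-1"] by simp
    then have "(\<integral>x. P t ?d x * v x \<partial>M) = (\<integral>x. (P t u x - P t u' x) * v x \<partial>M)"
      by (intro L2_integral_mult_cong_AE P_L2 L2_diff t u u' v) auto
    also have "\<dots> = (\<integral>x. P t u x * v x \<partial>M) - (\<integral>x. P t u' x * v x \<partial>M)"
      by (intro L2_integral_diff_mult P_L2 t u u' v)
    finally have "asym t ?d v = asym t u v - asym t u' v"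
      unfolding asym_def using L2_integral_diff_mult[OF u u' P_L2[OF t v]] by simp
    then have "\<bar>asym t u v\<bar> = \<bar>asym t ?d v\<bar>" using dom[OF gen'] by simp
    also have "\<dots> \<le> \<bar>\<integral>x. P t ?d x * v x \<partial>M\<bar> + \<bar>\<integral>x. ?d x * P t v x \<partial>M\<bar>"
      unfolding asym_def by (rule abs_triangle_ineq4)
    also have "\<dots> \<le> sqrt \<epsilon> * N + sqrt \<epsilon> * N"
    proof (rule add_mono)
      have "\<bar>\<integral>x. P t ?d x * v x \<partial>M\<bar> \<le> sqrt (\<integral>x. (P t ?d x)\<^sup>2 \<partial>M) * N"
        unfolding N_def by (intro L2_Cauchy_Schwarz_abs P_L2 t d v)
      also have "\<dots> \<le> sqrt \<epsilon> * N"
        using P_contraction[OF t d] close by (intro mult_right_mono real_sqrt_le_mono) (auto simp: N_def)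
      finally show "\<bar>\<integral>x. P t ?d x * v x \<partial>M\<bar> \<le> sqrt \<epsilon> * N" .
      have "\<bar>\<integral>x. ?d x * P t v x \<partial>M\<bar> \<le> sqrt (\<integral>x. (?d x)\<^sup>2 \<partial>M) * sqrt (\<integral>x. (P t v x)\<^sup>2 \<partial>M)"
        by (intro L2_Cauchy_Schwarz_abs P_L2 t d v)
      also have "\<dots> \<le> sqrt \<epsilon> * N"
        unfolding N_def using P_contraction[OF t v] close \<epsilon> by (intro mult_mono real_sqrt_le_mono) auto
      finally show "\<bar>\<integral>x. ?d x * P t v x \<partial>M\<bar> \<le> sqrt \<epsilon> * N" .
    qed
    finally show ?thesis by (simp add: mult_ac)
  qed
  note bound = this
  have "\<bar>asym t u v\<bar> \<le> 0"
  proof (rule tendsto_lowerbound)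
    show "((\<lambda>\<epsilon>. 2 * sqrt \<epsilon> * N) \<longlongrightarrow> 0) (at_right 0)"
      by (rule tendsto_eq_intros refl | simp)+
    show "\<forall>\<^sub>F \<epsilon> in at_right 0. \<bar>asym t u v\<bar> \<le> 2 * sqrt \<epsilon> * N"
      using eventually_at_right_less by eventually_elim (rule bound)
  qed simp
  then show ?thesis by simp
qed

theorem P_symmetric:
  assumes t: "t > 0" and u: "u \<in> L2_space M" and v: "v \<in> L2_space M"
  shows "(\<integral>x. P t u x * v x \<partial>M) = (\<integral>x. u x * P t v x \<partial>M)"
proof -
  have "asym t u v = 0"
  proof (rule asym_approx[OF t u v])
    fix u' w assume gu: "semigroup_generator M P u' w"
    have "asym t v u' = 0"
      by (rule asym_approx[OF t v generator_L2(1)[OF gu]]) (rule asym_generator_domain[OF t _ gu])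
    then show "asym t u' v = 0" using asym_skew[of t u' v] by simp
  qed
  then show ?thesis by (simp add: asym_def)
qed

end

section \<open>Lebesgue density in Ahlfors regular spaces\<close>

lemma frequently_at_right_0_iff:
  fixes Q :: "real \<Rightarrow> bool"
  shows "(\<exists>\<^sub>F r in at_right 0. Q r) \<longleftrightarrow> (\<forall>\<delta>>0. \<exists>r. 0 < r \<and> r < \<delta> \<and> Q r)"
  unfolding frequently_def eventually_at_right_field by blast

text \<open>Countably many thresholds take the place of positivity; this produces the outer union in
  \<open>upper_density_set_eq\<close>.\<close>

lemma Limsup_pos_iff:
  fixes f :: "'b \<Rightarrow> ennreal"
  shows "Limsup F f > 0 \<longleftrightarrow> (\<exists>n. \<exists>\<^sub>F x in F. ennreal (1 / real (Suc n)) < f x)"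
proof
  assume "Limsup F f > 0"
  then obtain y where y: "0 < y" "y < Limsup F f" using dense by blast
  obtain n where n: "ennreal (1 / real (Suc n)) \<le> y"
  proof (cases y)
    case (real r)
    then obtain n where "inverse (real (Suc n)) < r" using reals_Archimedean y by force
    then show ?thesis using real that[of n] by (simp add: divide_inverse ennreal_leI del: of_nat_Suc)
  qed auto
  have "\<not> (\<forall>\<^sub>F x in F. f x \<le> y)" using y Limsup_bounded[of f y F] by auto
  then have "\<exists>\<^sub>F x in F. y < f x" by (simp add: frequently_def not_less)
  then have "\<exists>\<^sub>F x in F. ennreal (1 / real (Suc n)) < f x"
    by (rule frequently_elim1) (use n in auto)
  then show "\<exists>n. \<exists>\<^sub>F x in F. ennreal (1 / real (Suc n)) < f x" by blast
next
  assume "\<exists>n. \<exists>\<^sub>F x in F. ennreal (1 / real (Suc n)) < f x"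
  then obtain n where n: "\<exists>\<^sub>F x in F. ennreal (1 / real (Suc n)) < f x" by blast
  show "Limsup F f > 0"
  proof (rule ccontr)
    assume "\<not> Limsup F f > 0"
    then have "\<forall>\<^sub>F x in F. f x < ennreal (1 / real (Suc n))"
      by (intro Limsup_lessD) simp
    then have "\<forall>\<^sub>F x in F. \<not> ennreal (1 / real (Suc n)) < f x" by eventually_elim order
    with n show False unfolding frequently_def by blast
  qed
qed

text \<open>A separated subset of largest cardinality is automatically a net, for otherwise an
  uncovered point could be added. Cardinalities are bounded because each ball of a finite cover by
  balls of radius r / 2 contains at most one point of a separated set.\<close>

lemma compact_finite_separated_net:
  fixes K :: "'a::metric_space set"
  assumes K: "compact K" and r: "r > 0"
  obtains S where "finite S" "S \<subseteq> K" "K \<subseteq> (\<Union>s\<in>S. ball s r)"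
    "\<And>s t. s \<in> S \<Longrightarrow> t \<in> S \<Longrightarrow> s \<noteq> t \<Longrightarrow> r \<le> dist s t"
proof -
  define sep where "sep S \<longleftrightarrow> finite S \<and> S \<subseteq> K \<and> (\<forall>s\<in>S. \<forall>t\<in>S. s \<noteq> t \<longrightarrow> r \<le> dist s t)" for S
  obtain T where T: "finite T" "K \<subseteq> (\<Union>t\<in>T. ball t (r/2))"
    using compactE_image[OF K, of K "\<lambda>t. ball t (r/2)"] r by (metis (no_types, lifting) UN_I centre_in_ball half_gt_zero open_ball subsetI)
  have card_le: "card S \<le> card T" if S: "sep S" for S
  proof -
    have "\<exists>t\<in>T. s \<in> ball t (r/2)" if "s \<in> S" for s
    proof -
      have "s \<in> K" using S that unfolding sep_def by blast
      with T(2) show ?thesis by blast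
    qed
    then obtain g where g: "\<And>s. s \<in> S \<Longrightarrow> g s \<in> T \<and> s \<in> ball (g s) (r/2)" by metis
    have "inj_on g S"
    proof (rule inj_onI, rule ccontr)
      fix s t assume st: "s \<in> S" "t \<in> S" "g s = g t" "s \<noteq> t"
      then have "dist s t < r" using g[of s] g[of t] dist_triangle3[of s t "g s"] by simp
      moreover have "r \<le> dist s t" using S st unfolding sep_def by blast
      ultimately show False by simp
    qed
    then show ?thesis using g T(1) by (meson card_inj_on_le image_subsetI)
  qed
  have "sep {}" by (simp add: sep_def)
  moreover have "\<forall>S. sep S \<longrightarrow> card S < Suc (card T)" using card_le by (simp add: less_Suc_eq_le)
  ultimately have "\<exists>S. sep S \<and> (\<forall>S'. sep S' \<longrightarrow> card S' \<le> card S)"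
    by (rule ex_has_greatest_nat)
  then obtain S where S: "sep S" and max: "\<And>S'. sep S' \<Longrightarrow> card S' \<le> card S"
    by auto
  have "K \<subseteq> (\<Union>s\<in>S. ball s r)"
  proof (rule subsetI, rule ccontr)
    fix x assume x: "x \<in> K" "x \<notin> (\<Union>s\<in>S. ball s r)"
    then have far: "r \<le> dist s x" if "s \<in> S" for s using that by auto
    then have "x \<notin> S" using r by force
    moreover have "sep (insert x S)" using S x far by (auto simp: sep_def dist_commute)
    ultimately show False using max[of "insert x S"] S by (simp add: sep_def)
  qed
  with S show ?thesis by (intro that[of S]) (auto simp: sep_def)
qed

locale ahlfors_space =
  fixes M :: "'a::metric_space measure" and dH c1 c2 :: real
  assumes radon_M: "radon_measure M"
    and dH_pos: "dH > 0" and c1_pos: "c1 > 0" and c2_pos: "c2 > 0"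
    and ball_lower: "r \<ge> 0 \<Longrightarrow> ennreal (c1 * r powr dH) \<le> emeasure M (ball x r)"
    and ball_upper: "r \<ge> 0 \<Longrightarrow> emeasure M (ball x r) \<le> ennreal (c2 * r powr dH)"
begin

lemma sets_M [simp, measurable_cong]: "sets M = sets borel"
  using radon_M by (simp add: radon_measure_def)

lemma space_M [simp]: "space M = UNIV"
  using sets_eq_imp_space_eq[OF sets_M] by simp

lemma ball_finite: "emeasure M (ball x r) < top"
proof (cases "r \<ge> 0")
  case True then show ?thesis using ball_upper[of r x] le_less_trans[OF _ ennreal_less_top] by blast
qed (simp add: ball_empty)

lemma ball_pos: "r > 0 \<Longrightarrow> 0 < emeasure M (ball x r)"
  using ball_lower[of r x] c1_pos by (intro less_le_trans[OF _ ball_lower]) auto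

lemma bounded_finite: "bounded A \<Longrightarrow> emeasure M A < top"
proof -
  assume "bounded A"
  then obtain r where "A \<subseteq> ball undefined r" using bounded_subset_ballD by blast
  then have "emeasure M A \<le> emeasure M (ball undefined r)" by (intro emeasure_mono) auto
  then show ?thesis using ball_finite le_less_trans by blast
qed

lemma sigma_finite_M: "sigma_finite_measure M"
proof
  show "\<exists>A. countable A \<and> A \<subseteq> sets M \<and> \<Union> A = space M \<and> (\<forall>a\<in>A. emeasure M a \<noteq> \<infinity>)"
  proof (intro exI[of _ "range (\<lambda>n::nat. ball (undefined :: 'a) (real n))"] conjI)
    show "\<Union> (range (\<lambda>n::nat. ball (undefined :: 'a) (real n))) = space M"
      using reals_Archimedean2 by auto
  qed (use ball_finite in \<open>auto simp: less_top\<close>)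
qed

lemma open_positive: "open U \<Longrightarrow> U \<noteq> {} \<Longrightarrow> 0 < emeasure M U"
proof -
  assume U: "open U" "U \<noteq> {}"
  then obtain x r where "r > 0" "ball x r \<subseteq> U" by (meson ex_in_conv openE)
  then show ?thesis using ball_pos[of r x] emeasure_mono[of "ball x r" U M] U(1) by (simp add: less_le_trans)
qed

text \<open>An open ball is the increasing union of concentric smaller ones, so a strict lower bound
  on the measure survives a slight shrinking. The room between s and r is what makes the sets
  considered next open.\<close>

lemma smaller_ball:
  assumes E: "E \<in> sets borel" and less: "a < emeasure M (ball x r \<inter> E)" and r: "r > 0"
  obtains s where "0 < s" "s < r" "a < emeasure M (ball x s \<inter> E)"
proof -
  \<comment> \<open>The double successor makes \<open>s 0 = r / 2\<close>; with a single one the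
    first radius would be 0.\<close>
  define s where "s n = r - r / real (Suc (Suc n))" for n
  have s: "0 < s n \<and> s n < r" for n using r by (simp add: s_def field_simps add_pos_nonneg)
  have "incseq s" unfolding s_def using r by (intro incseq_SucI) (simp add: field_simps)
  then have inc: "incseq (\<lambda>n. ball x (s n) \<inter> E)"
    unfolding incseq_def by (intro allI impI Int_mono subset_ball) auto
  have "(\<Union>n. ball x (s n) \<inter> E) = ball x r \<inter> E"
  proof (intro equalityI subsetI)
    fix y assume y: "y \<in> ball x r \<inter> E"
    have "s \<longlonglongrightarrow> r - 0"
      unfolding s_def by (intro tendsto_intros LIMSEQ_Suc[OF LIMSEQ_Suc[OF lim_const_over_n]])
    then have "\<forall>\<^sub>F n in sequentially. dist x y < s n" using y by (intro order_tendstoD(1)[of s r]) auto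
    then obtain n where "dist x y < s n" using eventually_happens[of _ sequentially] by auto
    then show "y \<in> (\<Union>n. ball x (s n) \<inter> E)" using y by auto
  qed (use s in \<open>auto intro: less_trans\<close>)
  then have "(SUP n. emeasure M (ball x (s n) \<inter> E)) = emeasure M (ball x r \<inter> E)"
    using SUP_emeasure_incseq[OF _ inc, of M] E by (simp add: image_subset_iff)
  with less have "a < (SUP n. emeasure M (ball x (s n) \<inter> E))" by simp
  then obtain n where "a < emeasure M (ball x (s n) \<inter> E)" unfolding less_SUP_iff by blast
  with s show ?thesis using that by blast
qed

section \<open>Borel measurability of ball measures, density sets and boundary
  neighbourhoods\<close>

lemma open_ball_measure_greater:
  assumes E: "E \<in> sets borel"
  shows "open {x. a < emeasure M (ball x r \<inter> E)}"
  unfolding open_contains_ball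
proof
  fix x assume x: "x \<in> {x. a < emeasure M (ball x r \<inter> E)}"
  then have r: "r > 0" by (cases "r > 0") (auto simp: ball_empty)
  from x obtain s where s: "0 < s" "s < r" "a < emeasure M (ball x s \<inter> E)"
    using smaller_ball[OF E _ r] by blast
  have "ball x (r - s) \<subseteq> {x. a < emeasure M (ball x r \<inter> E)}"
  proof
    fix y assume y: "y \<in> ball x (r - s)"
    have "ball x s \<subseteq> ball y r"
    proof
      fix z assume "z \<in> ball x s"
      then show "z \<in> ball y r" using y dist_triangle3[of y z x] by simp
    qed
    then have "emeasure M (ball x s \<inter> E) \<le> emeasure M (ball y r \<inter> E)"
      using E by (intro emeasure_mono) auto
    with s show "y \<in> {x. a < emeasure M (ball x r \<inter> E)}" by auto
  qed
  then show "\<exists>e>0. ball x e \<subseteq> {x. a < emeasure M (ball x r \<inter> E)}"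
    using s by (intro exI[of _ "r - s"]) auto
qed

lemma measurable_ball_measure:
  "E \<in> sets borel \<Longrightarrow> (\<lambda>x. emeasure M (ball x r \<inter> E)) \<in> borel_measurable M"
  by (rule borel_measurableI_greater) (simp add: open_ball_measure_greater)

lemma measurable_ball_measure' [measurable]:
  "(\<lambda>x. emeasure M (ball x r)) \<in> borel_measurable M"
  using measurable_ball_measure[of UNIV] by simp

text \<open>For a single radius the condition is not open in \<open>x\<close>, because \<open>\<mu> (ball x r)\<close> is only lower
  semicontinuous; letting the radius vary repairs this.\<close>

lemma open_density_greater:
  assumes E: "E \<in> sets borel"
  shows "open {x. \<exists>r. 0 < r \<and> r < \<delta> \<and> c * emeasure M (ball x r) < emeasure M (ball x r \<inter> E)}"
    (is "open ?S")
  unfolding open_contains_ball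
proof
  fix x assume "x \<in> ?S"
  then obtain r where r: "0 < r" "r < \<delta>" and gr: "c * emeasure M (ball x r) < emeasure M (ball x r \<inter> E)"
    by auto
  obtain s where s: "0 < s" "s < r" and grs: "c * emeasure M (ball x r) < emeasure M (ball x s \<inter> E)"
    using smaller_ball[OF E gr r(1)] .
  have "ball x ((r - s) / 2) \<subseteq> ?S"
  proof
    fix y assume y: "y \<in> ball x ((r - s) / 2)"
    \<comment> \<open>With the midpoint radius, any y within (r - s) / 2 of x satisfies
      \<open>ball x s\<close> \<subseteq> \<open>ball y t\<close> \<subseteq>
      \<open>ball x r\<close>. One inclusion controls the part in E from below, the other the whole
      ball from above.\<close>
    define t where "t = (r + s) / 2"
    have "ball x s \<subseteq> ball y t"
    proof
      fix z assume "z \<in> ball x s"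
      then show "z \<in> ball y t" using y dist_triangle3[of y z x] by (simp add: t_def field_simps)
    qed
    then have 1: "emeasure M (ball x s \<inter> E) \<le> emeasure M (ball y t \<inter> E)"
      using E by (intro emeasure_mono) auto
    have "ball y t \<subseteq> ball x r"
    proof
      fix z assume "z \<in> ball y t"
      then show "z \<in> ball x r" using y dist_triangle[of x z y] by (simp add: t_def field_simps)
    qed
    then have "c * emeasure M (ball y t) \<le> c * emeasure M (ball x r)"
      by (intro mult_left_mono emeasure_mono) auto
    with 1 grs have "c * emeasure M (ball y t) < emeasure M (ball y t \<inter> E)" by order
    moreover have "0 < t" "t < \<delta>" using r s by (auto simp: t_def)
    ultimately show "y \<in> ?S" by blast
  qed
  then show "\<exists>e>0. ball x e \<subseteq> ?S"
    using s by (intro exI[of _ "(r - s) / 2"]) auto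
qed

lemma less_divide_ball_iff:
  "r > 0 \<Longrightarrow> c < a / emeasure M (ball x r) \<longleftrightarrow> c * emeasure M (ball x r) < a"
proof -
  assume r: "r > 0"
  define b where "b = emeasure M (ball x r)"
  have b: "b \<noteq> 0" "b \<noteq> top" "b < top" using ball_pos[OF r, of x] ball_finite[of x r] by (auto simp: b_def)
  have "a / b \<le> c \<longleftrightarrow> a \<le> c * b"
  proof
    assume "a / b \<le> c"
    then have "a / b * b \<le> c * b" by (rule mult_right_mono) simp
    then show "a \<le> c * b" using b by (simp add: ennreal_divide_times)
  next
    assume "a \<le> c * b"
    then have "a / b \<le> c * b / b" by (rule divide_right_mono_ennreal)
    then show "a / b \<le> c" using b by (simp add: ennreal_times_divide[symmetric])
  qed
  then show ?thesis unfolding b_def by (metis not_le)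
qed

text \<open>Each set on the right is open by \<open>open_density_greater\<close>, which exhibits the
  density set as a countable union of countable intersections of open sets.\<close>

lemma upper_density_set_eq:
  "upper_density_set M E = (\<Union>n. \<Inter>m. {x. \<exists>r. 0 < r \<and> r < 1 / real (Suc m) \<and>
      ennreal (1 / real (Suc n)) * emeasure M (ball x r) < emeasure M (ball x r \<inter> E)})"
proof -
  have "(\<exists>\<^sub>F r in at_right 0. c < emeasure M (ball x r \<inter> E) / emeasure M (ball x r)) \<longleftrightarrow>
    (\<forall>m. \<exists>r. 0 < r \<and> r < 1 / real (Suc m) \<and> c * emeasure M (ball x r) < emeasure M (ball x r \<inter> E))"
    (is "?L \<longleftrightarrow> ?R") for c x
  proof -
    have "?L \<longleftrightarrow> (\<forall>\<delta>>0. \<exists>r. 0 < r \<and> r < \<delta> \<and> c * emeasure M (ball x r) < emeasure M (ball x r \<inter> E))"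
      unfolding frequently_at_right_0_iff by (simp add: less_divide_ball_iff cong: conj_cong)
    also have "\<dots> \<longleftrightarrow> ?R"
    proof (intro iffI allI impI)
      fix \<delta> :: real assume R: ?R and "\<delta> > 0"
      then obtain m where "inverse (real (Suc m)) < \<delta>" using reals_Archimedean by blast
      with R show "\<exists>r. 0 < r \<and> r < \<delta> \<and> c * emeasure M (ball x r) < emeasure M (ball x r \<inter> E)"
        by (metis inverse_eq_divide less_trans)
    qed (auto simp del: of_nat_Suc)
    finally show ?thesis .
  qed
  then show ?thesis unfolding upper_density_set_def Limsup_pos_iff by (simp only:) blast
qed

lemma sets_upper_density_set:
  assumes E: "E \<in> sets borel"
  shows "upper_density_set M E \<in> sets borel"
  unfolding upper_density_set_eq
  by (intro sets.countable_UN'' sets.countable_INT'' borel_open open_density_greater[OF E]) auto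

lemma sets_boundary_nbhd:
  assumes "E \<in> sets borel"
  shows "boundary_nbhd M r E \<in> sets borel"
proof -
  have "measure_nbhd M r F \<in> sets borel" if "F \<in> sets borel" for F
    unfolding measure_nbhd_def by (intro borel_open open_ball_measure_greater[OF that])
  then show ?thesis using assms unfolding boundary_nbhd_def
    by (intro sets.Un sets.Int sets_upper_density_set) auto
qed

section \<open>Positive upper density at almost every point, by a covering argument\<close>

lemma compact_nbhd_measure:
  assumes K: "compact K"
  shows "(\<lambda>n. emeasure M (\<Union>k\<in>K. ball k (1 / real (Suc n)))) \<longlonglongrightarrow> emeasure M K"
proof -
  let ?U = "\<lambda>n. \<Union>k\<in>K. ball k (1 / real (Suc n))"
  have "(\<lambda>n. emeasure M (?U n)) \<longlonglongrightarrow> emeasure M (\<Inter>n. ?U n)"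
  proof (rule Lim_emeasure_decseq)
    have "?U (Suc n) \<subseteq> ?U n" for n
      by (intro UN_mono subset_ball) (auto simp: field_simps)
    then show "decseq ?U" by (rule decseq_SucI)
    fix n
    obtain e where xe: "K \<subseteq> ball undefined e"
      using bounded_subset_ballD[OF compact_imp_bounded[OF K]] by blast
    have "?U n \<subseteq> ball undefined (e + 1)"
    proof
      fix y assume "y \<in> ?U n"
      then obtain k where k: "k \<in> K" "dist k y < 1 / real (Suc n)" by auto
      have "1 / real (Suc n) \<le> 1" by simp
      with k(2) have "dist k y < 1" by linarith
      moreover have "dist undefined k < e" using k(1) xe by auto
      ultimately show "y \<in> ball undefined (e + 1)" using dist_triangle[of undefined y k] by simp
    qed
    then have "bounded (?U n)" using bounded_ball bounded_subset by blast
    then show "emeasure M (?U n) \<noteq> \<infinity>" using bounded_finite by (simp add: less_top)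
  qed (auto intro!: borel_open open_UN)
  moreover have "(\<Inter>n. ?U n) = K"
  proof (intro equalityI subsetI)
    fix y assume y: "y \<in> (\<Inter>n. ?U n)"
    have "y \<in> closure K"
      unfolding closure_approachable
    proof (intro allI impI)
      fix e :: real assume "e > 0"
      then obtain n where n: "inverse (real (Suc n)) < e" using reals_Archimedean by blast
      from y obtain k where "k \<in> K" "dist k y < 1 / real (Suc n)" by auto
      with n show "\<exists>k\<in>K. dist k y < e" by (metis inverse_eq_divide less_trans)
    qed
    then show "y \<in> K" using compact_imp_closed[OF K] by simp
  next
    fix y assume "y \<in> K"
    then show "y \<in> (\<Inter>n. ?U n)" by (force intro!: bexI[of _ y])
  qed
  ultimately show ?thesis by simp
qed

lemma ball_doubling:
  assumes "r > 0"
  shows "emeasure M (ball x r) \<le> ennreal (c2 * 2 powr dH / c1) * emeasure M (ball x (r/2))"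
proof -
  have "emeasure M (ball x r) \<le> ennreal (c2 * r powr dH)" using assms by (intro ball_upper) simp
  also have "c2 * r powr dH = (c2 * 2 powr dH / c1) * (c1 * (r/2) powr dH)"
    using assms c1_pos by (simp add: powr_divide)
  also have "ennreal \<dots> = ennreal (c2 * 2 powr dH / c1) * ennreal (c1 * (r/2) powr dH)"
    using c1_pos c2_pos by (intro ennreal_mult) auto
  also have "\<dots> \<le> ennreal (c2 * 2 powr dH / c1) * emeasure M (ball x (r/2))"
    using assms by (intro mult_left_mono ball_lower) auto
  finally show ?thesis .
qed

text \<open>The constant is half the inverse of the doubling constant. Cover K by balls around an
  r-separated net: each of them meets E in at most half the measure of the concentric ball of radius
  r / 2, and these smaller balls are disjoint and lie in the r-neighbourhood of K. As r tends to 0,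
  the measure of K is at most half of itself, and it is finite.\<close>

lemma thin_compact_null:
  assumes E: "E \<in> sets borel" and K: "compact K" "K \<subseteq> E" and \<delta>: "\<delta> > 0"
    and thin: "\<And>x r. x \<in> K \<Longrightarrow> 0 < r \<Longrightarrow> r < \<delta> \<Longrightarrow>
      emeasure M (ball x r \<inter> E) \<le> ennreal (c1 / (2 * c2 * 2 powr dH)) * emeasure M (ball x r)"
  shows "emeasure M K = 0"
proof -
  let ?U = "\<lambda>n. \<Union>k\<in>K. ball k (1 / real (Suc n))"
  have half: "emeasure M K \<le> ennreal (1/2) * emeasure M (?U n)" if n: "1 / real (Suc n) < \<delta>" for n
  proof -
    define r where "r = 1 / real (Suc n)"
    have r: "r > 0" "r < \<delta>" using n by (auto simp: r_def)
    obtain S where S: "finite S" "S \<subseteq> K" "K \<subseteq> (\<Union>s\<in>S. ball s r)"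
      and sep: "\<And>s t. s \<in> S \<Longrightarrow> t \<in> S \<Longrightarrow> s \<noteq> t \<Longrightarrow> r \<le> dist s t"
      using compact_finite_separated_net[OF K(1) r(1)] by blast
    have "emeasure M K \<le> emeasure M (\<Union>s\<in>S. ball s r \<inter> E)"
      using S K E by (intro emeasure_mono) (auto intro!: sets.finite_UN)
    also have "\<dots> \<le> (\<Sum>s\<in>S. emeasure M (ball s r \<inter> E))"
      using S E by (intro emeasure_subadditive_finite) auto
    also have "\<dots> \<le> (\<Sum>s\<in>S. ennreal (1/2) * emeasure M (ball s (r/2)))"
    proof (rule sum_mono)
      fix s assume s: "s \<in> S"
      have "emeasure M (ball s r \<inter> E) \<le> ennreal (c1 / (2 * c2 * 2 powr dH)) * emeasure M (ball s r)"
        using s S r by (intro thin) auto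
      also have "\<dots> \<le> ennreal (c1 / (2 * c2 * 2 powr dH)) * (ennreal (c2 * 2 powr dH / c1) * emeasure M (ball s (r/2)))"
        by (intro mult_left_mono ball_doubling r) simp
      also have "\<dots> = ennreal (c1 / (2 * c2 * 2 powr dH) * (c2 * 2 powr dH / c1)) * emeasure M (ball s (r/2))"
        using c1_pos c2_pos by (subst ennreal_mult) (auto simp: mult.assoc)
      also have "c1 / (2 * c2 * 2 powr dH) * (c2 * 2 powr dH / c1) = 1/2"
        using c1_pos c2_pos by (simp add: field_simps)
      finally show "emeasure M (ball s r \<inter> E) \<le> ennreal (1/2) * emeasure M (ball s (r/2))" .
    qed
    also have "\<dots> = ennreal (1/2) * emeasure M (\<Union>s\<in>S. ball s (r/2))"
    proof -
      have "disjoint_family_on (\<lambda>s. ball s (r/2)) S"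
        unfolding disjoint_family_on_def
      proof (intro ballI impI)
        fix s t assume "s \<in> S" "t \<in> S" "s \<noteq> t"
        then have rst: "r \<le> dist s t" by (rule sep)
        show "ball s (r/2) \<inter> ball t (r/2) = {}"
        proof (rule ccontr)
          assume "ball s (r/2) \<inter> ball t (r/2) \<noteq> {}"
          then obtain z where "dist s z < r/2" "dist t z < r/2" by auto
          then show False using rst dist_triangle2[of s t z] by simp
        qed
      qed
      then show ?thesis using S(1) by (simp add: sum_distrib_left[symmetric] sum_emeasure image_subset_iff)
    qed
    also have "\<dots> \<le> ennreal (1/2) * emeasure M (?U n)"
    proof (intro mult_left_mono emeasure_mono UN_mono S)
      show "ball s (r/2) \<subseteq> ball s (1 / real (Suc n))" for s
        using r(1) unfolding r_def[symmetric] by (intro subset_ball) simp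
    qed (auto intro!: borel_open open_UN)
    finally show ?thesis .
  qed
  obtain N where N: "inverse (real (Suc N)) < \<delta>" using reals_Archimedean[OF \<delta>] by blast
  have "emeasure M K \<le> ennreal (1/2) * emeasure M K"
  proof (rule LIMSEQ_le_const)
    show "(\<lambda>n. ennreal (1/2) * emeasure M (?U n)) \<longlonglongrightarrow> ennreal (1/2) * emeasure M K"
      by (intro ennreal_tendsto_cmult compact_nbhd_measure K) (rule ennreal_less_top)
    have "emeasure M K \<le> ennreal (1/2) * emeasure M (?U n)" if "n \<ge> N" for n
    proof (rule half)
      have "1 / real (Suc n) \<le> inverse (real (Suc N))" using that unfolding inverse_eq_divide by (intro frac_le) auto
      with N show "1 / real (Suc n) < \<delta>" by linarith
    qed
    then show "\<exists>N. \<forall>n\<ge>N. emeasure M K \<le> ennreal (1/2) * emeasure M (?U n)" by blast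
  qed
  moreover have "emeasure M K < top" by (intro bounded_finite compact_imp_bounded K)
  ultimately show ?thesis
  proof (cases "emeasure M K")
    case (real m)
    assume "emeasure M K \<le> ennreal (1/2) * emeasure M K"
    then have "m \<le> 1/2 * m" using real by (simp add: ennreal_mult[symmetric] del: ennreal_half)
    then show ?thesis using real by simp
  qed auto
qed

text \<open>Only positivity of the upper density is claimed, not density one, so the crude threshold
  of \<open>thin_compact_null\<close> is enough. The points of E violating it at all scales below 1
  / (m + 1) form a Borel set whose compact subsets are null, and inner regularity makes the set
  itself null.\<close>

theorem AE_upper_density:
  assumes E: "E \<in> sets borel"
  shows "AE x in M. x \<in> E \<longrightarrow> x \<in> upper_density_set M E"
proof -
  define \<eta> where "\<eta> = c1 / (2 * c2 * 2 powr dH)"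
  have \<eta>: "\<eta> > 0" using c1_pos c2_pos by (simp add: \<eta>_def)
  define N where "N m = E - {x. \<exists>r. 0 < r \<and> r < 1 / real (Suc m) \<and>
      ennreal \<eta> * emeasure M (ball x r) < emeasure M (ball x r \<inter> E)}" for m
  have sets_N: "N m \<in> sets borel" for m
    unfolding N_def by (intro sets.Diff E borel_open open_density_greater)
  have "emeasure M (N m) = 0" for m
  proof -
    have "emeasure M K = 0" if K: "compact K" "K \<subseteq> N m" for K
    proof (rule thin_compact_null[OF E K(1)])
      show "K \<subseteq> E" using K(2) by (auto simp: N_def)
      fix x r assume "x \<in> K" "0 < r" "r < 1 / real (Suc m)"
      then show "emeasure M (ball x r \<inter> E) \<le> ennreal (c1 / (2 * c2 * 2 powr dH)) * emeasure M (ball x r)"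
        using K(2) unfolding N_def \<eta>_def[symmetric] not_less[symmetric] by blast
    qed simp
    moreover have "emeasure M (N m) = (SUP K\<in>{K. compact K \<and> K \<subseteq> N m}. emeasure M K)"
      using radon_M sets_N unfolding radon_measure_def by blast
    moreover have "\<dots> \<le> 0" using calculation(1) by (intro SUP_least) auto
    ultimately show ?thesis by simp
  qed
  then have "AE x in M. x \<notin> N m" for m
    using sets_N by (intro AE_not_in) (auto simp: null_sets_def)
  then have "AE x in M. \<forall>m. x \<notin> N m" by (simp add: AE_all_countable)
  then show ?thesis
  proof eventually_elim
    case (elim x)
    obtain n where n: "inverse (real (Suc n)) < \<eta>" using reals_Archimedean[OF \<eta>] by blast
    show ?case
    proof
      assume "x \<in> E"
      have "\<exists>r. 0 < r \<and> r < 1 / real (Suc m) \<and>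
          ennreal (1 / real (Suc n)) * emeasure M (ball x r) < emeasure M (ball x r \<inter> E)" for m
      proof -
        obtain r where r: "0 < r" "r < 1 / real (Suc m)"
          and gr: "ennreal \<eta> * emeasure M (ball x r) < emeasure M (ball x r \<inter> E)"
          using elim \<open>x \<in> E\<close> unfolding N_def by blast
        have "ennreal (1 / real (Suc n)) * emeasure M (ball x r) \<le> ennreal \<eta> * emeasure M (ball x r)"
          using n by (intro mult_right_mono ennreal_leI) (auto simp: inverse_eq_divide simp del: of_nat_Suc)
        then show ?thesis using r gr by (meson le_less_trans)
      qed
      then show "x \<in> upper_density_set M E" unfolding upper_density_set_eq by blast
    qed
  qed
qed


section \<open>The Korevaar-Schoen energy of an indicator\<close>

text \<open>The integral over y in \<open>ball x r\<close> of the difference of the values of the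
  indicator at x and y, before normalisation.\<close>

definition jump :: "'a set \<Rightarrow> real \<Rightarrow> 'a \<Rightarrow> ennreal" where
  "jump E r x = emeasure M (ball x r \<inter> (if x \<in> E then - E else E))"

lemma KS_energy_indicator:
  assumes E: "E \<in> sets borel"
  shows "KS_energy M l (indicator E) r
    = (\<integral>\<^sup>+x. jump E r x / (ennreal (r powr l) * emeasure M (ball x r)) \<partial>M)"
  unfolding KS_energy_def
proof (intro nn_integral_cong)
  fix x
  let ?F = "if x \<in> E then - E else E" and ?b = "ennreal (r powr l) * emeasure M (ball x r)"
  have F: "ball x r \<inter> ?F \<in> sets M" using E by auto
  have "(\<integral>\<^sup>+y\<in>ball x r. ennreal \<bar>indicator E y - indicator E x\<bar> / ?b \<partial>M)
      = (\<integral>\<^sup>+y. inverse ?b * indicator (ball x r \<inter> ?F) y \<partial>M)"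
    by (intro nn_integral_cong) (auto simp: indicator_def divide_ennreal_def)
  also have "\<dots> = jump E r x / ?b"
    using F by (simp add: nn_integral_cmult_indicator jump_def divide_ennreal_def mult.commute)
  finally show "(\<integral>\<^sup>+y\<in>ball x r. ennreal \<bar>indicator E y - indicator E x\<bar> / ?b \<partial>M) = jump E r x / ?b" .
qed

lemma measurable_jump:
  assumes "E \<in> sets borel"
  shows "jump E r \<in> borel_measurable M"
proof -
  have [measurable]: "E \<in> sets M" "(\<lambda>x. emeasure M (ball x r \<inter> - E)) \<in> borel_measurable M"
    "(\<lambda>x. emeasure M (ball x r \<inter> E)) \<in> borel_measurable M"
    using assms by (auto intro!: measurable_ball_measure)
  have "jump E r = (\<lambda>x. if x \<in> E then emeasure M (ball x r \<inter> - E) else emeasure M (ball x r \<inter> E))"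
    by (auto simp: jump_def fun_eq_iff)
  then show ?thesis by simp
qed

lemma KS_energy_le_boundary_nbhd:
  assumes E: "E \<in> sets borel" and r: "r > 0"
  shows "KS_energy M l (indicator E) r \<le> emeasure M (boundary_nbhd M r E) / ennreal (r powr l)"
proof -
  have "AE x in M. x \<in> - E \<longrightarrow> x \<in> upper_density_set M (- E)"
    using E by (intro AE_upper_density) auto
  with AE_upper_density[OF E]
  have "AE x in M. jump E r x / (ennreal (r powr l) * emeasure M (ball x r))
      \<le> inverse (ennreal (r powr l)) * indicator (boundary_nbhd M r E) x"
  proof eventually_elim
    case (elim x)
    show ?case
    proof (cases "jump E r x = 0")
      case False
      then have pos: "jump E r x > 0" by (simp add: zero_less_iff_neq_zero)
      have "x \<in> boundary_nbhd M r E"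
        using elim pos unfolding boundary_nbhd_def measure_nbhd_def jump_def by (cases "x \<in> E") auto
      moreover have "jump E r x / (ennreal (r powr l) * emeasure M (ball x r)) \<le> inverse (ennreal (r powr l))"
      proof -
        have b: "emeasure M (ball x r) \<noteq> 0" "emeasure M (ball x r) \<noteq> top"
          using ball_pos[OF r, of x] ball_finite[of x r] by auto
        have "jump E r x / (ennreal (r powr l) * emeasure M (ball x r))
            \<le> emeasure M (ball x r) / (ennreal (r powr l) * emeasure M (ball x r))"
          using E by (intro divide_right_mono_ennreal) (auto simp: jump_def intro!: emeasure_mono)
        also have "\<dots> = 1 * emeasure M (ball x r) / (ennreal (r powr l) * emeasure M (ball x r))" by simp
        also have "\<dots> = 1 / ennreal (r powr l)" using b by (intro divide_mult_eq) auto
        finally show ?thesis by (simp add: divide_ennreal_def)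
      qed
      ultimately show ?thesis by simp
    qed simp
  qed
  then have "KS_energy M l (indicator E) r
      \<le> (\<integral>\<^sup>+x. inverse (ennreal (r powr l)) * indicator (boundary_nbhd M r E) x \<partial>M)"
    unfolding KS_energy_indicator[OF E] by (rule nn_integral_mono_AE)
  also have "\<dots> = emeasure M (boundary_nbhd M r E) / ennreal (r powr l)"
    using sets_boundary_nbhd[OF E] by (simp add: nn_integral_cmult_indicator divide_ennreal_def mult.commute)
  finally show ?thesis .
qed

lemma Liminf_KS_energy_le_content:
  assumes "E \<in> sets borel"
  shows "Liminf (at_right 0) (KS_energy M l (indicator E)) \<le> lower_minkowski_content M l E"
  unfolding lower_minkowski_content_def
  by (intro Liminf_mono eventually_mono[OF eventually_at_right_less] KS_energy_le_boundary_nbhd assms)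

end

section \<open>Kernels with sub-Gaussian bounds\<close>

text \<open>From ln y \<le> y at y = c z / m. The true maximum, at z = m / c, is smaller by the
  factor exp (- m). The lemma absorbs powers of the distance into the exponential decay of the
  kernel.\<close>

lemma powr_mult_exp_le:
  fixes m c z :: real
  assumes m: "m > 0" and c: "c > 0" and z: "z \<ge> 0"
  shows "z powr m * exp (- c * z) \<le> (m / c) powr m"
proof (cases "z = 0")
  case False
  with z have z: "z > 0" by simp
  have "ln (c * z / m) \<le> c * z / m"
    using ln_le_minus_one[of "c * z / m"] m c z by simp
  then have "m * ln (c * z / m) \<le> c * z" using m by (simp add: field_simps)
  moreover have "ln (c * z / m) = ln z - ln (m / c)" using m c z by (simp add: ln_div ln_mult)
  ultimately have "m * ln z \<le> m * ln (m / c) + c * z" by (simp add: algebra_simps)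
  then have "z powr m \<le> (m / c) powr m * exp (c * z)"
    using m c z by (simp add: powr_def exp_add[symmetric])
  then have "z powr m * exp (- c * z) \<le> (m / c) powr m * exp (c * z) * exp (- c * z)"
    by (rule mult_right_mono) simp
  then show ?thesis by (simp add: mult.assoc exp_add[symmetric])
qed (use m in simp)

lemma Holder_continuous:
  fixes h :: "'b::metric_space \<Rightarrow> real"
  assumes \<kappa>: "\<kappa> > 0" and h: "\<And>x y. \<bar>h x - h y\<bar> \<le> B * dist x y powr \<kappa>"
  shows "continuous_on UNIV h"
  unfolding continuous_on_def
proof
  fix x :: 'b
  have "(h \<longlongrightarrow> h x) (at x)"
  proof (rule LIM_zero_cancel, rule Lim_null_comparison)
    show "\<forall>\<^sub>F y in at x. norm (h y - h x) \<le> B * dist y x powr \<kappa>"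
      using h by simp
    have "((\<lambda>y. B * dist y x powr \<kappa>) \<longlongrightarrow> B * dist x x powr \<kappa>) (at x)"
      using \<kappa> by (intro tendsto_intros tendsto_powr2) auto
    then show "((\<lambda>y. B * dist y x powr \<kappa>) \<longlongrightarrow> 0) (at x)" using \<kappa> by simp
  qed
  then show "(h \<longlongrightarrow> h x) (at x within UNIV)" by simp
qed

text \<open>The bounds are required at every pair of points, and \<open>weak_BE\<close> uses a
  pointwise bound instead of the essential supremum. The properties inherited from the semigroup are
  restricted to bounded functions because the measurability of \<open>kernel_op M p t u\<close> is
  obtained from the Hoelder estimate, which concerns bounded u.\<close>

locale sub_gaussian_kernel = ahlfors_space M dH c1 c2
  for M :: "'a::metric_space measure" and dH c1 c2 +
  fixes p :: "real \<Rightarrow> 'a \<Rightarrow> 'a \<Rightarrow> real" and dW \<kappa> c3 c4 c5 c6 D :: real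
  assumes dW: "dW > 2" and \<kappa>_pos: "\<kappa> > 0" and \<kappa>_less: "\<kappa> < dW"
    and c3_pos: "c3 > 0" and c4_pos: "c4 > 0" and c5_pos: "c5 > 0" and c6_pos: "c6 > 0"
    and D_pos: "D > 0"
    and p_continuous: "t > 0 \<Longrightarrow> continuous_on UNIV (\<lambda>(x, y). p t x y)"
    and p_lower: "t > 0 \<Longrightarrow> sub_gaussian dH dW c5 c6 t x y \<le> p t x y"
    and p_upper: "t > 0 \<Longrightarrow> p t x y \<le> sub_gaussian dH dW c3 c4 t x y"
    and weak_BE: "\<lbrakk>t > 0; g \<in> borel_measurable M; \<And>x. \<bar>g x\<bar> \<le> b\<rbrakk> \<Longrightarrow>
      \<bar>kernel_op M p t g x - kernel_op M p t g y\<bar> \<le> D * (dist x y powr \<kappa> / t powr (\<kappa> / dW)) * b"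
    and kernel_L2: "\<lbrakk>t > 0; u \<in> L2_space M; \<And>x. \<bar>u x\<bar> \<le> b\<rbrakk> \<Longrightarrow> kernel_op M p t u \<in> L2_space M"
    and kernel_sym: "\<lbrakk>t > 0; u \<in> L2_space M; \<And>x. \<bar>u x\<bar> \<le> b; v \<in> L2_space M; \<And>x. \<bar>v x\<bar> \<le> b'\<rbrakk> \<Longrightarrow>
      (\<integral>x. kernel_op M p t u x * v x \<partial>M) = (\<integral>x. u x * kernel_op M p t v x \<partial>M)"
    and kernel_semigroup_AE: "\<lbrakk>s > 0; t > 0; u \<in> L2_space M; \<And>x. \<bar>u x\<bar> \<le> b\<rbrakk> \<Longrightarrow>
      AE x in M. kernel_op M p (s + t) u x = kernel_op M p s (kernel_op M p t u) x"
begin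

abbreviation "K \<equiv> kernel_op M p"

text \<open>In this variable both sub-Gaussian bounds become pure exponentials.\<close>

definition gauge :: "real \<Rightarrow> 'a \<Rightarrow> 'a \<Rightarrow> real" where
  "gauge t x y = (dist x y powr dW / t) powr (1 / (dW - 1))"

lemma sub_gaussian_gauge:
  "sub_gaussian dH dW a b t x y = a * t powr (- dH / dW) * exp (- b * gauge t x y)"
  by (simp add: sub_gaussian_def gauge_def)

lemma gauge_nonneg: "gauge t x y \<ge> 0"
  by (simp add: gauge_def)

text \<open>Solves \<open>gauge\<close> for the distance, so that a power of the distance times the
  kernel bound takes the form treated in \<open>powr_mult_exp_le\<close>.\<close>

lemma dist_powr_gauge:
  assumes t: "t > 0" and m: "m > 0"
  shows "dist x y powr m = t powr (m / dW) * gauge t x y powr (m * (dW - 1) / dW)"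
proof -
  have "gauge t x y powr (m * (dW - 1) / dW) = (dist x y powr dW / t) powr (m / dW)"
    using dW by (simp add: gauge_def powr_powr)
  also have "\<dots> = dist x y powr m / t powr (m / dW)"
    using dW t by (simp add: powr_divide powr_powr)
  finally show ?thesis using t by simp
qed

lemma p_nonneg: "t > 0 \<Longrightarrow> 0 \<le> p t x y"
  using p_lower[of t x y] c5_pos by (intro order_trans[OF _ p_lower]) (auto simp: sub_gaussian_def)

lemma p_measurable [measurable]: "t > 0 \<Longrightarrow> p t x \<in> borel_measurable M"
proof -
  assume "t > 0"
  then have "continuous_on UNIV ((\<lambda>(x, y). p t x y) \<circ> (\<lambda>y. (x, y)))"
    by (intro continuous_on_compose continuous_intros) (auto intro: continuous_on_subset[OF p_continuous])
  then have "continuous_on UNIV (p t x)" by (simp add: o_def)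
  then show ?thesis using borel_measurable_continuous_onI measurable_cong_sets[OF sets_M refl] by blast
qed

text \<open>The exponential is traded for polynomial decay of order dH + 1 in units of t^(1/dW).
  This is one order better than the volume growth, so that the sum over dyadic balls becomes
  geometric.\<close>

lemma p_le_dyadic:
  obtains A where "A > 0" "\<And>t x y. t > 0 \<Longrightarrow> \<exists>k. dist x y < 2 ^ k * t powr (1 / dW) \<and>
    p t x y \<le> A * t powr (- dH / dW) * 2 powr (- real k * (dH + 1))"
proof -
  define m where "m = (dH + 1) * (dW - 1) / dW"
  have m: "m > 0" using dH_pos dW by (simp add: m_def)
  define C where "C = (m / c4) powr m"
  \<comment> \<open>The 1 serves k = 0, where the distance has no lower bound. For k > 0 minimality
    bounds the distance below by 2^(k-1) units only, and the shift costs the factor 2^(dH +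
    1).\<close>
  define A where "A = c3 * max 1 (C * 2 powr (dH + 1))"
  have A: "A > 0" "c3 \<le> A" "c3 * (C * 2 powr (dH + 1)) \<le> A"
    using c3_pos by (auto simp: A_def)
  have "\<exists>k. dist x y < 2 ^ k * t powr (1 / dW) \<and>
    p t x y \<le> A * t powr (- dH / dW) * 2 powr (- real k * (dH + 1))" if t: "t > 0" for t x y
  proof -
    define \<rho> where "\<rho> = t powr (1 / dW)"
    have \<rho>: "\<rho> > 0" using t by (simp add: \<rho>_def)
    obtain k0 where "dist x y / \<rho> < 2 ^ k0" using real_arch_pow[of 2 "dist x y / \<rho>"] by auto
    then have ex: "dist x y < 2 ^ k0 * \<rho>" using \<rho> by (simp add: field_simps)
    define k where "k = (LEAST k. dist x y < 2 ^ k * \<rho>)"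
    have k: "dist x y < 2 ^ k * \<rho>" unfolding k_def using ex by (rule LeastI)
    have upper: "p t x y \<le> c3 * t powr (- dH / dW) * exp (- c4 * gauge t x y)"
      using p_upper[OF t] by (simp add: sub_gaussian_gauge)
    have "p t x y \<le> A * t powr (- dH / dW) * 2 powr (- real k * (dH + 1))"
    proof (cases k)
      case 0
      have "c3 * t powr (- dH / dW) * exp (- c4 * gauge t x y) \<le> A * t powr (- dH / dW) * 1"
        using c3_pos c4_pos A gauge_nonneg[of t x y] t by (intro mult_mono) auto
      with upper 0 show ?thesis by simp
    next
      case (Suc j)
      have "\<not> dist x y < 2 ^ j * \<rho>" using Suc not_less_Least[of j "\<lambda>k. dist x y < 2 ^ k * \<rho>"]
        by (simp add: k_def)
      then have d: "2 ^ j * \<rho> \<le> dist x y" by simp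
      have "(2 ^ j * \<rho>) powr (dH + 1) \<le> dist x y powr (dH + 1)"
        using d \<rho> dH_pos by (intro powr_mono2) auto
      also have "\<dots> = \<rho> powr (dH + 1) * gauge t x y powr m"
        using dist_powr_gauge[OF t, of "dH + 1"] dH_pos by (simp add: \<rho>_def powr_powr m_def)
      finally have "(2 ^ j) powr (dH + 1) \<le> gauge t x y powr m"
        using \<rho> by (simp add: powr_mult mult.commute)
      then have "(2 ^ j) powr (dH + 1) * exp (- c4 * gauge t x y) \<le> gauge t x y powr m * exp (- c4 * gauge t x y)"
        by (intro mult_right_mono) auto
      also have "\<dots> \<le> C" unfolding C_def by (intro powr_mult_exp_le m c4_pos gauge_nonneg)
      finally have "exp (- c4 * gauge t x y) \<le> C / (2 ^ j) powr (dH + 1)" by (simp add: field_simps)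
      also have "(2 ^ j) powr (dH + 1) = 2 powr (real j * (dH + 1))"
        by (simp add: powr_realpow[symmetric] powr_powr)
      also have "C / \<dots> = C * 2 powr (- (real j * (dH + 1)))"
        by (simp add: powr_minus divide_inverse)
      also have "- (real j * (dH + 1)) = (dH + 1) + - real k * (dH + 1)"
        by (simp add: Suc algebra_simps)
      also have "C * 2 powr \<dots> = C * 2 powr (dH + 1) * 2 powr (- real k * (dH + 1))"
        by (subst powr_add) simp
      finally have e: "exp (- c4 * gauge t x y) \<le> C * 2 powr (dH + 1) * 2 powr (- real k * (dH + 1))" .
      have "p t x y \<le> c3 * t powr (- dH / dW) * (C * 2 powr (dH + 1) * 2 powr (- real k * (dH + 1)))"
        using upper e c3_pos by (intro order_trans[OF upper] mult_left_mono) auto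
      also have "\<dots> = (c3 * (C * 2 powr (dH + 1))) * (t powr (- dH / dW) * 2 powr (- real k * (dH + 1)))"
        by simp
      also have "\<dots> \<le> A * (t powr (- dH / dW) * 2 powr (- real k * (dH + 1)))"
        using A by (intro mult_right_mono) auto
      finally show ?thesis by (simp add: mult.assoc)
    qed
    with k show ?thesis unfolding \<rho>_def by blast
  qed
  with A(1) show ?thesis by (rule that)
qed

text \<open>The k-th dyadic ball contributes at most A c2 2^(-k). The time cancels because t^(- dH /
  dW) is the inverse of the volume scale at radius t^(1 / dW), and this uniformity in t is essential
  for the later passage to infinite time.\<close>

lemma p_nn_integral_bounded:
  obtains C0 where "C0 > 0" "\<And>t x. t > 0 \<Longrightarrow> (\<integral>\<^sup>+y. ennreal (p t x y) \<partial>M) \<le> ennreal C0"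
proof -
  obtain A where A: "A > 0" and dy: "\<And>t x y. t > 0 \<Longrightarrow> \<exists>k. dist x y < 2 ^ k * t powr (1 / dW) \<and>
    p t x y \<le> A * t powr (- dH / dW) * 2 powr (- real k * (dH + 1))"
    by (rule p_le_dyadic) (rule that)
  have "(\<integral>\<^sup>+y. ennreal (p t x y) \<partial>M) \<le> ennreal (2 * (A * c2))" if t: "t > 0" for t x
  proof -
    define \<rho> where "\<rho> = t powr (1 / dW)"
    define a where "a k = A * t powr (- dH / dW) * 2 powr (- real k * (dH + 1))" for k :: nat
    have \<rho>: "\<rho> > 0" using t by (simp add: \<rho>_def)
    have a: "a k \<ge> 0" for k using A by (simp add: a_def)
    have "(\<integral>\<^sup>+y. ennreal (p t x y) \<partial>M) \<le> (\<integral>\<^sup>+y. (\<Sum>k. ennreal (a k) * indicator (ball x (2 ^ k * \<rho>)) y) \<partial>M)"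
    proof (rule nn_integral_mono)
      fix y
      obtain k where k: "dist x y < 2 ^ k * \<rho>" "p t x y \<le> a k"
        using dy[OF t, of x y] unfolding \<rho>_def a_def by blast
      have "ennreal (p t x y) \<le> ennreal (a k) * indicator (ball x (2 ^ k * \<rho>)) y"
        using k by (simp add: ennreal_leI)
      also have "\<dots> = (\<Sum>j\<in>{k}. ennreal (a j) * indicator (ball x (2 ^ j * \<rho>)) y)"
        by (simp del: sum_mult_indicator)
      also have "\<dots> \<le> (\<Sum>k. ennreal (a k) * indicator (ball x (2 ^ k * \<rho>)) y)"
        by (intro sum_le_suminf) auto
      finally show "ennreal (p t x y) \<le> (\<Sum>k. ennreal (a k) * indicator (ball x (2 ^ k * \<rho>)) y)" .
    qed
    also have "\<dots> = (\<Sum>k. \<integral>\<^sup>+y. ennreal (a k) * indicator (ball x (2 ^ k * \<rho>)) y \<partial>M)"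
      by (intro nn_integral_suminf borel_measurable_times_ennreal borel_measurable_const
          borel_measurable_indicator) simp
    also have "\<dots> = (\<Sum>k. ennreal (a k) * emeasure M (ball x (2 ^ k * \<rho>)))"
      by (simp add: nn_integral_cmult_indicator)
    also have "\<dots> \<le> (\<Sum>k. ennreal (A * c2 * (1/2) ^ k))"
    proof (intro suminf_le summableI)
      fix k
      have "ennreal (a k) * emeasure M (ball x (2 ^ k * \<rho>)) \<le> ennreal (a k) * ennreal (c2 * (2 ^ k * \<rho>) powr dH)"
        using \<rho> by (intro mult_left_mono ball_upper) auto
      also have "\<dots> = ennreal (a k * (c2 * (2 ^ k * \<rho>) powr dH))"
        using a c2_pos by (intro ennreal_mult[symmetric]) auto
      also have "a k * (c2 * (2 ^ k * \<rho>) powr dH) = A * c2 * (1/2) ^ k"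
      proof -
        have rearrange: "A * u * v * (c * (w * z)) = A * c * (v * w) * (u * z)" for A c u v w z :: real
          by simp
        have eq1: "(2 ^ k * \<rho>) powr dH = 2 powr (real k * dH) * t powr (dH / dW)"
          using \<rho> by (simp add: powr_mult \<rho>_def powr_powr powr_realpow[symmetric])
        have eq2: "2 powr (- real k * (dH + 1)) * 2 powr (real k * dH) = (1/2) ^ k"
          by (simp add: powr_add[symmetric] algebra_simps powr_minus powr_realpow power_one_over inverse_eq_divide)
        have eq3: "t powr (- dH / dW) * t powr (dH / dW) = 1"
          using t by (simp add: powr_add[symmetric])
        have "a k * (c2 * (2 ^ k * \<rho>) powr dH) = A * c2 * (2 powr (- real k * (dH + 1)) * 2 powr (real k * dH))
            * (t powr (- dH / dW) * t powr (dH / dW))"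
          unfolding a_def eq1 by (rule rearrange)
        then show ?thesis unfolding eq2 eq3 by simp
      qed
      finally show "ennreal (a k) * emeasure M (ball x (2 ^ k * \<rho>)) \<le> ennreal (A * c2 * (1/2) ^ k)" .
    qed
    also have "\<dots> = ennreal (2 * (A * c2))"
    proof (rule suminf_ennreal_eq)
      show "(\<lambda>k. A * c2 * (1/2) ^ k) sums (2 * (A * c2))"
        using sums_mult[OF geometric_sums[of "1/2 :: real"], of "A * c2"] by (simp add: mult.commute)
    qed (use A c2_pos in auto)
    finally show ?thesis .
  qed
  moreover have "2 * (A * c2) > 0" using A c2_pos by simp
  ultimately show ?thesis using that by blast
qed

lemma p_integrable: "t > 0 \<Longrightarrow> integrable M (p t x)"
proof -
  assume t: "t > 0"
  obtain C0 where "C0 > 0" and C0: "\<And>t x. t > 0 \<Longrightarrow> (\<integral>\<^sup>+y. ennreal (p t x y) \<partial>M) \<le> ennreal C0"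
    by (rule p_nn_integral_bounded) (rule that)
  have "(\<integral>\<^sup>+y. ennreal (p t x y) \<partial>M) < \<infinity>"
    unfolding infinity_ennreal_def using le_less_trans[OF C0[OF t, of x] ennreal_less_top] .
  then show ?thesis
    by (intro integrableI_nonneg p_measurable AE_I2 p_nonneg t)
qed

section \<open>Total mass of the kernel\<close>

definition mass :: "real \<Rightarrow> 'a \<Rightarrow> real" where
  "mass t x = (\<integral>y. p t x y \<partial>M)"

text \<open>The lower bound comes from the ball of radius t^(1/dW), where the gauge is at most
  1.\<close>

lemma mass_bounds:
  obtains c C where "c > 0" "C > 0" "\<And>t x. t > 0 \<Longrightarrow> c \<le> mass t x" "\<And>t x. t > 0 \<Longrightarrow> mass t x \<le> C"
proof -
  obtain C where C: "C > 0" "\<And>t x. t > 0 \<Longrightarrow> (\<integral>\<^sup>+y. ennreal (p t x y) \<partial>M) \<le> ennreal C"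
    by (rule p_nn_integral_bounded) (rule that)
  have mass_nn: "ennreal (mass t x) = (\<integral>\<^sup>+y. ennreal (p t x y) \<partial>M)" if "t > 0" for t x
    unfolding mass_def using p_integrable p_nonneg that by (intro nn_integral_eq_integral[symmetric]) auto
  have upper: "mass t x \<le> C" if "t > 0" for t x
    using C(2)[OF that, of x] C(1) unfolding mass_nn[OF that, symmetric] by (simp add: ennreal_le_iff)
  have lower: "c5 * exp (- c6) * c1 \<le> mass t x" if t: "t > 0" for t x
  proof -
    define \<rho> where "\<rho> = t powr (1 / dW)"
    have \<rho>: "\<rho> > 0" using t by (simp add: \<rho>_def)
    let ?v = "c5 * t powr (- dH / dW) * exp (- c6)"
    have "ennreal (c5 * exp (- c6) * c1) = ennreal (?v * (c1 * \<rho> powr dH))"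
      using t by (simp add: \<rho>_def powr_powr powr_minus mult_ac left_inverse)
    also have "\<dots> = ennreal ?v * ennreal (c1 * \<rho> powr dH)"
      using c5_pos c1_pos by (intro ennreal_mult) auto
    also have "\<dots> \<le> ennreal ?v * emeasure M (ball x \<rho>)"
      using \<rho> by (intro mult_left_mono ball_lower) auto
    also have "\<dots> = (\<integral>\<^sup>+y. ennreal ?v * indicator (ball x \<rho>) y \<partial>M)"
      by (simp add: nn_integral_cmult_indicator)
    also have "\<dots> \<le> (\<integral>\<^sup>+y. ennreal (p t x y) \<partial>M)"
    proof (rule nn_integral_mono)
      fix y
      show "ennreal ?v * indicator (ball x \<rho>) y \<le> ennreal (p t x y)"
      proof (cases "y \<in> ball x \<rho>")
        case True
        have "dist x y powr dW \<le> \<rho> powr dW" using True dW by (intro powr_mono2) auto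
        also have "\<dots> = t" using t dW by (simp add: \<rho>_def powr_powr)
        finally have "dist x y powr dW / t \<le> 1" using t by simp
        then have "gauge t x y \<le> 1 powr (1 / (dW - 1))"
          unfolding gauge_def using t dW by (intro powr_mono2) auto
        then have "exp (- c6) \<le> exp (- c6 * gauge t x y)" using c6_pos by simp
        then have "?v \<le> c5 * t powr (- dH / dW) * exp (- c6 * gauge t x y)"
          using c5_pos by (intro mult_left_mono) auto
        also have "\<dots> \<le> p t x y" using p_lower[OF t, of x y] by (simp add: sub_gaussian_gauge)
        finally show ?thesis using True by (simp add: ennreal_leI)
      qed simp
    qed
    finally have "ennreal (c5 * exp (- c6) * c1) \<le> ennreal (mass t x)" using mass_nn[OF t] by simp
    moreover have "mass t x \<ge> 0" unfolding mass_def using p_nonneg[OF t] by simp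
    ultimately show ?thesis by (simp add: ennreal_le_iff)
  qed
  show ?thesis
    by (rule that[of "c5 * exp (- c6) * c1" C]) (use lower upper C(1) c5_pos c1_pos in auto)
qed

section \<open>Action of the kernel on bounded functions\<close>

lemma kernel_integrable:
  assumes t: "t > 0" and [measurable]: "g \<in> borel_measurable M" and b: "\<And>x. \<bar>g x\<bar> \<le> b"
  shows "integrable M (\<lambda>y. p t x y * g y)"
proof (rule Bochner_Integration.integrable_bound)
  show "integrable M (\<lambda>y. b * p t x y)" using p_integrable[OF t] by simp
  show "(\<lambda>y. p t x y * g y) \<in> borel_measurable M" using p_measurable[OF t] by simp
  show "AE y in M. norm (p t x y * g y) \<le> norm (b * p t x y)"
  proof (rule AE_I2)
    fix y
    have "\<bar>g y\<bar> * \<bar>p t x y\<bar> \<le> \<bar>b\<bar> * \<bar>p t x y\<bar>"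
      using b[of y] by (intro mult_right_mono) auto
    then show "norm (p t x y * g y) \<le> norm (b * p t x y)" by (simp add: abs_mult mult.commute)
  qed
qed

lemma kernel_mono:
  assumes t: "t > 0" and g: "g \<in> borel_measurable M" "\<And>x. \<bar>g x\<bar> \<le> b"
    and h: "h \<in> borel_measurable M" "\<And>x. \<bar>h x\<bar> \<le> b'" and le: "\<And>y. g y \<le> h y"
  shows "K t g x \<le> K t h x"
  unfolding kernel_op_def
  by (intro integral_mono kernel_integrable[OF t g] kernel_integrable[OF t h] mult_left_mono le p_nonneg t)

lemma kernel_const: "K t (\<lambda>_. c) x = c * mass t x"
  by (simp add: kernel_op_def mass_def mult.commute)

lemma kernel_bounded:
  assumes t: "t > 0" and g: "g \<in> borel_measurable M" "\<And>x. \<bar>g x\<bar> \<le> b"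
  shows "\<bar>K t g x\<bar> \<le> b * mass t x"
proof -
  have gb: "- b \<le> g y \<and> g y \<le> b" for y using g(2)[of y] by linarith
  have "K t g x \<le> K t (\<lambda>_. b) x" by (rule kernel_mono[OF t g, of _ "\<bar>b\<bar>"]) (use gb in auto)
  moreover have "K t (\<lambda>_. - b) x \<le> K t g x"
    by (rule kernel_mono[OF t _ _ g, of _ "\<bar>b\<bar>"]) (use gb in auto)
  ultimately show ?thesis by (simp add: kernel_const abs_le_iff)
qed

lemma kernel_continuous:
  assumes t: "t > 0" and g: "g \<in> borel_measurable M" "\<And>x. \<bar>g x\<bar> \<le> b"
  shows "continuous_on UNIV (K t g)"
proof (rule Holder_continuous[OF \<kappa>_pos])
  show "\<bar>K t g x - K t g y\<bar> \<le> D * b / t powr (\<kappa> / dW) * dist x y powr \<kappa>" for x y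
    using weak_BE[OF t g] by (simp add: mult_ac)
qed

lemma kernel_measurable:
  assumes t: "t > 0" and g: "g \<in> borel_measurable M" "\<And>x. \<bar>g x\<bar> \<le> b"
  shows "K t g \<in> borel_measurable M"
  using borel_measurable_continuous_onI[OF kernel_continuous[OF assms]] measurable_cong_sets[OF sets_M refl] by blast

lemma continuous_AE_eq:
  fixes f g :: "'a \<Rightarrow> real"
  assumes cont: "continuous_on UNIV f" "continuous_on UNIV g" and ae: "AE x in M. f x = g x"
  shows "f = g"
proof (rule ccontr)
  assume "f \<noteq> g"
  then have "{x. f x \<noteq> g x} \<noteq> {}" by auto
  moreover have op: "open {x. f x \<noteq> g x}" by (rule open_Collect_neq[OF cont])
  ultimately have "0 < emeasure M {x. f x \<noteq> g x}" by (intro open_positive)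
  moreover have "emeasure M {x. f x \<noteq> g x} = 0"
    using ae AE_iff_measurable[of "{x. f x \<noteq> g x}" M "\<lambda>x. f x = g x"] op by auto
  ultimately show False by simp
qed

text \<open>Both sides are continuous by the weak Bakry-Emery estimate, and continuous functions
  that agree almost everywhere agree everywhere, as nonempty open sets have positive
  measure.\<close>

lemma kernel_semigroup:
  assumes s: "s > 0" and t: "t > 0" and u: "u \<in> L2_space M" "\<And>x. \<bar>u x\<bar> \<le> b"
  shows "K (s + t) u = K s (K t u)"
proof (rule continuous_AE_eq)
  obtain c C where "c > 0" "C > 0" "\<And>t x. t > 0 \<Longrightarrow> c \<le> mass t x" and C: "\<And>t x. t > 0 \<Longrightarrow> mass t x \<le> C"
    by (rule mass_bounds) (rule that)
  note um = L2_spaceD(1)[OF u(1)]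
  have b: "b \<ge> 0" using u(2)[of undefined] by simp
  have bd: "\<bar>K t u x\<bar> \<le> b * C" for x
    using kernel_bounded[OF t um u(2), of x] mult_left_mono[OF C[OF t] b, of x] by linarith
  show "continuous_on UNIV (K (s + t) u)" using s t by (intro kernel_continuous[OF _ um u(2)]) auto
  show "continuous_on UNIV (K s (K t u))"
    by (rule kernel_continuous[OF s kernel_measurable[OF t um u(2)] bd])
  show "AE x in M. K (s + t) u x = K s (K t u) x" by (rule kernel_semigroup_AE[OF s t u])
qed


section \<open>Stochastic completeness\<close>

lemma kernel_tendsto:
  assumes t: "t > 0" and g: "\<And>n. g n \<in> borel_measurable M" "\<And>n x. \<bar>g n x\<bar> \<le> b"
    and h: "h \<in> borel_measurable M" and lim: "\<And>x. (\<lambda>n. g n x) \<longlonglongrightarrow> h x"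
  shows "(\<lambda>n. K t (g n) x) \<longlonglongrightarrow> K t h x"
  unfolding kernel_op_def
proof (rule integral_dominated_convergence[where w = "\<lambda>y. b * p t x y"])
  show "integrable M (\<lambda>y. b * p t x y)" using p_integrable[OF t] by simp
  show "AE y in M. (\<lambda>n. p t x y * g n y) \<longlonglongrightarrow> p t x y * h y"
    using lim by (intro AE_I2 tendsto_intros) auto
  show "AE y in M. norm (p t x y * g n y) \<le> b * p t x y" for n
  proof (rule AE_I2)
    fix y
    show "norm (p t x y * g n y) \<le> b * p t x y"
      using mult_left_mono[OF g(2)[of n y] p_nonneg[OF t, of x y]] p_nonneg[OF t, of x y]
      by (simp add: abs_mult mult.commute)
  qed
qed (use p_measurable[OF t] g h in auto)

text \<open>The constant 1 is not in L2, the space having infinite measure. The semigroup law is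
  used for indicators of growing balls and passes to the limit by dominated convergence.\<close>

lemma mass_semigroup:
  assumes s: "s > 0" and t: "t > 0"
  shows "mass (s + t) x = K s (mass t) x"
proof -
  let ?B = "\<lambda>n::nat. ball (undefined :: 'a) (real n)"
  let ?g = "\<lambda>n. indicator (?B n) :: 'a \<Rightarrow> real"
  obtain c C where "c > 0" "C > 0" and c: "\<And>t x. t > 0 \<Longrightarrow> c \<le> mass t x" and C: "\<And>t x. t > 0 \<Longrightarrow> mass t x \<le> C"
    by (rule mass_bounds) (rule that)
  have g: "?g n \<in> borel_measurable M" "\<bar>?g n x\<bar> \<le> 1" for n x
    by (auto simp: indicator_def intro!: borel_measurable_indicator)
  have lim: "(\<lambda>n. ?g n x) \<longlonglongrightarrow> 1" for x
  proof (rule tendsto_eventually)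
    obtain m :: nat where m: "dist undefined x < real m" using reals_Archimedean2 by blast
    show "\<forall>\<^sub>F n in sequentially. ?g n x = 1"
      using eventually_ge_at_top[of m] by eventually_elim (use m in auto)
  qed
  have mass1: "K t (\<lambda>_. 1) x = mass t x" for t x by (simp add: kernel_const)
  have "(\<lambda>n. K (s + t) (?g n) x) \<longlonglongrightarrow> K (s + t) (\<lambda>_. 1) x"
    using s t by (intro kernel_tendsto[OF _ g]) (auto intro: lim)
  moreover have "(\<lambda>n. K s (K t (?g n)) x) \<longlonglongrightarrow> K s (mass t) x"
  proof (rule kernel_tendsto[OF s, where b = C])
    show "K t (?g n) \<in> borel_measurable M" for n by (rule kernel_measurable[OF t g])
    show "\<bar>K t (?g n) x\<bar> \<le> C" for n x
      using kernel_bounded[OF t g, of n x] C[OF t, of x] by simp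
    show "mass t \<in> borel_measurable M"
      using kernel_measurable[OF t, of "\<lambda>_. 1" 1] by (simp add: kernel_const[abs_def])
    show "(\<lambda>n. K t (?g n) x) \<longlonglongrightarrow> mass t x" for x
      using kernel_tendsto[where h = "\<lambda>_. 1", OF t g _ lim] by (simp add: mass1)
  qed
  moreover have "K (s + t) (?g n) = K s (K t (?g n))" for n
    using ball_finite by (intro kernel_semigroup[OF s t L2_indicator g(2)]) auto
  ultimately show ?thesis using LIMSEQ_unique by (simp add: mass1)
qed

text \<open>As \<open>t\<close> tends to infinity the weak Bakry-Emery estimate flattens \<open>mass t\<close>, so that
  \<open>mass s\<close> is a constant \<open>m s\<close>; this is multiplicative in \<open>s\<close> and bounded from above and from
  below, hence equal to one.\<close>

lemma mass_constant:
  assumes s: "s > 0"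
  shows "mass s x = mass s y"
proof -
  obtain c C where c0: "c > 0" and "C > 0" and c: "\<And>t x. t > 0 \<Longrightarrow> c \<le> mass t x"
    and C: "\<And>t x. t > 0 \<Longrightarrow> mass t x \<le> C"
    by (rule mass_bounds) (rule that)
  have osc: "\<bar>mass t x - mass t y\<bar> \<le> D * (dist x y powr \<kappa> / t powr (\<kappa> / dW))" if "t > 0" for t x y
    using weak_BE[OF that, of "\<lambda>_. 1" 1 x y] by (simp add: kernel_const)
  have decay: "(\<lambda>n. mass (s + real (Suc (r n))) x - mass (s + real (Suc (r n))) y) \<longlonglongrightarrow> 0"
    if "strict_mono r" "s \<ge> 0" for r :: "nat \<Rightarrow> nat" and s x y
  proof (rule Lim_null_comparison)
    show "\<forall>\<^sub>F n in sequentially. norm (mass (s + real (Suc (r n))) x - mass (s + real (Suc (r n))) y)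
        \<le> D * (dist x y powr \<kappa> / (s + real (Suc (r n))) powr (\<kappa> / dW))"
      using that osc by (intro always_eventually allI) (auto simp: add_nonneg_pos)
    have "filterlim (\<lambda>n. real (Suc (r n))) at_top sequentially"
      using filterlim_compose[OF filterlim_real_sequentially
          filterlim_compose[OF filterlim_Suc filterlim_subseq[OF that(1)]]] by simp
    then have "filterlim (\<lambda>n. s + real (Suc (r n))) at_top sequentially"
      by (intro filterlim_tendsto_add_at_top[OF tendsto_const])
    then have "((\<lambda>n. (s + real (Suc (r n))) powr (- (\<kappa> / dW))) \<longlonglongrightarrow> 0)"
      using \<kappa>_pos dW by (intro tendsto_neg_powr) auto
    from tendsto_mult_right_zero[OF this, of "D * dist x y powr \<kappa>"]
    show "(\<lambda>n. D * (dist x y powr \<kappa> / (s + real (Suc (r n))) powr (\<kappa> / dW))) \<longlonglongrightarrow> 0"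
      by (simp add: powr_minus divide_inverse mult.assoc)
  qed
  \<comment> \<open>Convergence of the mass for large times is not yet known, so compactness
    supplies a subsequence. By flattening, the limit a is then the same at every point.\<close>
  have "mass (real (Suc n)) x \<in> {c..C}" for n using c C by simp
  then obtain a r where "a \<in> {c..C}" and r: "strict_mono r"
    and "((\<lambda>n. mass (real (Suc n)) x) \<circ> r) \<longlonglongrightarrow> a"
    using compact_Icc[of c C] unfolding compact_def by meson
  then have a: "a \<ge> c" and lima: "(\<lambda>n. mass (real (Suc (r n))) x) \<longlonglongrightarrow> a" by (auto simp: o_def)
  have lim: "(\<lambda>n. mass (real (Suc (r n))) z) \<longlonglongrightarrow> a" for z
    using tendsto_diff[OF lima decay[OF r, of 0 x z]] by simp
  have "(\<lambda>n. mass (s + real (Suc (r n))) z) \<longlonglongrightarrow> a * mass s z" for z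
  proof -
    have "(\<lambda>n. K s (mass (real (Suc (r n)))) z) \<longlonglongrightarrow> K s (\<lambda>_. a) z"
    proof (rule kernel_tendsto[OF s, where b = C])
      fix n x
      show "mass (real (Suc (r n))) \<in> borel_measurable M"
        using kernel_measurable[of "real (Suc (r n))" "\<lambda>_. 1" 1] by (simp add: kernel_const[abs_def])
      show "\<bar>mass (real (Suc (r n))) x\<bar> \<le> C"
        using c[of "real (Suc (r n))" x] C[of "real (Suc (r n))" x] c0 by simp
    qed (use lim in auto)
    moreover have "K s (mass (real (Suc (r n)))) z = mass (s + real (Suc (r n))) z" for n
      by (rule mass_semigroup[OF s, symmetric]) simp
    ultimately show ?thesis by (simp add: kernel_const)
  qed
  \<comment> \<open>The shifted masses tend to a times \<open>mass s\<close> at each of the two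
    points, while their difference tends to 0. The lower mass bound allows division by a.\<close>
  from LIMSEQ_unique[OF tendsto_diff[OF this[of x] this[of y]] decay[OF r less_imp_le[OF s]]]
  have "a * mass s x - a * mass s y = 0" .
  then show ?thesis using a c0 by simp
qed

theorem mass_eq_1:
  assumes t: "t > 0"
  shows "mass t x = 1"
proof -
  obtain c C where c0: "c > 0" and C0: "C > 0" and c: "\<And>t x. t > 0 \<Longrightarrow> c \<le> mass t x"
    and C: "\<And>t x. t > 0 \<Longrightarrow> mass t x \<le> C"
    by (rule mass_bounds) (rule that)
  have mult: "mass (s + t) x = mass t x * mass s x" if "s > 0" "t > 0" for s t
  proof -
    have "mass t = (\<lambda>_. mass t x)" using mass_constant[OF that(2)] by blast
    then have "K s (mass t) x = K s (\<lambda>_. mass t x) x" by simp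
    then show ?thesis using mass_semigroup[OF that, of x] by (simp add: kernel_const)
  qed
  have pow: "mass (real (Suc n) * t) x = mass t x ^ Suc n" for n
  proof (induction n)
    case (Suc n)
    have "real (Suc (Suc n)) * t = t + real (Suc n) * t" by (simp add: algebra_simps)
    then have "mass (real (Suc (Suc n)) * t) x = mass (real (Suc n) * t) x * mass t x"
      using mult[OF t, of "real (Suc n) * t"] t by simp
    then show ?case unfolding Suc by simp
  qed simp
  have bounds: "c \<le> mass t x ^ Suc n" "mass t x ^ Suc n \<le> C" for n
    using c[of "real (Suc n) * t" x] C[of "real (Suc n) * t" x] t unfolding pow[symmetric] by auto
  have pos: "0 < mass t x" using c[OF t, of x] c0 by simp
  have "\<not> mass t x > 1"
  proof
    assume m: "mass t x > 1"
    obtain n where "C < mass t x ^ n" using real_arch_pow[OF m] by blast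
    also have "\<dots> \<le> mass t x ^ Suc n" using m by (intro power_increasing) auto
    finally show False using bounds(2)[of n] by simp
  qed
  moreover have "\<not> mass t x < 1"
  proof
    assume m: "mass t x < 1"
    obtain n where "mass t x ^ n < c" using real_arch_pow_inv[OF c0 m] by blast
    moreover have "mass t x ^ Suc n \<le> mass t x ^ n" using m pos by (intro power_decreasing) auto
    ultimately show False using bounds(1)[of n] by simp
  qed
  ultimately show ?thesis by simp
qed

end

context sub_gaussian_kernel
begin

section \<open>The heat loss of a set\<close>

text \<open>Multiplying the time by N divides the gauge by N^\<beta>, which slows the exponential
  decay of the lower bound. Half of the decay rate \<open>c4\<close> pays for this, and the other
  half remains as an explicit factor: it will beat powers of the distance and make tails
  small.\<close>

lemma time_comparison:
  obtains N :: nat and A where "N \<ge> 1" "A > 0"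
    "\<And>t x y. t > 0 \<Longrightarrow> p t x y \<le> A * exp (- (c4 / 2) * gauge t x y) * p (real N * t) x y"
proof -
  define \<beta> where "\<beta> = 1 / (dW - 1)"
  have \<beta>: "\<beta> > 0" using dW by (simp add: \<beta>_def)
  \<comment> \<open>Large enough for \<open>c6 / real N powr \<beta>\<close> to be at most
    \<open>c4 / 2\<close>; the added 1 ensures N \<ge> 1.\<close>
  define N where "N = nat \<lceil>(2 * c6 / c4) powr (1 / \<beta>)\<rceil> + 1"
  have N1: "N \<ge> 1" by (simp add: N_def)
  have "(2 * c6 / c4) powr (1 / \<beta>) \<le> real N" unfolding N_def by linarith
  then have "((2 * c6 / c4) powr (1 / \<beta>)) powr \<beta> \<le> real N powr \<beta>" using \<beta> by (intro powr_mono2) auto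
  then have N\<beta>: "2 * c6 / c4 \<le> real N powr \<beta>" using \<beta> c4_pos c6_pos by (simp add: powr_powr)
  have Npos: "real N powr \<beta> > 0" using N1 by simp
  have small: "c6 / real N powr \<beta> \<le> c4 / 2"
    using N\<beta> Npos c4_pos by (simp add: field_simps)
  define A where "A = c3 / c5 * real N powr (dH / dW)"
  have A: "A > 0" using c3_pos c5_pos N1 by (simp add: A_def)
  have "p t x y \<le> A * exp (- (c4 / 2) * gauge t x y) * p (real N * t) x y" if t: "t > 0" for t x y
  proof -
    let ?z = "gauge t x y"
    have Nt: "real N * t > 0" using t N1 by simp
    have gN: "gauge (real N * t) x y = ?z / real N powr \<beta>"
      unfolding gauge_def \<beta>_def[symmetric] using t N1
      by (subst powr_divide[symmetric]) (auto simp: mult.commute)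
    have "c6 * gauge (real N * t) x y \<le> c4 / 2 * ?z"
      unfolding gN using mult_right_mono[OF small gauge_nonneg[of t x y]] by simp
    then have e: "exp (- (c4 / 2) * ?z) \<le> exp (- c6 * gauge (real N * t) x y)" by simp
    have tN: "(real N * t) powr (- dH / dW) = real N powr (- dH / dW) * t powr (- dH / dW)"
      using t N1 by (simp add: powr_mult)
    have NN: "real N powr (dH / dW) * real N powr (- dH / dW) = 1"
      using N1 by (simp add: powr_add[symmetric])
    have "c3 * t powr (- dH / dW) * exp (- c4 * ?z)
        = A * exp (- (c4 / 2) * ?z) * (c5 * (real N * t) powr (- dH / dW) * exp (- (c4 / 2) * ?z))"
    proof -
      have rearrange: "c3 / c5 * u * e * (c5 * (v * w) * e) = c3 * w * (e * e) * (u * v)" for u v w e :: real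
        using c5_pos by simp
      have ee: "exp (- (c4 / 2) * ?z) * exp (- (c4 / 2) * ?z) = exp (- c4 * ?z)"
        by (simp add: exp_add[symmetric])
      show ?thesis unfolding tN A_def rearrange NN ee by simp
    qed
    also have "\<dots> \<le> A * exp (- (c4 / 2) * ?z) * (c5 * (real N * t) powr (- dH / dW) * exp (- c6 * gauge (real N * t) x y))"
      using A c5_pos e by (intro mult_left_mono) auto
    also have "\<dots> \<le> A * exp (- (c4 / 2) * ?z) * p (real N * t) x y"
      using A p_lower[OF Nt, of x y] by (intro mult_left_mono) (auto simp: sub_gaussian_gauge)
    finally show ?thesis using p_upper[OF t, of x y] by (simp add: sub_gaussian_gauge)
  qed
  with N1 A show ?thesis by (rule that)
qed

lemma indicator_measurable: "A \<in> sets borel \<Longrightarrow> indicat_real A \<in> borel_measurable M"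
  by (intro borel_measurable_indicator) simp

lemma indicator_abs_le: "\<bar>indicat_real A x\<bar> \<le> 1"
  by (simp add: indicator_def)

lemma K_indicator_nonneg: "t > 0 \<Longrightarrow> 0 \<le> K t (indicat_real A) x"
  unfolding kernel_op_def by (intro integral_nonneg_AE AE_I2 mult_nonneg_nonneg p_nonneg) auto

lemma K_indicator_Compl:
  assumes t: "t > 0" and A: "A \<in> sets borel"
  shows "K t (indicat_real (- A)) x = 1 - K t (indicat_real A) x"
proof -
  have "K t (indicat_real (- A)) x = (\<integral>y. p t x y - p t x y * indicat_real A y \<partial>M)"
    unfolding kernel_op_def by (intro Bochner_Integration.integral_cong) (auto simp: indicator_def)
  also have "\<dots> = mass t x - K t (indicat_real A) x"
    unfolding kernel_op_def mass_def
    by (intro Bochner_Integration.integral_diff p_integrable[OF t]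
        kernel_integrable[OF t indicator_measurable[OF A] indicator_abs_le])
  finally show ?thesis using mass_eq_1[OF t] by simp
qed

lemma K_indicator_le_1:
  assumes "t > 0" "A \<in> sets borel"
  shows "K t (indicat_real A) x \<le> 1"
  using K_indicator_Compl[OF assms, of x] K_indicator_nonneg[OF assms(1), of "- A" x] by simp

lemma K_indicator_abs_le: "t > 0 \<Longrightarrow> A \<in> sets borel \<Longrightarrow> \<bar>K t (indicat_real A) x\<bar> \<le> 1"
  using K_indicator_le_1[of t A x] K_indicator_nonneg[of t A x] by simp

lemma K_indicator_measurable:
  "t > 0 \<Longrightarrow> A \<in> sets borel \<Longrightarrow> K t (indicat_real A) \<in> borel_measurable M"
  by (rule kernel_measurable[OF _ indicator_measurable indicator_abs_le])

text \<open>In this form nonnegativity is visible at once; \<open>mass_eq_1\<close> turns it into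
  the measure of E minus the heat that remains in E.\<close>

definition heat_loss :: "'a set \<Rightarrow> real \<Rightarrow> real" where
  "heat_loss E t = (\<integral>x. indicat_real E x * K t (indicat_real (- E)) x \<partial>M)"

context
  fixes E :: "'a set"
  assumes E: "E \<in> sets borel" and finE: "emeasure M E < \<infinity>"
begin

lemma E_sets: "E \<in> sets M"
  using E by simp

lemma Compl_E: "- E \<in> sets borel"
  using E by auto

lemma L2_E: "indicat_real E \<in> L2_space M"
  using E_sets finE by (rule L2_indicator)

lemma integrable_E_times:
  assumes g: "g \<in> borel_measurable M" and b: "\<And>x. \<bar>g x\<bar> \<le> b"
  shows "integrable M (\<lambda>x. indicat_real E x * g x)"
proof (rule Bochner_Integration.integrable_bound)
  show "integrable M (\<lambda>x. b * indicat_real E x)"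
    using E_sets finE by (intro integrable_mult_right) (simp add: integrable_indicator_iff)
  show "(\<lambda>x. indicat_real E x * g x) \<in> borel_measurable M"
    by (intro borel_measurable_times indicator_measurable E g)
  have "\<bar>g x\<bar> \<le> \<bar>b\<bar>" for x using b[of x] by linarith
  then show "AE x in M. norm (indicat_real E x * g x) \<le> norm (b * indicat_real E x)"
    by (intro AE_I2) (auto simp: indicator_def)
qed

lemma heat_loss_nonneg: "t > 0 \<Longrightarrow> 0 \<le> heat_loss E t"
  unfolding heat_loss_def
  by (intro integral_nonneg_AE AE_I2 mult_nonneg_nonneg K_indicator_nonneg) auto

lemma heat_loss_eq:
  assumes t: "t > 0"
  shows "heat_loss E t = measure M E - (\<integral>x. indicat_real E x * K t (indicat_real E) x \<partial>M)"
proof -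
  have "heat_loss E t = (\<integral>x. indicat_real E x * 1 - indicat_real E x * K t (indicat_real E) x \<partial>M)"
    unfolding heat_loss_def K_indicator_Compl[OF t E] by (simp add: algebra_simps)
  also have "\<dots> = (\<integral>x. indicat_real E x * 1 \<partial>M) - (\<integral>x. indicat_real E x * K t (indicat_real E) x \<partial>M)"
    by (intro Bochner_Integration.integral_diff integrable_E_times[of _ 1]
        K_indicator_measurable K_indicator_abs_le t E) auto
  finally show ?thesis using E_sets by simp
qed

lemma heat_content_add:
  assumes s: "s > 0" and t: "t > 0"
  shows "(\<integral>x. indicat_real E x * K (s + t) (indicat_real E) x \<partial>M)
    = (\<integral>x. K s (indicat_real E) x * K t (indicat_real E) x \<partial>M)"
  unfolding kernel_semigroup[OF s t L2_E indicator_abs_le]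
  by (rule kernel_sym[OF s L2_E indicator_abs_le
        kernel_L2[OF t L2_E indicator_abs_le] K_indicator_abs_le[OF t E], symmetric])

text \<open>With \<open>u = P\<^sub>s 1\<^sub>E\<close> and \<open>v = P\<^sub>t 1\<^sub>E\<close>, both in \<open>[0, 1]\<close>, the claim reduces to
  \<open>u v \<ge> u + v - 1\<close>.\<close>

lemma heat_loss_subadditive:
  assumes s: "s > 0" and t: "t > 0"
  shows "heat_loss E (s + t) \<le> heat_loss E s + heat_loss E t"
proof -
  let ?u = "K s (indicat_real E)" and ?v = "K t (indicat_real E)"
  have st: "s + t > 0" using s t by simp
  have iu: "integrable M (\<lambda>x. indicat_real E x * ?u x)" and iv: "integrable M (\<lambda>x. indicat_real E x * ?v x)"
    by (intro integrable_E_times[of _ 1] K_indicator_measurable K_indicator_abs_le s t E)+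
  have i1: "integrable M (indicat_real E)"
    using integrable_E_times[of "\<lambda>_. 1" 1] by simp
  have "(\<integral>x. indicat_real E x * ?u x \<partial>M) + (\<integral>x. indicat_real E x * ?v x \<partial>M) - measure M E
      = (\<integral>x. indicat_real E x * ?u x + indicat_real E x * ?v x - indicat_real E x \<partial>M)"
    using iu iv i1 E_sets by simp
  also have "\<dots> \<le> (\<integral>x. ?u x * ?v x \<partial>M)"
  proof (rule integral_mono)
    show "integrable M (\<lambda>x. indicat_real E x * ?u x + indicat_real E x * ?v x - indicat_real E x)"
      using iu iv i1 by simp
    show "integrable M (\<lambda>x. ?u x * ?v x)"
      by (intro L2_integrable_mult kernel_L2[OF s L2_E indicator_abs_le] kernel_L2[OF t L2_E indicator_abs_le])
    fix x
    have "0 \<le> (1 - ?u x) * (1 - ?v x)" "0 \<le> ?u x * ?v x"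
      using K_indicator_le_1[OF s E] K_indicator_le_1[OF t E]
        K_indicator_nonneg[OF s] K_indicator_nonneg[OF t] by auto
    then show "indicat_real E x * ?u x + indicat_real E x * ?v x - indicat_real E x \<le> ?u x * ?v x"
      by (auto simp: indicator_def algebra_simps)
  qed
  finally show ?thesis
    unfolding heat_loss_eq[OF s] heat_loss_eq[OF t] heat_loss_eq[OF st] heat_content_add[OF s t] by linarith
qed

lemma heat_loss_multiple:
  assumes t: "t > 0"
  shows "heat_loss E (real (Suc n) * t) \<le> real (Suc n) * heat_loss E t"
proof (induction n)
  case (Suc n)
  have "real (Suc (Suc n)) * t = t + real (Suc n) * t" by (simp add: algebra_simps)
  then have "heat_loss E (real (Suc (Suc n)) * t) \<le> heat_loss E t + heat_loss E (real (Suc n) * t)"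
    using heat_loss_subadditive[OF t, of "real (Suc n) * t"] t by simp
  also have "\<dots> \<le> real (Suc (Suc n)) * heat_loss E t" using Suc by (simp add: algebra_simps)
  finally show ?case .
qed simp

text \<open>The increment is the form \<open>\<langle>1\<^sub>E, w - P\<^sub>\<tau> w\<rangle>\<close> with \<open>w = P\<^sub>s 1\<^sub>E\<close>. By symmetry only the
  interaction of \<open>E\<close> with its complement contributes, and there the weak Bakry-Emery
  estimate bounds \<open>w x - w y\<close>.\<close>

lemma heat_loss_step:
  assumes s: "s > 0" and \<tau>: "\<tau> > 0" and \<tau>': "\<tau>' > 0"
    and comparison: "\<And>x y. p \<tau> x y * dist x y powr \<kappa> \<le> C * \<tau> powr (\<kappa> / dW) * p \<tau>' x y"
  shows "heat_loss E (s + \<tau>) \<le> heat_loss E s + D * C * (\<tau> / s) powr (\<kappa> / dW) * heat_loss E \<tau>'"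
proof -
  define w where "w = K s (indicat_real E)"
  define B where "B = D * C * (\<tau> / s) powr (\<kappa> / dW)"
  have wm: "w \<in> borel_measurable M" and wb: "\<bar>w x\<bar> \<le> 1" for x
    unfolding w_def by (intro K_indicator_measurable K_indicator_abs_le s E)+
  let ?f = "indicat_real E" and ?g = "indicat_real (- E)"
  let ?fw = "\<lambda>x. ?f x * w x"
  have fwm: "?fw \<in> borel_measurable M" by (intro borel_measurable_times indicator_measurable E wm)
  have fwb: "\<bar>?fw x\<bar> \<le> 1" for x using wb[of x] by (simp add: indicator_def)
  have fwL2: "?fw \<in> L2_space M"
    by (rule L2_bounded_support[OF fwm E_sets finE fwb]) simp
  have Kw: "\<bar>K \<tau> w x\<bar> \<le> 1" for x
    using kernel_bounded[OF \<tau> wm wb, of x] mass_eq_1[OF \<tau>] by simp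
  have Kfw: "\<bar>K \<tau> ?fw x\<bar> \<le> 1" for x
    using kernel_bounded[OF \<tau> fwm fwb, of x] mass_eq_1[OF \<tau>] by simp
  \<comment> \<open>As the mass is 1, the left hand side is the average of w x - w y against the
    kernel. The y in E give the bracket on the right, which is antisymmetric once x is also
    integrated over E; the remaining y are estimated.\<close>
  have point: "w x - K \<tau> w x \<le> (w x * K \<tau> ?f x - K \<tau> ?fw x) + B * K \<tau>' ?g x" for x
  proof -
    have i: "integrable M (p \<tau> x)" "integrable M (\<lambda>y. p \<tau> x y * ?f y)"
        "integrable M (\<lambda>y. p \<tau> x y * w y)" "integrable M (\<lambda>y. p \<tau> x y * ?fw y)"
      by (intro p_integrable[OF \<tau>] kernel_integrable[OF \<tau> indicator_measurable[OF E] indicator_abs_le]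
          kernel_integrable[OF \<tau> wm wb] kernel_integrable[OF \<tau> fwm fwb])+
    \<comment> \<open>After simplification this is \<open>p \<tau> x y * (w x - w y)\<close> for y
      outside E, and 0 for y in E.\<close>
    let ?h = "\<lambda>y. (w x * p \<tau> x y - w x * (p \<tau> x y * ?f y)) - (p \<tau> x y * w y - p \<tau> x y * ?fw y)"
    have ih: "integrable M ?h"
      by (intro Bochner_Integration.integrable_diff integrable_mult_right i)
    have hint: "(\<integral>y. ?h y \<partial>M) = (w x * mass \<tau> x - w x * K \<tau> ?f x) - (K \<tau> w x - K \<tau> ?fw x)"
      using i by (simp add: mass_def kernel_op_def)
    have "(\<integral>y. ?h y \<partial>M) \<le> (\<integral>y. B * (p \<tau>' x y * ?g y) \<partial>M)"
    proof (rule integral_mono[OF ih])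
      show "integrable M (\<lambda>y. B * (p \<tau>' x y * ?g y))"
        by (intro integrable_mult_right kernel_integrable[OF \<tau>' indicator_measurable[OF Compl_E] indicator_abs_le])
      fix y
      show "?h y \<le> B * (p \<tau>' x y * ?g y)"
      proof (cases "y \<in> E")
        case False
        have "w x - w y \<le> D * (dist x y powr \<kappa> / s powr (\<kappa> / dW)) * 1"
          using weak_BE[OF s indicator_measurable[OF E] indicator_abs_le, of x y] unfolding w_def by linarith
        then have "p \<tau> x y * (w x - w y) \<le> p \<tau> x y * (D * (dist x y powr \<kappa> / s powr (\<kappa> / dW)) * 1)"
          by (intro mult_left_mono p_nonneg \<tau>)
        also have "\<dots> = D / s powr (\<kappa> / dW) * (p \<tau> x y * dist x y powr \<kappa>)" by simp
        also have "\<dots> \<le> D / s powr (\<kappa> / dW) * (C * \<tau> powr (\<kappa> / dW) * p \<tau>' x y)"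
          using D_pos by (intro mult_left_mono comparison) auto
        also have "\<dots> = B * p \<tau>' x y"
          using s \<tau> by (simp add: B_def powr_divide)
        finally show ?thesis using False by (simp add: algebra_simps)
      qed (simp add: algebra_simps)
    qed
    also have "(\<integral>y. B * (p \<tau>' x y * ?g y) \<partial>M) = B * K \<tau>' ?g x" by (simp add: kernel_op_def)
    finally show ?thesis unfolding hint mass_eq_1[OF \<tau>] by simp
  qed
  have w_mul: "\<bar>w x * K \<tau> ?f x\<bar> \<le> 1" for x
    using mult_mono[OF wb[of x] K_indicator_abs_le[OF \<tau> E, of x]] by (simp add: abs_mult)
  have ints: "integrable M (\<lambda>x. ?f x * w x)" "integrable M (\<lambda>x. ?f x * K \<tau> w x)"
    "integrable M (\<lambda>x. ?f x * (w x * K \<tau> ?f x))" "integrable M (\<lambda>x. ?f x * K \<tau> ?fw x)"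
    "integrable M (\<lambda>x. ?f x * K \<tau>' ?g x)"
    by (intro integrable_E_times[of _ 1] wm wb kernel_measurable[OF \<tau> wm wb] Kw borel_measurable_times
        K_indicator_measurable K_indicator_abs_le w_mul Kfw kernel_measurable[OF \<tau> fwm fwb] \<tau> \<tau>' E Compl_E)+
  have "(\<integral>x. ?f x * w x \<partial>M) - (\<integral>x. ?f x * K \<tau> w x \<partial>M) = (\<integral>x. ?f x * w x - ?f x * K \<tau> w x \<partial>M)"
    using ints by simp
  also have "\<dots> \<le> (\<integral>x. (?f x * (w x * K \<tau> ?f x) - ?f x * K \<tau> ?fw x) + B * (?f x * K \<tau>' ?g x) \<partial>M)"
  proof (rule integral_mono)
    fix x
    show "?f x * w x - ?f x * K \<tau> w x \<le> (?f x * (w x * K \<tau> ?f x) - ?f x * K \<tau> ?fw x) + B * (?f x * K \<tau>' ?g x)"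
      using point[of x] by (simp add: indicator_def)
  qed (intro Bochner_Integration.integrable_diff Bochner_Integration.integrable_add integrable_mult_right ints)+
  also have "\<dots> = (\<integral>x. ?fw x * K \<tau> ?f x \<partial>M) - (\<integral>x. ?f x * K \<tau> ?fw x \<partial>M) + B * heat_loss E \<tau>'"
    using ints by (simp add: heat_loss_def mult.assoc)
  also have "(\<integral>x. ?fw x * K \<tau> ?f x \<partial>M) = (\<integral>x. ?f x * K \<tau> ?fw x \<partial>M)"
    using kernel_sym[OF \<tau> L2_E indicator_abs_le fwL2 fwb] by (simp add: mult.commute)
  finally have "(\<integral>x. ?f x * w x \<partial>M) - (\<integral>x. ?f x * K \<tau> w x \<partial>M) \<le> B * heat_loss E \<tau>'" by simp
  moreover have "K \<tau> w = K (\<tau> + s) ?f"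
    unfolding w_def by (rule kernel_semigroup[OF \<tau> s L2_E indicator_abs_le, symmetric])
  ultimately show ?thesis
    using heat_loss_eq[OF s] heat_loss_eq[of "s + \<tau>"] s \<tau> by (simp add: w_def B_def add.commute)
qed

text \<open>The unnormalised energy with x restricted to E. This half is all that is needed to bound
  the heat loss by the energy.\<close>

definition outward_jump :: "real \<Rightarrow> real" where
  "outward_jump r = (\<integral>x. indicat_real E x * measure M (ball x r \<inter> - E) \<partial>M)"

lemma ball_measure_measurable: "A \<in> sets borel \<Longrightarrow> (\<lambda>x. measure M (ball x r \<inter> A)) \<in> borel_measurable M"
  unfolding measure_def using measurable_ball_measure by simp

lemma ball_measure_le: "r \<ge> 0 \<Longrightarrow> \<bar>measure M (ball x r \<inter> A)\<bar> \<le> c2 * r powr dH"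
proof -
  assume r: "r \<ge> 0"
  have "measure M (ball x r \<inter> A) \<le> measure M (ball x r)"
    unfolding measure_def using ball_finite[of x r] by (intro enn2real_mono emeasure_mono) auto
  also have "\<dots> \<le> c2 * r powr dH"
    unfolding measure_def using ball_upper[OF r, of x] c2_pos by (intro enn2real_leI) auto
  finally show ?thesis by simp
qed

lemma ball_measure_emeasure: "ennreal (measure M (ball x r \<inter> A)) = emeasure M (ball x r \<inter> A)"
proof -
  have "emeasure M (ball x r \<inter> A) \<le> emeasure M (ball x r)" by (intro emeasure_mono) auto
  then show ?thesis
    using ball_finite[of x r] by (intro emeasure_eq_ennreal_measure[symmetric]) (auto simp: less_top)
qed

text \<open>The part of the kernel at distance at least \<open>r\<close> is dominated by a small multiple of the
  kernel at time \<open>N \<tau>\<close>, whose contribution \<open>heat_loss E (N \<tau>) \<le> N heat_loss E \<tau>\<close> is absorbed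
  into the left hand side.\<close>

lemma heat_loss_le_outward_jump:
  assumes \<tau>: "\<tau> > 0" and r: "r > 0"
    and far: "\<And>x y. r \<le> dist x y \<Longrightarrow> p \<tau> x y \<le> 1 / (2 * real (Suc n)) * p (real (Suc n) * \<tau>) x y"
  shows "heat_loss E \<tau> \<le> 2 * c3 * \<tau> powr (- dH / dW) * outward_jump r"
proof -
  let ?g = "indicat_real (- E)" and ?\<tau>' = "real (Suc n) * \<tau>"
  let ?\<eta> = "1 / (2 * real (Suc n))" and ?c = "c3 * \<tau> powr (- dH / dW)"
  have \<tau>': "?\<tau>' > 0" using \<tau> by simp
  have point: "K \<tau> ?g x \<le> ?c * measure M (ball x r \<inter> - E) + ?\<eta> * K ?\<tau>' ?g x" for x
  proof -
    have fin: "emeasure M (ball x r \<inter> - E) < \<infinity>"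
      unfolding ball_measure_emeasure[symmetric] by simp
    have B: "ball x r \<inter> - E \<in> sets M" using Compl_E by auto
    have i: "integrable M (indicat_real (ball x r \<inter> - E))"
      using fin B by (simp add: integrable_indicator_iff)
    have i': "integrable M (\<lambda>y. p ?\<tau>' x y * ?g y)"
      by (rule kernel_integrable[OF \<tau>' indicator_measurable[OF Compl_E] indicator_abs_le])
    have "K \<tau> ?g x \<le> (\<integral>y. ?c * indicat_real (ball x r \<inter> - E) y + ?\<eta> * (p ?\<tau>' x y * ?g y) \<partial>M)"
      unfolding kernel_op_def
    proof (rule integral_mono)
      show "integrable M (\<lambda>y. p \<tau> x y * ?g y)"
        by (rule kernel_integrable[OF \<tau> indicator_measurable[OF Compl_E] indicator_abs_le])
      show "integrable M (\<lambda>y. ?c * indicat_real (ball x r \<inter> - E) y + ?\<eta> * (p ?\<tau>' x y * ?g y))"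
        by (intro Bochner_Integration.integrable_add integrable_mult_right i i')
      fix y
      show "p \<tau> x y * ?g y \<le> ?c * indicat_real (ball x r \<inter> - E) y + ?\<eta> * (p ?\<tau>' x y * ?g y)"
      proof (cases "y \<in> E")
        case False
        have pos: "0 \<le> ?\<eta> * p ?\<tau>' x y" using p_nonneg[OF \<tau>'] by simp
        show ?thesis
        proof (cases "y \<in> ball x r")
          case True
          have "p \<tau> x y \<le> ?c * exp (- c4 * gauge \<tau> x y)"
            using p_upper[OF \<tau>, of x y] by (simp add: sub_gaussian_gauge)
          also have "\<dots> \<le> ?c * 1" using c3_pos c4_pos gauge_nonneg[of \<tau> x y] by (intro mult_left_mono) auto
          finally have "p \<tau> x y \<le> ?c" by simp
          with pos have "p \<tau> x y \<le> ?c + ?\<eta> * p ?\<tau>' x y" by linarith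
          with True False show ?thesis by simp
        next
          case False
          with far[of x y] \<open>y \<notin> E\<close> show ?thesis by simp
        qed
      qed simp
    qed
    also have "\<dots> = ?c * measure M (ball x r \<inter> - E) + ?\<eta> * K ?\<tau>' ?g x"
      using i i' B by (simp add: kernel_op_def)
    finally show ?thesis .
  qed
  have i: "integrable M (\<lambda>x. indicat_real E x * K \<tau> ?g x)" "integrable M (\<lambda>x. indicat_real E x * K ?\<tau>' ?g x)"
    by (intro integrable_E_times[of _ 1] K_indicator_measurable K_indicator_abs_le \<tau> \<tau>' Compl_E)+
  have j: "integrable M (\<lambda>x. indicat_real E x * measure M (ball x r \<inter> - E))"
    by (rule integrable_E_times[OF ball_measure_measurable[OF Compl_E] ball_measure_le]) (use r in simp)
  have "heat_loss E \<tau> \<le> (\<integral>x. ?c * (indicat_real E x * measure M (ball x r \<inter> - E)) + ?\<eta> * (indicat_real E x * K ?\<tau>' ?g x) \<partial>M)"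
    unfolding heat_loss_def
  proof (rule integral_mono[OF i(1)])
    show "integrable M (\<lambda>x. ?c * (indicat_real E x * measure M (ball x r \<inter> - E)) + ?\<eta> * (indicat_real E x * K ?\<tau>' ?g x))"
      by (intro Bochner_Integration.integrable_add integrable_mult_right i j)
    fix x
    show "indicat_real E x * K \<tau> ?g x \<le> ?c * (indicat_real E x * measure M (ball x r \<inter> - E)) + ?\<eta> * (indicat_real E x * K ?\<tau>' ?g x)"
      using point[of x] by (auto simp: indicator_def)
  qed
  also have "\<dots> = ?c * outward_jump r + ?\<eta> * heat_loss E ?\<tau>'"
    using i j by (simp add: outward_jump_def heat_loss_def)
  also have "\<dots> \<le> ?c * outward_jump r + ?\<eta> * (real (Suc n) * heat_loss E \<tau>)"
    by (intro add_left_mono mult_left_mono heat_loss_multiple \<tau>) simp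
  also have "?\<eta> * (real (Suc n) * heat_loss E \<tau>) = heat_loss E \<tau> / 2" by (simp add: field_simps)
  finally show ?thesis by simp
qed

end

end

text \<open>Takes the place of summing k^(\<theta> - 1): it lets an induction with the bound B
  n^\<theta> absorb one increment. The factor 1 / 2 stems from ln (1 + 1/k) \<ge> 1 / (k + 1) \<ge>
  1 / (2 k).\<close>

lemma powr_Suc_ge:
  fixes k \<theta> :: real
  assumes k: "k \<ge> 1" and \<theta>: "\<theta> > 0"
  shows "k powr \<theta> + \<theta> / 2 * k powr (\<theta> - 1) \<le> (k + 1) powr \<theta>"
proof -
  have "ln (k / (k + 1)) \<le> k / (k + 1) - 1" using k by (intro ln_le_minus_one) simp
  also have "\<dots> = - (1 / (k + 1))" using k by (simp add: field_simps)
  also have "\<dots> \<le> - (1 / (2 * k))" using k by (simp add: frac_le)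
  finally have "1 / (2 * k) \<le> ln (k + 1) - ln k" using k by (simp add: ln_div)
  then have "\<theta> * (1 / (2 * k)) \<le> \<theta> * (ln (k + 1) - ln k)" using \<theta> by (intro mult_left_mono) auto
  then have "1 + \<theta> * (1 / (2 * k)) \<le> exp (\<theta> * (ln (k + 1) - ln k))"
    using exp_ge_add_one_self[of "\<theta> * (ln (k + 1) - ln k)"] by linarith
  then have "k powr \<theta> * (1 + \<theta> * (1 / (2 * k))) \<le> k powr \<theta> * exp (\<theta> * (ln (k + 1) - ln k))"
    by (intro mult_left_mono) auto
  also have "\<dots> = (k + 1) powr \<theta>"
    using k by (simp add: powr_def exp_add[symmetric] algebra_simps)
  also have "k powr \<theta> * (1 + \<theta> * (1 / (2 * k))) = k powr \<theta> + \<theta> / 2 * k powr (\<theta> - 1)"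
    using k by (simp add: powr_diff field_simps)
  finally show ?thesis .
qed

section \<open>Growth of the heat loss in time, and its control at short times\<close>

context sub_gaussian_kernel
begin

lemma heat_loss_growth:
  obtains B where "B > 0"
    "\<And>E \<tau> n. \<lbrakk>E \<in> sets borel; emeasure M E < \<infinity>; \<tau> > 0\<rbrakk> \<Longrightarrow>
      heat_loss E (real (Suc n) * \<tau>) \<le> B * real (Suc n) powr (1 - \<kappa> / dW) * heat_loss E \<tau>"
proof -
  obtain N :: nat and A where N: "N \<ge> 1" and A: "A > 0"
    and cmp: "\<And>t x y. t > 0 \<Longrightarrow> p t x y \<le> A * exp (- (c4 / 2) * gauge t x y) * p (real N * t) x y"
    by (rule time_comparison) (rule that)
  \<comment> \<open>The exponent for which the \<kappa>-th power of the distance is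
    \<tau>^(\<kappa>/dW) times the m-th power of the gauge; C then bounds that power against the
    spare exponential factor.\<close>
  define m where "m = \<kappa> * (dW - 1) / dW"
  have m: "m > 0" using \<kappa>_pos dW by (simp add: m_def)
  define C where "C = A * (m / (c4 / 2)) powr m"
  have C: "C \<ge> 0" using A by (simp add: C_def)
  define \<theta> where "\<theta> = 1 - \<kappa> / dW"
  have \<theta>: "\<theta> > 0" using \<kappa>_less dW by (simp add: \<theta>_def)
  \<comment> \<open>At least 1 for the base case, and large enough that the increment, of size D C N
    k^(\<theta> - 1), fits under B (\<theta> / 2) k^(\<theta> - 1).\<close>
  define B where "B = max 1 (2 * D * C * real N / \<theta>)"
  have B1: "B \<ge> 1" by (simp add: B_def)
  have "2 * D * C * real N / \<theta> \<le> B" by (simp add: B_def)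
  then have B2: "D * C * real N \<le> B * (\<theta> / 2)" using \<theta> by (simp add: field_simps)
  have comparison: "p \<tau> x y * dist x y powr \<kappa> \<le> C * \<tau> powr (\<kappa> / dW) * p (real N * \<tau>) x y"
    if \<tau>: "\<tau> > 0" for \<tau> x y
  proof -
    let ?z = "gauge \<tau> x y" and ?q = "p (real N * \<tau>) x y"
    have q: "?q \<ge> 0" using \<tau> N by (intro p_nonneg) simp
    have "p \<tau> x y * dist x y powr \<kappa> \<le> A * exp (- (c4 / 2) * ?z) * ?q * dist x y powr \<kappa>"
      by (intro mult_right_mono cmp \<tau>) simp
    also have "\<dots> = (A * \<tau> powr (\<kappa> / dW) * ?q) * (?z powr m * exp (- (c4 / 2) * ?z))"
      unfolding dist_powr_gauge[OF \<tau> \<kappa>_pos] m_def by (simp only: mult_ac)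
    also have "\<dots> \<le> (A * \<tau> powr (\<kappa> / dW) * ?q) * (m / (c4 / 2)) powr m"
      using A q c4_pos by (intro mult_left_mono powr_mult_exp_le m gauge_nonneg) auto
    finally show ?thesis by (simp add: C_def mult_ac)
  qed
  have "heat_loss E (real (Suc n) * \<tau>) \<le> B * real (Suc n) powr \<theta> * heat_loss E \<tau>"
    if E: "E \<in> sets borel" "emeasure M E < \<infinity>" and \<tau>: "\<tau> > 0" for E \<tau> n
  proof (induction n)
    case 0
    have "1 * heat_loss E \<tau> \<le> B * heat_loss E \<tau>"
      using B1 heat_loss_nonneg[OF E \<tau>] by (intro mult_right_mono) auto
    then show ?case by simp
  next
    case (Suc n)
    define k where "k = real (Suc n)"
    have k: "k \<ge> 1" by (simp add: k_def)
    have h: "heat_loss E \<tau> \<ge> 0" by (rule heat_loss_nonneg[OF E \<tau>])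
    have k\<tau>: "k * \<tau> > 0" and N\<tau>: "real N * \<tau> > 0" using k N \<tau> by auto
    have "heat_loss E (k * \<tau> + \<tau>)
        \<le> heat_loss E (k * \<tau>) + D * C * (\<tau> / (k * \<tau>)) powr (\<kappa> / dW) * heat_loss E (real N * \<tau>)"
      by (rule heat_loss_step[OF E k\<tau> \<tau> N\<tau> comparison[OF \<tau>]])
    also have "(\<tau> / (k * \<tau>)) powr (\<kappa> / dW) = k powr (\<theta> - 1)"
    proof -
      have "\<tau> / (k * \<tau>) = 1 / k" using \<tau> by simp
      moreover have "(1 / k) powr (\<kappa> / dW) = k powr - (\<kappa> / dW)"
        using k by (simp add: powr_divide powr_minus_divide)
      ultimately show ?thesis by (simp add: \<theta>_def)
    qed
    also have "heat_loss E (k * \<tau>) + D * C * k powr (\<theta> - 1) * heat_loss E (real N * \<tau>)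
        \<le> B * k powr \<theta> * heat_loss E \<tau> + D * C * k powr (\<theta> - 1) * (real N * heat_loss E \<tau>)"
    proof (intro add_mono mult_left_mono)
      show "heat_loss E (k * \<tau>) \<le> B * k powr \<theta> * heat_loss E \<tau>" using Suc by (simp add: k_def)
      \<comment> \<open>Subadditivity undoes the enlargement of the time from \<tau> to N
        \<tau>.\<close>
      show "heat_loss E (real N * \<tau>) \<le> real N * heat_loss E \<tau>"
        using heat_loss_multiple[OF E \<tau>, of "N - 1"] N by simp
    qed (use D_pos C in auto)
    also have "\<dots> = B * k powr \<theta> * heat_loss E \<tau> + (D * C * real N) * (k powr (\<theta> - 1) * heat_loss E \<tau>)"
      by simp
    also have "\<dots> \<le> B * k powr \<theta> * heat_loss E \<tau> + B * (\<theta> / 2) * (k powr (\<theta> - 1) * heat_loss E \<tau>)"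
      using h by (intro add_left_mono mult_right_mono B2) auto
    also have "\<dots> = B * (k powr \<theta> + \<theta> / 2 * k powr (\<theta> - 1)) * heat_loss E \<tau>" by (simp add: algebra_simps)
    also have "\<dots> \<le> B * (k + 1) powr \<theta> * heat_loss E \<tau>"
      using B1 h by (intro mult_right_mono mult_left_mono powr_Suc_ge k \<theta>) auto
    also have "k * \<tau> + \<tau> = real (Suc (Suc n)) * \<tau>" by (simp add: k_def algebra_simps)
    also have "k + 1 = real (Suc (Suc n))" by (simp add: k_def)
    finally show ?case .
  qed
  moreover have "B > 0" using B1 by simp
  ultimately show ?thesis using that unfolding \<theta>_def by blast
qed

lemma heat_loss_small_time:
  obtains L C where "L > 0" "C > 0"
    "\<And>E r. \<lbrakk>E \<in> sets borel; emeasure M E < \<infinity>; r > 0\<rbrakk> \<Longrightarrow>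
      heat_loss E (r powr dW / L) \<le> C * r powr (- dH) * outward_jump E r"
proof -
  obtain N :: nat and A where N: "N \<ge> 1" and A: "A > 0"
    and cmp: "\<And>t x y. t > 0 \<Longrightarrow> p t x y \<le> A * exp (- (c4 / 2) * gauge t x y) * p (real N * t) x y"
    by (rule time_comparison) (rule that)
  obtain n where n: "N = Suc n" using N by (cases N) auto
  define \<beta> where "\<beta> = 1 / (dW - 1)"
  have \<beta>: "\<beta> > 0" using dW by (simp add: \<beta>_def)
  \<comment> \<open>From gauge g onwards the factor of \<open>time_comparison\<close> is at most 1 /
    (2 N), as \<open>heat_loss_le_outward_jump\<close> requires. The maximum keeps g positive even
    if the logarithm is not.\<close>
  define g where "g = max 1 (2 / c4 * ln (2 * real N * A))"
  have g: "g > 0" by (simp add: g_def)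
  \<comment> \<open>At time r^dW / L, points at distance at least r have gauge at least L^\<beta> =
    g.\<close>
  define L where "L = g powr (1 / \<beta>)"
  have L: "L > 0" using g by (simp add: L_def)
  have L\<beta>: "L powr \<beta> = g" using \<beta> g by (simp add: L_def powr_powr)
  have "2 / c4 * ln (2 * real N * A) \<le> g" by (simp add: g_def)
  then have "ln (2 * real N * A) \<le> c4 / 2 * g" using c4_pos by (simp add: field_simps)
  then have "exp (- (c4 / 2 * g)) \<le> exp (- ln (2 * real N * A))" by simp
  also have "\<dots> = 1 / (2 * real N * A)" using N A by (simp add: exp_minus inverse_eq_divide)
  finally have Ag: "A * exp (- (c4 / 2) * g) \<le> 1 / (2 * real N)" using A N by (simp add: field_simps)
  define C where "C = 2 * c3 * L powr (dH / dW)"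
  have "heat_loss E (r powr dW / L) \<le> C * r powr (- dH) * outward_jump E r"
    if E: "E \<in> sets borel" "emeasure M E < \<infinity>" and r: "r > 0" for E r
  proof -
    define \<tau> where "\<tau> = r powr dW / L"
    have \<tau>: "\<tau> > 0" using r L by (simp add: \<tau>_def)
    have far: "p \<tau> x y \<le> 1 / (2 * real (Suc n)) * p (real (Suc n) * \<tau>) x y" if "r \<le> dist x y" for x y
    proof -
      have "r powr dW \<le> dist x y powr dW" using that r dW by (intro powr_mono2) auto
      then have "L \<le> dist x y powr dW / \<tau>" using \<tau> r L by (simp add: \<tau>_def field_simps)
      then have "L powr \<beta> \<le> gauge \<tau> x y"
        unfolding gauge_def \<beta>_def[symmetric] using L \<beta> by (intro powr_mono2) auto
      then have "exp (- (c4 / 2) * gauge \<tau> x y) \<le> exp (- (c4 / 2) * g)" using c4_pos by (simp add: L\<beta>)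
      then have "A * exp (- (c4 / 2) * gauge \<tau> x y) \<le> 1 / (2 * real N)"
        using Ag A by (meson less_imp_le mult_left_mono order_trans)
      then have "A * exp (- (c4 / 2) * gauge \<tau> x y) * p (real N * \<tau>) x y \<le> 1 / (2 * real N) * p (real N * \<tau>) x y"
        using N \<tau> by (intro mult_right_mono p_nonneg) auto
      with cmp[OF \<tau>, of x y] show ?thesis by (simp add: n)
    qed
    have "heat_loss E \<tau> \<le> 2 * c3 * \<tau> powr (- dH / dW) * outward_jump E r"
      by (rule heat_loss_le_outward_jump[OF E \<tau> r far])
    also have "\<tau> powr (- dH / dW) = r powr (- dH) * L powr (dH / dW)"
      using r L dW by (simp add: \<tau>_def powr_divide powr_powr powr_minus field_simps)
    finally show ?thesis by (simp add: \<tau>_def C_def mult_ac)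
  qed
  moreover have "C > 0" using c3_pos L by (simp add: C_def)
  ultimately show ?thesis using L that by blast
qed

section \<open>Comparison with the Korevaar-Schoen energy\<close>

lemma outward_jump_le_KS_energy:
  assumes E: "E \<in> sets borel" and fin: "emeasure M E < \<infinity>" and r: "r > 0"
  shows "ennreal (outward_jump E r) \<le> ennreal (c2 * r powr (l + dH)) * KS_energy M l (indicator E) r"
proof -
  let ?b = "\<lambda>x. ennreal (r powr l) * emeasure M (ball x r)"
  have int: "integrable M (\<lambda>x. indicat_real E x * measure M (ball x r \<inter> - E))"
    using r by (intro integrable_E_times[OF E fin ball_measure_measurable[OF E fin] ball_measure_le[OF E fin]])
      (use E in auto)
  have "ennreal (outward_jump E r) = (\<integral>\<^sup>+x. ennreal (indicat_real E x * measure M (ball x r \<inter> - E)) \<partial>M)"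
    unfolding outward_jump_def[OF E fin] using int by (intro nn_integral_eq_integral[symmetric]) auto
  also have "\<dots> \<le> (\<integral>\<^sup>+x. ennreal (c2 * r powr (l + dH)) * (jump E r x / ?b x) \<partial>M)"
  proof (rule nn_integral_mono)
    fix x
    show "ennreal (indicat_real E x * measure M (ball x r \<inter> - E)) \<le> ennreal (c2 * r powr (l + dH)) * (jump E r x / ?b x)"
    proof (cases "x \<in> E")
      case True
      have b0: "?b x \<noteq> 0" "?b x < top"
        using ball_pos[OF r, of x] ball_finite[of x r] r by (auto simp: ennreal_mult_less_top)
      have "?b x \<le> ennreal (r powr l) * ennreal (c2 * r powr dH)"
        using r by (intro mult_left_mono ball_upper) auto
      also have "\<dots> = ennreal (c2 * r powr (l + dH))"
        using c2_pos by (simp add: ennreal_mult[symmetric] powr_add mult_ac)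
      finally have le: "?b x \<le> ennreal (c2 * r powr (l + dH))" .
      have "jump E r x = ?b x * (jump E r x / ?b x)"
        using b0 by (simp add: ennreal_times_divide mult_divide_eq_ennreal mult.commute)
      also have "\<dots> \<le> ennreal (c2 * r powr (l + dH)) * (jump E r x / ?b x)"
        by (intro mult_right_mono le) simp
      finally show ?thesis using True by (simp add: jump_def ball_measure_emeasure[OF E fin])
    qed simp
  qed
  also have "\<dots> = ennreal (c2 * r powr (l + dH)) * KS_energy M l (indicator E) r"
    unfolding KS_energy_indicator[OF E]
    by (intro nn_integral_cmult borel_measurable_divide_ennreal measurable_jump E
        borel_measurable_times_ennreal measurable_ball_measure' borel_measurable_const)
  finally show ?thesis .
qed

text \<open>Symmetry of the kernel exchanges E and its complement, but the indicator of the
  complement is not in L2. Its bounded pieces are exchanged instead, and Fatou's lemma removes the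
  cut-off.\<close>

lemma heat_loss_Compl_le:
  assumes E: "E \<in> sets borel" and fin: "emeasure M E < \<infinity>" and t: "t > 0"
  shows "(\<integral>\<^sup>+x. ennreal (indicat_real (- E) x * K t (indicat_real E) x) \<partial>M) \<le> ennreal (heat_loss E t)"
proof -
  define A where "A n = ball (undefined :: 'a) (real n) \<inter> - E" for n :: nat
  have A: "A n \<in> sets borel" for n unfolding A_def using E by auto
  have finA: "emeasure M (A n) < \<infinity>" for n
  proof -
    have "emeasure M (A n) \<le> emeasure M (ball undefined (real n))" unfolding A_def by (intro emeasure_mono) auto
    from le_less_trans[OF this ball_finite] show ?thesis by simp
  qed
  have L2A: "indicat_real (A n) \<in> L2_space M" for n using A finA by (intro L2_indicator) auto
  let ?u = "\<lambda>n x. ennreal (indicat_real (A n) x * K t (indicat_real E) x)"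
  have bound: "(\<integral>\<^sup>+x. ?u n x \<partial>M) \<le> ennreal (heat_loss E t)" for n
  proof -
    have "(\<integral>\<^sup>+x. ?u n x \<partial>M) = ennreal (\<integral>x. indicat_real (A n) x * K t (indicat_real E) x \<partial>M)"
      using K_indicator_nonneg[OF t]
      by (intro nn_integral_eq_integral L2_integrable_mult L2A kernel_L2[OF t L2_E[OF E fin] indicator_abs_le]) auto
    also have "(\<integral>x. indicat_real (A n) x * K t (indicat_real E) x \<partial>M)
        = (\<integral>x. indicat_real E x * K t (indicat_real (A n)) x \<partial>M)"
      using kernel_sym[OF t L2A indicator_abs_le L2_E[OF E fin] indicator_abs_le, of n] by (simp add: mult.commute)
    also have "\<dots> \<le> heat_loss E t"
      unfolding heat_loss_def
    proof (rule integral_mono)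
      show "integrable M (\<lambda>x. indicat_real E x * K t (indicat_real (A n)) x)"
        by (intro integrable_E_times[OF E fin, of _ 1] K_indicator_measurable K_indicator_abs_le t A)
      show "integrable M (\<lambda>x. indicat_real E x * K t (indicat_real (- E)) x)"
        using E by (intro integrable_E_times[OF E fin, of _ 1] K_indicator_measurable K_indicator_abs_le t) auto
      fix x
      have "K t (indicat_real (A n)) x \<le> K t (indicat_real (- E)) x"
        using E by (intro kernel_mono[OF t indicator_measurable[OF A] indicator_abs_le
              indicator_measurable indicator_abs_le]) (auto simp: indicator_def A_def)
      then show "indicat_real E x * K t (indicat_real (A n)) x \<le> indicat_real E x * K t (indicat_real (- E)) x"
        by (intro mult_left_mono) auto
    qed
    finally show ?thesis by (simp add: ennreal_leI)
  qed
  have "(\<integral>\<^sup>+x. ennreal (indicat_real (- E) x * K t (indicat_real E) x) \<partial>M) = (\<integral>\<^sup>+x. liminf (\<lambda>n. ?u n x) \<partial>M)"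
  proof (rule nn_integral_cong)
    fix x :: 'a
    obtain m :: nat where m: "dist undefined x < real m" using reals_Archimedean2 by blast
    have "\<forall>\<^sub>F n in sequentially. ?u n x = ennreal (indicat_real (- E) x * K t (indicat_real E) x)"
      using eventually_ge_at_top[of m] by eventually_elim (use m in \<open>auto simp: A_def indicator_def\<close>)
    then show "ennreal (indicat_real (- E) x * K t (indicat_real E) x) = liminf (\<lambda>n. ?u n x)"
      by (intro lim_imp_Liminf[symmetric] tendsto_eventually) auto
  qed
  also have "\<dots> \<le> liminf (\<lambda>n. \<integral>\<^sup>+x. ?u n x \<partial>M)"
    by (intro nn_integral_liminf measurable_compose[OF _ measurable_ennreal]
        borel_measurable_times indicator_measurable A K_indicator_measurable t E)
  also have "\<dots> \<le> liminf (\<lambda>n. ennreal (heat_loss E t))"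
    by (intro Liminf_mono always_eventually allI bound)
  also have "\<dots> = ennreal (heat_loss E t)" by (simp add: Liminf_const)
  finally show ?thesis .
qed

text \<open>For t in this window the gauge is at most 1 on the ball, so the kernel is at least a
  constant times r^(- dH) there. A window is allowed instead of t = r^dW because t will have to be
  an integer multiple of a given small time.\<close>

lemma ball_measure_le_kernel:
  assumes A: "A \<in> sets borel" and r: "r > 0" and t: "r powr dW \<le> t" "t \<le> 2 * r powr dW"
  shows "emeasure M (ball x r \<inter> A)
    \<le> ennreal (r powr dH / (c5 * 2 powr (- dH / dW) * exp (- c6)) * K t (indicat_real A) x)"
proof -
  define b where "b = c5 * 2 powr (- dH / dW) * exp (- c6)"
  have b: "b > 0" using c5_pos by (simp add: b_def)
  have t0: "t > 0" using r by (intro less_le_trans[OF _ t(1)]) simp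
  have BA: "ball x r \<inter> A \<in> sets M" using A by auto
  have "emeasure M (ball x r \<inter> A) = (\<integral>\<^sup>+y. indicator (ball x r \<inter> A) y \<partial>M)"
    using BA by simp
  also have "\<dots> \<le> (\<integral>\<^sup>+y. ennreal (r powr dH / b * (p t x y * indicat_real A y)) \<partial>M)"
  proof (rule nn_integral_mono)
    fix y
    show "indicator (ball x r \<inter> A) y \<le> ennreal (r powr dH / b * (p t x y * indicat_real A y))"
    proof (cases "y \<in> ball x r \<inter> A")
      case True
      have "dist x y powr dW \<le> r powr dW" using True dW by (intro powr_mono2) auto
      then have "dist x y powr dW / t \<le> 1" using t t0 by simp
      then have "gauge t x y \<le> 1 powr (1 / (dW - 1))"
        unfolding gauge_def using t0 dW by (intro powr_mono2) auto
      then have e: "exp (- c6) \<le> exp (- c6 * gauge t x y)" using c6_pos by simp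
      have "(2 * r powr dW) powr (- dH / dW) \<le> t powr (- dH / dW)"
        using t t0 dH_pos dW by (intro powr_mono2') auto
      also have "(2 * r powr dW) powr (- dH / dW) = 2 powr (- dH / dW) * r powr (- dH)"
        using r dW by (simp add: powr_mult powr_powr)
      finally have tp: "2 powr (- dH / dW) * r powr (- dH) \<le> t powr (- dH / dW)" .
      have "b * r powr (- dH) = c5 * (2 powr (- dH / dW) * r powr (- dH)) * exp (- c6)"
        by (simp add: b_def)
      also have "\<dots> \<le> c5 * t powr (- dH / dW) * exp (- c6 * gauge t x y)"
        using c5_pos by (intro mult_mono mult_left_mono tp e) auto
      also have "\<dots> \<le> p t x y" using p_lower[OF t0, of x y] by (simp add: sub_gaussian_gauge)
      finally have "r powr dH / b * (b * r powr (- dH)) \<le> r powr dH / b * p t x y"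
        using b by (intro mult_left_mono) auto
      moreover have "r powr dH / b * (b * r powr (- dH)) = 1"
        using b r by (simp add: powr_minus)
      ultimately show ?thesis using True by (simp add: ennreal_1[symmetric] ennreal_leI del: ennreal_1)
    qed simp
  qed
  also have "\<dots> = ennreal (\<integral>y. r powr dH / b * (p t x y * indicat_real A y) \<partial>M)"
    using b p_nonneg[OF t0]
    by (intro nn_integral_eq_integral integrable_mult_right
        kernel_integrable[OF t0 indicator_measurable[OF A] indicator_abs_le]) auto
  also have "\<dots> = ennreal (r powr dH / b * K t (indicat_real A) x)" by (simp add: kernel_op_def)
  finally show ?thesis unfolding b_def .
qed

text \<open>The points x in E and those outside contribute at most the heat loss each, hence the
  factor 2 in the constant.\<close>

lemma KS_energy_le_heat_loss:
  obtains C where "C > 0"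
    "\<And>E r t l. \<lbrakk>E \<in> sets borel; emeasure M E < \<infinity>; r > 0; r powr dW \<le> t; t \<le> 2 * r powr dW\<rbrakk> \<Longrightarrow>
      KS_energy M l (indicator E) r \<le> ennreal (C * r powr (- l) * heat_loss E t)"
proof -
  define b where "b = c5 * 2 powr (- dH / dW) * exp (- c6)"
  have b: "b > 0" using c5_pos by (simp add: b_def)
  have "KS_energy M l (indicator E) r \<le> ennreal (2 / (b * c1) * r powr (- l) * heat_loss E t)"
    if E: "E \<in> sets borel" "emeasure M E < \<infinity>" and r: "r > 0" and t: "r powr dW \<le> t" "t \<le> 2 * r powr dW"
    for E r t l
  proof -
    have t0: "t > 0" using r by (intro less_le_trans[OF _ t(1)]) simp
    have CE: "- E \<in> sets borel" using E by auto
    let ?f = "indicat_real E" and ?g = "indicat_real (- E)"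
    define a where "a = r powr (- l) / (b * c1)"
    have a: "a > 0" using b c1_pos r by (simp add: a_def)
    have "KS_energy M l (indicator E) r
        \<le> (\<integral>\<^sup>+x. ennreal a * (ennreal (?f x * K t ?g x) + ennreal (?g x * K t ?f x)) \<partial>M)"
      unfolding KS_energy_indicator[OF E(1)]
    proof (rule nn_integral_mono)
      fix x
      define q where "q = (if x \<in> E then K t ?g x else K t ?f x)"
      have q: "q \<ge> 0" using K_indicator_nonneg[OF t0] by (simp add: q_def)
      have "ennreal (c1 * r powr (l + dH)) = ennreal (r powr l) * ennreal (c1 * r powr dH)"
        using c1_pos by (simp add: ennreal_mult[symmetric] powr_add mult_ac)
      also have "\<dots> \<le> ennreal (r powr l) * emeasure M (ball x r)"
        using r by (intro mult_left_mono ball_lower) auto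
      finally have le: "ennreal (c1 * r powr (l + dH)) \<le> ennreal (r powr l) * emeasure M (ball x r)" .
      have "jump E r x / (ennreal (r powr l) * emeasure M (ball x r)) \<le> jump E r x / ennreal (c1 * r powr (l + dH))"
      proof (rule divide_le_posI_ennreal)
        have c: "ennreal (c1 * r powr (l + dH)) \<noteq> 0" using c1_pos r by simp
        show "0 < ennreal (r powr l) * emeasure M (ball x r)"
          using less_le_trans[OF _ le, of 0] c by (simp add: zero_less_iff_neq_zero)
        have "jump E r x = jump E r x / ennreal (c1 * r powr (l + dH)) * ennreal (c1 * r powr (l + dH))"
          using c by (simp add: ennreal_divide_times mult_divide_eq_ennreal ennreal_times_divide[symmetric])
        also have "\<dots> \<le> jump E r x / ennreal (c1 * r powr (l + dH)) * (ennreal (r powr l) * emeasure M (ball x r))"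
          by (intro mult_left_mono le) simp
        finally show "jump E r x \<le> ennreal (r powr l) * emeasure M (ball x r) * (jump E r x / ennreal (c1 * r powr (l + dH)))"
          by (simp only: mult.commute)
      qed
      also have "\<dots> \<le> ennreal (r powr dH / b * q) / ennreal (c1 * r powr (l + dH))"
      proof (rule divide_right_mono_ennreal)
        show "jump E r x \<le> ennreal (r powr dH / b * q)"
          unfolding jump_def q_def b_def
          using ball_measure_le_kernel[OF E(1) r t, of x] ball_measure_le_kernel[OF CE r t, of x] by simp
      qed
      also have "\<dots> = ennreal (r powr dH / b * q / (c1 * r powr (l + dH)))"
        using b q c1_pos r by (intro divide_ennreal) auto
      also have "r powr dH / b * q / (c1 * r powr (l + dH)) = a * q"
        using r by (simp add: a_def powr_add powr_minus field_simps)
      also have "ennreal (a * q) = ennreal a * ennreal q" using a q by (intro ennreal_mult) auto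
      also have "ennreal q = ennreal (?f x * K t ?g x) + ennreal (?g x * K t ?f x)"
        by (simp add: q_def)
      finally show "jump E r x / (ennreal (r powr l) * emeasure M (ball x r))
        \<le> ennreal a * (ennreal (?f x * K t ?g x) + ennreal (?g x * K t ?f x))" .
    qed
    also have "\<dots> = ennreal a * ((\<integral>\<^sup>+x. ennreal (?f x * K t ?g x) \<partial>M) + (\<integral>\<^sup>+x. ennreal (?g x * K t ?f x) \<partial>M))"
    proof -
      have m: "(\<lambda>x. ennreal (?f x * K t ?g x)) \<in> borel_measurable M"
        "(\<lambda>x. ennreal (?g x * K t ?f x)) \<in> borel_measurable M"
        by (intro measurable_compose[OF _ measurable_ennreal] borel_measurable_times indicator_measurable
            K_indicator_measurable t0 E CE)+
      show ?thesis
        by (subst nn_integral_cmult) (use m in \<open>auto simp: nn_integral_add\<close>)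
    qed
    also have "(\<integral>\<^sup>+x. ennreal (?f x * K t ?g x) \<partial>M) = ennreal (heat_loss E t)"
      unfolding heat_loss_def using K_indicator_nonneg[OF t0]
      by (intro nn_integral_eq_integral integrable_E_times[OF E, of _ 1] K_indicator_measurable
          K_indicator_abs_le t0 CE) auto
    also have "ennreal a * (ennreal (heat_loss E t) + (\<integral>\<^sup>+x. ennreal (?g x * K t ?f x) \<partial>M))
        \<le> ennreal a * (ennreal (heat_loss E t) + ennreal (heat_loss E t))"
      by (intro mult_left_mono add_left_mono heat_loss_Compl_le E t0) simp
    also have "\<dots> = ennreal (a * (heat_loss E t + heat_loss E t))"
      using a heat_loss_nonneg[OF E t0] 
      by (simp add: ennreal_plus[symmetric] ennreal_mult[symmetric] del: ennreal_plus)
    also have "a * (heat_loss E t + heat_loss E t) = 2 / (b * c1) * r powr (- l) * heat_loss E t"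
      by (simp add: a_def)
    finally show ?thesis .
  qed
  moreover have "2 / (b * c1) > 0" using b c1_pos by simp
  ultimately show ?thesis using that by blast
qed

text \<open>A finite lower limit gives arbitrarily small scales \<rho> with energy below a fixed
  level b. For every r a good \<rho>, small relative to r, is chosen; the final bound Q involves
  neither r nor \<rho>, so the energies are bounded at all scales.\<close>

theorem KS_energy_bounded:
  assumes E: "E \<in> sets borel" and fin: "emeasure M E < \<infinity>"
    and Liminf: "Liminf (at_right 0) (KS_energy M (dW - \<kappa>) (indicator E)) < \<infinity>"
  shows "Limsup (at_right 0) (KS_energy M (dW - \<kappa>) (indicator E)) < \<infinity>"
proof -
  define l where "l = dW - \<kappa>"
  let ?KS = "KS_energy M l (indicator E)"
  define \<theta> where "\<theta> = 1 - \<kappa> / dW"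
  have \<theta>: "\<theta> > 0" using \<kappa>_less dW by (simp add: \<theta>_def)
  have dW\<theta>: "dW * \<theta> = l" using dW by (simp add: \<theta>_def l_def field_simps)
  obtain B where B: "B > 0"
    and growth: "\<And>\<tau> n. \<tau> > 0 \<Longrightarrow> heat_loss E (real (Suc n) * \<tau>) \<le> B * real (Suc n) powr \<theta> * heat_loss E \<tau>"
    unfolding \<theta>_def using heat_loss_growth E fin by metis
  obtain L C where L: "L > 0" and C: "C > 0"
    and small: "\<And>r. r > 0 \<Longrightarrow> heat_loss E (r powr dW / L) \<le> C * r powr (- dH) * outward_jump E r"
    using heat_loss_small_time E fin by metis
  obtain C' where C': "C' > 0"
    and upper: "\<And>r t. \<lbrakk>r > 0; r powr dW \<le> t; t \<le> 2 * r powr dW\<rbrakk> \<Longrightarrow>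
      ?KS r \<le> ennreal (C' * r powr (- l) * heat_loss E t)"
    using KS_energy_le_heat_loss E fin by metis
  obtain b where b: "b > 0" and Lb: "Liminf (at_right 0) ?KS < ennreal b"
  proof (cases "Liminf (at_right 0) ?KS")
    case (real q)
    then show ?thesis using that[of "q + 1"] by (simp add: ennreal_less_iff)
  qed (use Liminf in \<open>simp add: l_def\<close>)
  have "\<not> (\<forall>\<^sub>F r in at_right 0. ennreal b \<le> ?KS r)"
    using Lb Liminf_bounded[of "ennreal b" ?KS "at_right 0"] by auto
  then have freq: "\<exists>\<^sub>F r in at_right 0. ?KS r < ennreal b" by (simp add: frequently_def not_less)
  define Q where "Q = C' * (B * (2 * L) powr \<theta> * (C * (c2 * b)))"
  have bound: "?KS r \<le> ennreal Q" if r: "r > 0" for r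
  proof -
    \<comment> \<open>\<rho> < \<delta> is the condition that \<tau> = \<rho>^dW / L does not exceed
      r^dW, which leaves room for multiples of \<tau>.\<close>
    define \<delta> where "\<delta> = (L * r powr dW) powr (1 / dW)"
    have \<delta>: "\<delta> > 0" using L r by (simp add: \<delta>_def)
    obtain \<rho> where \<rho>: "0 < \<rho>" "\<rho> < \<delta>" and KS\<rho>: "?KS \<rho> < ennreal b"
      using freq \<delta> unfolding frequently_at_right_0_iff by blast
    define \<tau> where "\<tau> = \<rho> powr dW / L"
    have \<tau>: "\<tau> > 0" using \<rho> L by (simp add: \<tau>_def)
    have "\<rho> powr dW \<le> \<delta> powr dW" using \<rho> dW by (intro powr_mono2) auto
    also have "\<dots> = L * r powr dW" using L r dW by (simp add: \<delta>_def powr_powr)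
    finally have \<tau>r: "\<tau> \<le> r powr dW" using L by (simp add: \<tau>_def field_simps)
    \<comment> \<open>The quotient is at least 1, so replacing it by \<open>Suc n\<close> at most
      doubles it. Hence \<open>Suc n * \<tau>\<close> falls into the window accepted by
      \<open>upper\<close>.\<close>
    define n where "n = nat \<lfloor>r powr dW / \<tau>\<rfloor>"
    have "1 \<le> r powr dW / \<tau>" using \<tau>r \<tau> by simp
    then have "real n \<le> r powr dW / \<tau>" "r powr dW / \<tau> \<le> real (Suc n)" "real (Suc n) \<le> 2 * (r powr dW / \<tau>)"
      unfolding n_def by linarith+
    then have t: "r powr dW \<le> real (Suc n) * \<tau>" "real (Suc n) * \<tau> \<le> 2 * r powr dW"
      and n: "real (Suc n) \<le> 2 * r powr dW / \<tau>"
      using \<tau> by (auto simp: field_simps)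
    have jump: "outward_jump E \<rho> \<le> c2 * \<rho> powr (l + dH) * b"
    proof -
      have "ennreal (outward_jump E \<rho>) \<le> ennreal (c2 * \<rho> powr (l + dH)) * ?KS \<rho>"
        by (rule outward_jump_le_KS_energy[OF E fin \<rho>(1)])
      also have "\<dots> \<le> ennreal (c2 * \<rho> powr (l + dH)) * ennreal b"
        using KS\<rho> by (intro mult_left_mono) auto
      also have "\<dots> = ennreal (c2 * \<rho> powr (l + dH) * b)" using c2_pos b by (simp add: ennreal_mult)
      finally show ?thesis using c2_pos b by (simp add: ennreal_le_iff)
    qed
    have "heat_loss E \<tau> \<le> C * \<rho> powr (- dH) * outward_jump E \<rho>" unfolding \<tau>_def by (rule small[OF \<rho>(1)])
    also have "\<dots> \<le> C * \<rho> powr (- dH) * (c2 * \<rho> powr (l + dH) * b)"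
      using C by (intro mult_left_mono jump) auto
    also have "\<dots> = C * (c2 * b) * \<rho> powr l"
      using \<rho> by (simp add: powr_add powr_minus field_simps)
    finally have h\<tau>: "heat_loss E \<tau> \<le> C * (c2 * b) * \<rho> powr l" .
    have "real (Suc n) powr \<theta> \<le> (2 * r powr dW / \<tau>) powr \<theta>"
      using \<theta> by (intro powr_mono2 n) auto
    also have "2 * r powr dW / \<tau> = (2 * L) * (r powr dW / \<rho> powr dW)" using \<rho> L by (simp add: \<tau>_def)
    also have "\<dots> powr \<theta> = (2 * L) powr \<theta> * (r powr l / \<rho> powr l)"
      using L r \<rho> by (simp only: powr_mult powr_divide powr_powr dW\<theta>)
    finally have n\<theta>: "real (Suc n) powr \<theta> \<le> (2 * L) powr \<theta> * (r powr l / \<rho> powr l)" .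
    have "heat_loss E (real (Suc n) * \<tau>) \<le> B * real (Suc n) powr \<theta> * heat_loss E \<tau>"
      by (rule growth[OF \<tau>])
    \<comment> \<open>The number of steps brings \<rho>^(- l) and the heat loss at the good scale
      \<rho>^l, so \<rho> drops out.\<close>
    also have "\<dots> \<le> B * ((2 * L) powr \<theta> * (r powr l / \<rho> powr l)) * (C * (c2 * b) * \<rho> powr l)"
      using B by (intro mult_mono mult_left_mono n\<theta> h\<tau>) (auto simp: heat_loss_nonneg[OF E fin \<tau>])
    also have "\<dots> = B * (2 * L) powr \<theta> * (C * (c2 * b)) * r powr l"
      using \<rho> by (simp add: field_simps)
    finally have "C' * r powr (- l) * heat_loss E (real (Suc n) * \<tau>)
        \<le> C' * r powr (- l) * (B * (2 * L) powr \<theta> * (C * (c2 * b)) * r powr l)"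
      using C' by (intro mult_left_mono) auto
    also have "\<dots> = Q" using r by (simp add: Q_def powr_minus field_simps)
    finally show ?thesis using upper[OF r t] by (meson ennreal_leI order_trans)
  qed
  have "Limsup (at_right 0) ?KS \<le> ennreal Q"
    by (intro Limsup_bounded eventually_mono[OF eventually_at_right_less] bound)
  then show ?thesis unfolding l_def by (simp add: le_less_trans)
qed

end

section \<open>The kernel of a sub-Gaussian Dirichlet space\<close>

context ahlfors_space
begin

lemma AE_open_witness:
  assumes "AE x in M. Q x" "open U" "x0 \<in> U"
  obtains x where "x \<in> U" "Q x"
proof -
  have "\<exists>x\<in>U. Q x"
  proof (rule ccontr)
    assume "\<not> (\<exists>x\<in>U. Q x)"
    then have "AE x in M. x \<notin> U" using assms(1) by (auto elim: AE_mp)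
    then have "emeasure M U = 0"
      using AE_iff_measurable[of U M "\<lambda>x. x \<notin> U"] assms(2) by auto
    with open_positive[OF assms(2)] assms(3) show False by auto
  qed
  with that show ?thesis by blast
qed

text \<open>A violation at one pair would persist on an open rectangle. Fubini for null sets,
  together with the positivity of nonempty open sets in each factor, finds a pair in the rectangle
  where the condition holds. For continuous kernels this makes the sub-Gaussian bounds valid
  everywhere.\<close>

lemma AE_pair_closed:
  fixes Q :: "'a \<Rightarrow> 'a \<Rightarrow> bool"
  assumes ae: "AE (x, y) in M \<Otimes>\<^sub>M M. Q x y" and closed: "closed {z. Q (fst z) (snd z)}"
  shows "Q x y"
proof (rule ccontr)
  assume "\<not> Q x y"
  then have "(x, y) \<in> - {z. Q (fst z) (snd z)}" by simp
  with open_Compl[OF closed] obtain U V where U: "open U" and V: "open V"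
    and "(x, y) \<in> U \<times> V" and UV: "U \<times> V \<subseteq> - {z. Q (fst z) (snd z)}"
    by (rule open_prod_elim) (rule that)
  then have xU: "x \<in> U" and yV: "y \<in> V" by auto
  interpret pair_sigma_finite M M
    using sigma_finite_M by (simp add: pair_sigma_finite_def)
  have "AE x in M. AE y in M. Q x y" using AE_pair[OF ae] by simp
  then obtain x' where x': "x' \<in> U" and ae': "AE y in M. Q x' y"
    using U xU by (rule AE_open_witness) (rule that)
  from ae' V yV obtain y' where "y' \<in> V" "Q x' y'" by (rule AE_open_witness) (rule that)
  with x' UV show False by auto
qed

end

lemma continuous_on_sub_gaussian:
  assumes "dW > 1" "t > 0"
  shows "continuous_on UNIV (\<lambda>z :: 'a::metric_space \<times> 'a. sub_gaussian dH dW a b t (fst z) (snd z))"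
proof -
  have 1: "continuous_on UNIV (\<lambda>z :: 'a \<times> 'a. dist (fst z) (snd z) powr dW / t)"
    using assms by (intro continuous_on_divide continuous_on_powr' continuous_intros) auto
  have "continuous_on UNIV (\<lambda>z :: 'a \<times> 'a. (dist (fst z) (snd z) powr dW / t) powr (1 / (dW - 1)))"
    using assms by (intro continuous_on_powr'[OF 1] continuous_intros) auto
  then show ?thesis
    unfolding sub_gaussian_def by (intro continuous_on_mult continuous_on_const continuous_on_exp)
qed

text \<open>The functions \<open>P t u\<close> are specified up to null sets only. Their properties
  are transported to \<open>kernel_op M p t u\<close>, which for bounded u is continuous and has
  meaningful values at points.\<close>

lemma sub_gaussian_kernel_exists:
  assumes space: "sub_gaussian_dirichlet_space M \<E> \<F> p dH dW" and BE: "wBE M p dW \<kappa>"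
  obtains c1 c2 c3 c4 c5 c6 D where "sub_gaussian_kernel M dH c1 c2 p dW \<kappa> c3 c4 c5 c6 D"
proof -
  interpret S: sub_gaussian_dirichlet_space M \<E> \<F> p dH dW by (rule space)
  obtain c1 c2 where c12: "dH > 0" "c1 > 0" "c2 > 0"
    "\<And>x r. r \<ge> 0 \<Longrightarrow> ennreal (c1 * r powr dH) \<le> emeasure M (ball x r)"
    "\<And>x r. r \<ge> 0 \<Longrightarrow> emeasure M (ball x r) \<le> ennreal (c2 * r powr dH)"
    using S.ahlfors unfolding ahlfors_regular_def by blast
  interpret ahlfors_space M dH c1 c2
    by unfold_locales (use c12 S.radon in auto)
  obtain P where "heat_semigroup M \<E> \<F> P"
    and PK: "\<And>t g. t > 0 \<Longrightarrow> g \<in> L2_space M \<Longrightarrow> AE x in M. P t g x = kernel_op M p t g x"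
    and cont: "\<And>t. t > 0 \<Longrightarrow> continuous_on UNIV (\<lambda>(x, y). p t x y)"
    using S.heat_kernel unfolding continuous_heat_kernel_def by blast
  then interpret H: dirichlet_heat_semigroup M \<E> \<F> P
    by (intro dirichlet_heat_semigroup.intro S.dirichlet_form_axioms)
  obtain c3 c4 c5 c6 where c: "c3 > 0" "c4 > 0" "c5 > 0" "c6 > 0"
    and bounds: "\<And>t. t > 0 \<Longrightarrow> AE (x, y) in M \<Otimes>\<^sub>M M.
        sub_gaussian dH dW c5 c6 t x y \<le> p t x y \<and> p t x y \<le> sub_gaussian dH dW c3 c4 t x y"
    using S.heat_kernel_bounds unfolding sub_gaussian_bounds_def by blast
  obtain D where \<kappa>: "0 < \<kappa>" "\<kappa> < dW" and D: "D > 0"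
    and BE': "\<And>t g x y. t > 0 \<Longrightarrow> g \<in> Linf_space M \<Longrightarrow>
      ereal \<bar>kernel_op M p t g x - kernel_op M p t g y\<bar>
          \<le> ereal (D * (dist x y powr \<kappa> / t powr (\<kappa> / dW))) * Linf_norm M g"
    using BE unfolding wBE_def by blast
  have pointwise: "sub_gaussian dH dW c5 c6 t x y \<le> p t x y \<and> p t x y \<le> sub_gaussian dH dW c3 c4 t x y"
    if t: "t > 0" for t x y
  proof (rule AE_pair_closed[OF bounds[OF t]])
    have "continuous_on UNIV (\<lambda>z. p t (fst z) (snd z))" using cont[OF t] by (simp add: case_prod_unfold)
    then show "closed {z. sub_gaussian dH dW c5 c6 t (fst z) (snd z) \<le> p t (fst z) (snd z) \<and>
        p t (fst z) (snd z) \<le> sub_gaussian dH dW c3 c4 t (fst z) (snd z)}"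
      using S.dW_gt_2 t by (intro closed_Collect_conj closed_Collect_le continuous_on_sub_gaussian) auto
  qed
  have weak_BE: "\<bar>kernel_op M p t g x - kernel_op M p t g y\<bar> \<le> D * (dist x y powr \<kappa> / t powr (\<kappa> / dW)) * b"
    if t: "t > 0" and g: "g \<in> borel_measurable M" "\<And>x. \<bar>g x\<bar> \<le> b" for t g b x y
  proof -
    have "Linf_norm M g \<le> ereal b"
      unfolding Linf_norm_def using g by (intro esssup_I) auto
    moreover from this have "Linf_norm M g < \<infinity>" by (rule order_le_less_trans) simp
    ultimately have "ereal \<bar>kernel_op M p t g x - kernel_op M p t g y\<bar>
        \<le> ereal (D * (dist x y powr \<kappa> / t powr (\<kappa> / dW))) * ereal b"
      using g(1) D by (intro order_trans[OF BE'[OF t]] ereal_mult_left_mono) (auto simp: Linf_space_def)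
    then show ?thesis by simp
  qed
  have K_measurable: "kernel_op M p t u \<in> borel_measurable M"
    if t: "t > 0" and u: "u \<in> borel_measurable M" "\<And>x. \<bar>u x\<bar> \<le> b" for t u b
  proof -
    have "continuous_on UNIV (kernel_op M p t u)"
    proof (rule Holder_continuous[OF \<kappa>(1)])
      show "\<bar>kernel_op M p t u x - kernel_op M p t u y\<bar> \<le> D * b / t powr (\<kappa> / dW) * dist x y powr \<kappa>" for x y
        using weak_BE[OF t u] by (simp add: mult_ac)
    qed
    from borel_measurable_continuous_onI[OF this] show ?thesis
      using measurable_cong_sets[OF sets_M refl] by blast
  qed
  have K_L2: "kernel_op M p t u \<in> L2_space M"
    if t: "t > 0" and u: "u \<in> L2_space M" "\<And>x. \<bar>u x\<bar> \<le> b" for t u b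
  proof -
    note m = K_measurable[OF t L2_spaceD(1)[OF u(1)] u(2)]
    note P = L2_spaceD[OF H.P_L2[OF t u(1)]]
    have "AE x in M. (P t u x)\<^sup>2 = (kernel_op M p t u x)\<^sup>2"
      using PK[OF t u(1)] by eventually_elim simp
    then have "integrable M (\<lambda>x. (kernel_op M p t u x)\<^sup>2)"
      by (rule integrable_cong_AE_imp[OF P(2) borel_measurable_power[OF m]])
    with m show ?thesis by (simp add: L2_space_def)
  qed
  have "sub_gaussian_kernel M dH c1 c2 p dW \<kappa> c3 c4 c5 c6 D"
  proof unfold_locales
    fix t b b' :: real and u v :: "'a \<Rightarrow> real" assume t: "0 < t" and u: "u \<in> L2_space M" "\<And>x. \<bar>u x\<bar> \<le> b"
      and v: "v \<in> L2_space M" "\<And>x. \<bar>v x\<bar> \<le> b'"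
    have "(\<integral>x. kernel_op M p t u x * v x \<partial>M) = (\<integral>x. P t u x * v x \<partial>M)"
    proof (intro H.L2_integral_mult_cong_AE K_L2[OF t u] H.P_L2 t u v)
      show "AE x in M. kernel_op M p t u x = P t u x" using PK[OF t u(1)] by eventually_elim simp
    qed
    also have "\<dots> = (\<integral>x. u x * P t v x \<partial>M)" by (rule H.P_symmetric[OF t u(1) v(1)])
    also have "\<dots> = (\<integral>x. P t v x * u x \<partial>M)" by (simp add: mult.commute)
    also have "\<dots> = (\<integral>x. kernel_op M p t v x * u x \<partial>M)"
      by (intro H.L2_integral_mult_cong_AE PK K_L2[OF t v] H.P_L2 t u v)
    finally show "(\<integral>x. kernel_op M p t u x * v x \<partial>M) = (\<integral>x. u x * kernel_op M p t v x \<partial>M)"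
      by (simp add: mult.commute)
  next
    fix s t b :: real and u :: "'a \<Rightarrow> real" assume s: "0 < s" and t: "0 < t" and u: "u \<in> L2_space M" "\<And>x. \<bar>u x\<bar> \<le> b"
    have st: "s + t > 0" using s t by simp
    \<comment> \<open>\<open>P s\<close> meets two representatives of the same class,
      \<open>P t u\<close> and \<open>kernel_op M p t u\<close>; \<open>P_AE\<close> identifies the
      results, with \<open>K_L2\<close> making the second one an admissible argument.\<close>
    show "AE x in M. kernel_op M p (s + t) u x = kernel_op M p s (kernel_op M p t u) x"
      using PK[OF st u(1)] H.P_semigroup[OF s t u(1)] PK[OF s K_L2[OF t u]]
        H.P_AE[OF s H.P_L2[OF t u(1)] K_L2[OF t u] PK[OF t u(1)]]
      by eventually_elim simp
  next
    fix t b :: real and u :: "'a \<Rightarrow> real"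
    assume "0 < t" "u \<in> L2_space M" "\<And>x. \<bar>u x\<bar> \<le> b"
    then show "kernel_op M p t u \<in> L2_space M" by (rule K_L2)
  qed (use S.dW_gt_2 \<kappa> c D cont pointwise weak_BE in auto)
  then show ?thesis by (rule that)
qed

theorem theorem4p17:
  fixes M :: "'a::metric_space measure"
    and \<E> :: "('a \<Rightarrow> real) \<Rightarrow> ('a \<Rightarrow> real) \<Rightarrow> real"
    and \<F> :: "('a \<Rightarrow> real) set"
    and p :: "real \<Rightarrow> 'a \<Rightarrow> 'a \<Rightarrow> real"
    and dH dW \<kappa> :: real
  assumes "sub_gaussian_dirichlet_space M \<E> \<F> p dH dW"
    and "wBE M p dW \<kappa>"
    and "ereal \<kappa> = ereal dW - critical_exponent M"
  shows "(\<exists>C::real. C > 0 \<and> (\<forall>E \<in> sets borel.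
             perimeter M E \<le> ennreal C * lower_minkowski_content M (dW - \<kappa>) E)) \<and>
         (\<forall>E \<in> sets borel. emeasure M E < \<infinity> \<longrightarrow>
             lower_minkowski_content M (dW - \<kappa>) E < \<infinity> \<longrightarrow> finite_perimeter M E)"
proof -
  obtain c1 c2 c3 c4 c5 c6 D where "sub_gaussian_kernel M dH c1 c2 p dW \<kappa> c3 c4 c5 c6 D"
    using sub_gaussian_kernel_exists[OF assms(1,2)] .
  then interpret sub_gaussian_kernel M dH c1 c2 p dW \<kappa> c3 c4 c5 c6 D .
  \<comment> \<open>A real \<kappa> excludes an infinite critical exponent, so
    \<open>real_of_ereal\<close> does not fall back on its default value.\<close>
  have crit: "real_of_ereal (critical_exponent M) = dW - \<kappa>"
    using assms(3) by (cases "critical_exponent M") auto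
  have le: "perimeter M E \<le> lower_minkowski_content M (dW - \<kappa>) E" if "E \<in> sets borel" for E
    unfolding perimeter_def BV_variation_def crit by (rule Liminf_KS_energy_le_content[OF that])
  have "finite_perimeter M E"
    \<comment> \<open>BV functions are integrable, hence the finite measure: for E the whole space
      the content is 0, but the measure is infinite.\<close>
    if E: "E \<in> sets borel" "emeasure M E < \<infinity>" and content: "lower_minkowski_content M (dW - \<kappa>) E < \<infinity>" for E
  proof -
    have "Liminf (at_right 0) (KS_energy M (dW - \<kappa>) (indicator E)) < \<infinity>"
      using Liminf_KS_energy_le_content[OF E(1)] content by (rule le_less_trans)
    then have "Limsup (at_right 0) (KS_energy M (dW - \<kappa>) (indicator E)) < \<infinity>"
      by (rule KS_energy_bounded[OF E])
    moreover have "integrable M (indicat_real E)" using E by (simp add: integrable_indicator_iff)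
    ultimately show ?thesis
      using E(1) unfolding finite_perimeter_def BV_space_def KS_space_def crit by simp
  qed
  with le show ?thesis by (intro conjI exI[of _ 1]) auto
qed

end
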